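(* Let $F$ be a field with $\operatorname{char}(F)\ne 2$ and let $A$ be a unital associative $F$-algebra. (a) If $A=K(A)$, then, for any commutative unital $F$-algebra $C$ and any $F$-algebra $B$, every surjective Jordan homomorphism $\varphi:A\otimes C\to B$ is standard. (b) If $A=K(A)$, then, for any commutative unital $F$-algebra $C$ and any $F$-algebra $B$, every Jordan homomorphism $\varphi:A\otimes C\to B$ is nearly-standard. (c) If $A\neq K(A)$, then there exist a commutative unital $F$-algebra $C$, an $F$-algebra $B$, and a Jordan homomorphism $\varphi:A\otimes C\to B$ that is not standard. (d) If $A\neq K(A)+Z(A)$, then there exist a commutative unital $F$-algebra $C$, an $F$-algebra $B$, and a Jordan homomorphism $\varphi:A\otimes C\to B$ that is not nearly-standard.
   Context: All algebras are associative over $F$, not assumed unital unless stated; $\otimes=\otimes_F$. $K(A)$ is the commutator ideal of $A$ (the ideal generated by all $[x,y]=xy-yx$), $Z(A)$ is the center of $A$. A Jordan homomorphism $\varphi:A\to B$ is an $F$-linear map with $\varphi(x\circ y)=\varphi(x)\circ\varphi(y)$ for all $x,y$, where $x\circ y=xy+yx$. A Jordan homomorphism $\varphi:A\to B$ is standard if there exist a homomorphism $\varphi_1:A\to B$ and an antihomomorphism $\varphi_2:A\to B$ such that $\varphi=\varphi_1+\varphi_2$ and $\varphi_1(A)\varphi_2(A)=\varphi_2(A)\varphi_1(A)=(0)$. It is nearly-standard if there exist mappings $\varphi_1,\varphi_2:A\to B$ (not assumed to be homomorphisms or antihomomorphisms) such that $\varphi=\varphi_1+\varphi_2$ and $\varphi(xy)=\varphi(x)\varphi_1(y)+\varphi_2(y)\varphi(x)$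 for all $x,y\in A$. *)

theory Defs
  imports "HOL-Algebra.Algebra"
begin

definition ring_char :: "('a, 'm) ring_scheme \<Rightarrow> nat" where
  "ring_char R =
    (if \<exists>n::nat. n > 0 \<and> [n] \<cdot>\<^bsub>R\<^esub> \<one>\<^bsub>R\<^esub> = \<zero>\<^bsub>R\<^esub> then LEAST n::nat. n > 0 \<and> [n] \<cdot>\<^bsub>R\<^esub> \<one>\<^bsub>R\<^esub> = \<zero>\<^bsub>R\<^esub> else 0)"


section \<open>Algebras over a field\<close>

text \<open>
  The library locale \<^locale>\<open>algebra\<close> describes commutative unital algebras only. In the following
  locale neither commutativity nor the existence of a unit is required; nothing is assumed about
  the \<^const>\<open>one\<close> field of the record.
\<close>

locale assoc_algebra = field F + module F A for F (structure) and A (structure) +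
  assumes mult_closed: "\<lbrakk>x \<in> carrier A; y \<in> carrier A\<rbrakk> \<Longrightarrow> x \<otimes>\<^bsub>A\<^esub> y \<in> carrier A"
    and mult_assoc: "\<lbrakk>x \<in> carrier A; y \<in> carrier A; z \<in> carrier A\<rbrakk> \<Longrightarrow>
      (x \<otimes>\<^bsub>A\<^esub> y) \<otimes>\<^bsub>A\<^esub> z = x \<otimes>\<^bsub>A\<^esub> (y \<otimes>\<^bsub>A\<^esub> z)"
    and mult_l_distr: "\<lbrakk>x \<in> carrier A; y \<in> carrier A; z \<in> carrier A\<rbrakk> \<Longrightarrow>
      (x \<oplus>\<^bsub>A\<^esub> y) \<otimes>\<^bsub>A\<^esub> z = x \<otimes>\<^bsub>A\<^esub> z \<oplus>\<^bsub>A\<^esub> y \<otimes>\<^bsub>A\<^esub> z"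
    and mult_r_distr: "\<lbrakk>x \<in> carrier A; y \<in> carrier A; z \<in> carrier A\<rbrakk> \<Longrightarrow>
      z \<otimes>\<^bsub>A\<^esub> (x \<oplus>\<^bsub>A\<^esub> y) = z \<otimes>\<^bsub>A\<^esub> x \<oplus>\<^bsub>A\<^esub> z \<otimes>\<^bsub>A\<^esub> y"
    and smult_mult_l: "\<lbrakk>k \<in> carrier F; x \<in> carrier A; y \<in> carrier A\<rbrakk> \<Longrightarrow>
      (k \<odot>\<^bsub>A\<^esub> x) \<otimes>\<^bsub>A\<^esub> y = k \<odot>\<^bsub>A\<^esub> (x \<otimes>\<^bsub>A\<^esub> y)"
    and smult_mult_r: "\<lbrakk>k \<in> carrier F; x \<in> carrier A; y \<in> carrier A\<rbrakk> \<Longrightarrow>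
      x \<otimes>\<^bsub>A\<^esub> (k \<odot>\<^bsub>A\<^esub> y) = k \<odot>\<^bsub>A\<^esub> (x \<otimes>\<^bsub>A\<^esub> y)"

locale unital_assoc_algebra = assoc_algebra + monoid A

text \<open>
  \<^const>\<open>genideal\<close> produces the two-sided ring ideal generated by a set. In a unital algebra every
  ring ideal is a subspace, so this is also the algebra ideal generated by the set.
\<close>

definition commutator_ideal :: "('a, 'm) ring_scheme \<Rightarrow> 'a set" where
  "commutator_ideal A =
    Idl\<^bsub>A\<^esub> {x \<otimes>\<^bsub>A\<^esub> y \<ominus>\<^bsub>A\<^esub> y \<otimes>\<^bsub>A\<^esub> x | x y. x \<in> carrier A \<and> y \<in> carrier A}"

definition algebra_center :: "('a, 'm) ring_scheme \<Rightarrow> 'a set" where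
  "algebra_center A = {z \<in> carrier A. \<forall>x \<in> carrier A. z \<otimes>\<^bsub>A\<^esub> x = x \<otimes>\<^bsub>A\<^esub> z}"


section \<open>Tensor product of algebras\<close>

text \<open>
  The free \<open>F\<close>-module on the carrier of a monoid \<open>G\<close> (finitely supported functions), with the
  convolution product that extends the product of \<open>G\<close> bilinearly.
\<close>

definition monoid_algebra ::
  "('f, 'm) ring_scheme \<Rightarrow> ('g, 'n) monoid_scheme \<Rightarrow> ('f, 'g \<Rightarrow> 'f) module" where
  "monoid_algebra F G =
    \<lparr>carrier = {u. (\<forall>x \<in> carrier G. u x \<in> carrier F) \<and> (\<forall>x. x \<notin> carrier G \<longrightarrow> u x = \<zero>\<^bsub>F\<^esub>)
        \<and> finite {x. u x \<noteq> \<zero>\<^bsub>F\<^esub>}},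
     monoid.mult = (\<lambda>u v x.
        \<Oplus>\<^bsub>F\<^esub>r \<in> {(p, q). u p \<noteq> \<zero>\<^bsub>F\<^esub> \<and> v q \<noteq> \<zero>\<^bsub>F\<^esub> \<and> p \<otimes>\<^bsub>G\<^esub> q = x}.
          u (fst r) \<otimes>\<^bsub>F\<^esub> v (snd r)),
     one = (\<lambda>x. if x = \<one>\<^bsub>G\<^esub> then \<one>\<^bsub>F\<^esub> else \<zero>\<^bsub>F\<^esub>),
     ring.zero = (\<lambda>x. \<zero>\<^bsub>F\<^esub>),
     ring.add = (\<lambda>u v x. u x \<oplus>\<^bsub>F\<^esub> v x),
     smult = (\<lambda>k u x. k \<otimes>\<^bsub>F\<^esub> u x)\<rparr>"

definition basis_elt :: "('f, 'm) ring_scheme \<Rightarrow> 'g \<Rightarrow> 'g \<Rightarrow> 'f" where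
  "basis_elt F x = (\<lambda>y. if y = x then \<one>\<^bsub>F\<^esub> else \<zero>\<^bsub>F\<^esub>)"

definition module_span ::
  "('f, 'm) ring_scheme \<Rightarrow> ('f, 'x, 'n) module_scheme \<Rightarrow> 'x set \<Rightarrow> 'x set" where
  "module_span F M S = \<Inter>{N. submodule N F M \<and> S \<subseteq> N}"

definition bilinear_relations ::
  "('f, 'm) ring_scheme \<Rightarrow> ('f, 'a, 'n) module_scheme \<Rightarrow> ('f, 'c, 'k) module_scheme
    \<Rightarrow> ('a \<times> 'c \<Rightarrow> 'f) set" where
  "bilinear_relations F A C =
    (let P = monoid_algebra F (A \<times>\<times> C); e = basis_elt F in
      {e (a \<oplus>\<^bsub>A\<^esub> a', c) \<ominus>\<^bsub>P\<^esub> (e (a, c) \<oplus>\<^bsub>P\<^esub> e (a', c)) | a a' c.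
        a \<in> carrier A \<and> a' \<in> carrier A \<and> c \<in> carrier C}
    \<union> {e (a, c \<oplus>\<^bsub>C\<^esub> c') \<ominus>\<^bsub>P\<^esub> (e (a, c) \<oplus>\<^bsub>P\<^esub> e (a, c')) | a c c'.
        a \<in> carrier A \<and> c \<in> carrier C \<and> c' \<in> carrier C}
    \<union> {e (k \<odot>\<^bsub>A\<^esub> a, c) \<ominus>\<^bsub>P\<^esub> k \<odot>\<^bsub>P\<^esub> e (a, c) | k a c.
        k \<in> carrier F \<and> a \<in> carrier A \<and> c \<in> carrier C}
    \<union> {e (a, k \<odot>\<^bsub>C\<^esub> c) \<ominus>\<^bsub>P\<^esub> k \<odot>\<^bsub>P\<^esub> e (a, c) | k a c.
        k \<in> carrier F \<and> a \<in> carrier A \<and> c \<in> carrier C})"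

text \<open>
  The usual construction of \<open>A \<otimes>\<^sub>F C\<close>: the free module on \<open>A \<times> C\<close> modulo the span \<open>N\<close> of the
  bilinearity relations, with product determined by \<open>(a \<otimes> c)(a' \<otimes> c') = aa' \<otimes> cc'\<close>. The product of
  a relation with a basis element is again a relation, so \<open>N\<close> is an ideal and the product
  of cosets is well defined.
\<close>

definition tensor_algebra ::
  "('f, 'm) ring_scheme \<Rightarrow> ('f, 'a, 'n) module_scheme \<Rightarrow> ('f, 'c, 'k) module_scheme
    \<Rightarrow> ('f, ('a \<times> 'c \<Rightarrow> 'f) set) module" where
  "tensor_algebra F A C =
    (let P = monoid_algebra F (A \<times>\<times> C);
         N = module_span F P (bilinear_relations F A C);
         Q = P Quot N
     in \<lparr>carrier = carrier Q, monoid.mult = monoid.mult Q, one = one Q, ring.zero = ring.zero Q,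
         ring.add = ring.add Q,
         smult = (\<lambda>k S. \<Union>u \<in> S. N +>\<^bsub>P\<^esub> (k \<odot>\<^bsub>P\<^esub> u))\<rparr>)"


section \<open>Jordan homomorphisms\<close>

definition linear_map ::
  "('f, 'm) ring_scheme \<Rightarrow> ('f, 'a, 'n) module_scheme \<Rightarrow> ('f, 'b, 'k) module_scheme
    \<Rightarrow> ('a \<Rightarrow> 'b) \<Rightarrow> bool" where
  "linear_map F A B f \<longleftrightarrow>
    f \<in> carrier A \<rightarrow> carrier B \<and>
    (\<forall>x \<in> carrier A. \<forall>y \<in> carrier A. f (x \<oplus>\<^bsub>A\<^esub> y) = f x \<oplus>\<^bsub>B\<^esub> f y) \<and>
    (\<forall>k \<in> carrier F. \<forall>x \<in> carrier A. f (k \<odot>\<^bsub>A\<^esub> x) = k \<odot>\<^bsub>B\<^esub> f x)"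

definition algebra_hom ::
  "('f, 'm) ring_scheme \<Rightarrow> ('f, 'a, 'n) module_scheme \<Rightarrow> ('f, 'b, 'k) module_scheme
    \<Rightarrow> ('a \<Rightarrow> 'b) \<Rightarrow> bool" where
  "algebra_hom F A B f \<longleftrightarrow> linear_map F A B f \<and>
    (\<forall>x \<in> carrier A. \<forall>y \<in> carrier A. f (x \<otimes>\<^bsub>A\<^esub> y) = f x \<otimes>\<^bsub>B\<^esub> f y)"

definition algebra_antihom ::
  "('f, 'm) ring_scheme \<Rightarrow> ('f, 'a, 'n) module_scheme \<Rightarrow> ('f, 'b, 'k) module_scheme
    \<Rightarrow> ('a \<Rightarrow> 'b) \<Rightarrow> bool" where
  "algebra_antihom F A B f \<longleftrightarrow> linear_map F A B f \<and>
    (\<forall>x \<in> carrier A. \<forall>y \<in> carrier A. f (x \<otimes>\<^bsub>A\<^esub> y) = f y \<otimes>\<^bsub>B\<^esub> f x)"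

definition jordan_product :: "('a, 'm) ring_scheme \<Rightarrow> 'a \<Rightarrow> 'a \<Rightarrow> 'a" where
  "jordan_product A x y = x \<otimes>\<^bsub>A\<^esub> y \<oplus>\<^bsub>A\<^esub> y \<otimes>\<^bsub>A\<^esub> x"

definition jordan_hom ::
  "('f, 'm) ring_scheme \<Rightarrow> ('f, 'a, 'n) module_scheme \<Rightarrow> ('f, 'b, 'k) module_scheme
    \<Rightarrow> ('a \<Rightarrow> 'b) \<Rightarrow> bool" where
  "jordan_hom F A B f \<longleftrightarrow> linear_map F A B f \<and>
    (\<forall>x \<in> carrier A. \<forall>y \<in> carrier A.
      f (jordan_product A x y) = jordan_product B (f x) (f y))"

definition standard_map ::
  "('f, 'm) ring_scheme \<Rightarrow> ('f, 'a, 'n) module_scheme \<Rightarrow> ('f, 'b, 'k) module_scheme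
    \<Rightarrow> ('a \<Rightarrow> 'b) \<Rightarrow> bool" where
  "standard_map F A B f \<longleftrightarrow>
    (\<exists>f1 f2. algebra_hom F A B f1 \<and> algebra_antihom F A B f2 \<and>
      (\<forall>x \<in> carrier A. f x = f1 x \<oplus>\<^bsub>B\<^esub> f2 x) \<and>
      (\<forall>x \<in> carrier A. \<forall>y \<in> carrier A.
        f1 x \<otimes>\<^bsub>B\<^esub> f2 y = \<zero>\<^bsub>B\<^esub> \<and> f2 y \<otimes>\<^bsub>B\<^esub> f1 x = \<zero>\<^bsub>B\<^esub>))"

definition nearly_standard_map ::
  "('a, 'm) ring_scheme \<Rightarrow> ('b, 'n) ring_scheme \<Rightarrow> ('a \<Rightarrow> 'b) \<Rightarrow> bool" where
  "nearly_standard_map A B f \<longleftrightarrow>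
    (\<exists>f1 \<in> carrier A \<rightarrow> carrier B. \<exists>f2 \<in> carrier A \<rightarrow> carrier B.
      (\<forall>x \<in> carrier A. f x = f1 x \<oplus>\<^bsub>B\<^esub> f2 x) \<and>
      (\<forall>x \<in> carrier A. \<forall>y \<in> carrier A.
        f (x \<otimes>\<^bsub>A\<^esub> y) = f x \<otimes>\<^bsub>B\<^esub> f1 y \<oplus>\<^bsub>B\<^esub> f2 y \<otimes>\<^bsub>B\<^esub> f x))"

text \<open>
  HOL cannot quantify existentially over types, so a statement asserting the existence of an algebra
  has to fix the type of its elements. These two types are large enough for finite and countable
  direct products of copies of \<open>F\<close> and, respectively, of subquotients of \<open>A\<close> (an element of \<open>A\<close>
  is represented by a coset).
\<close>

type_synonym 'f scalar_seq = "nat \<Rightarrow> 'f"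
type_synonym 'a coset_seq = "nat \<Rightarrow> 'a set"

end

theory Submission
  imports Defs
begin

text \<open>
  Let \<open>R = A \<otimes> C\<close>. The defects \<open>\<alpha>(a, b) = \<phi>(ab) - \<phi>(a)\<phi>(b)\<close> and \<open>\<beta>(a, b) = \<phi>(ab) - \<phi>(b)\<phi>(a)\<close> satisfy
  \<open>\<phi>(x[a, b]) = \<phi>(x)\<beta>(a, b) + \<alpha>(a, b)\<phi>(x)\<close>. Sandwich identities for these defects show that
  \<open>\<alpha>(c, d)\<phi>(x)\<beta>(a, b)\<^sup>9 = 0\<close> for all \<open>a, b, c, d, x\<close>. The elements \<open>y\<close> for which
  \<open>\<phi>(xy) = \<phi>(x)p + q\<phi>(x)\<close> and \<open>\<phi>(yx) = p\<phi>(x) + \<phi>(x)q\<close> with \<open>p\<close> annihilating all \<open>\<alpha>\<close> and \<open>q\<close> all \<open>\<beta>\<close>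
  form an ideal of \<open>R\<close> containing the ninth powers of commutators. A prime ideal above it
  contains all commutators by Levitzki's theorem, which is impossible when \<open>R = K(R)\<close>; so the ideal
  contains \<open>1\<close>, and the corresponding \<open>p\<close>, \<open>q\<close> are complementary central idempotents that split
  \<open>\<phi>\<close>. Standard maps are nearly standard.

  For the converse parts, let \<open>C = F1 + Fx + Fy\<close> with \<open>x\<^sup>2 = y\<^sup>2 = xy = 0\<close>, let \<open>B\<close> be the exterior algebra
  over \<open>A\<close> on \<open>e\<^sub>1, e\<^sub>2\<close> with the \<open>e\<^sub>1e\<^sub>2\<close>-coefficient reduced modulo \<open>K(A)\<close>, and let \<open>\<phi>\<close> send
  \<open>1, x, y\<close> to \<open>1, e\<^sub>1, e\<^sub>2\<close>. Evaluating a decomposition of \<open>\<phi>\<close> at \<open>b \<otimes> x\<close> against \<open>A \<otimes> 1\<close> and \<open>1 \<otimes> y\<close>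
  gives \<open>b = p + q\<close> with \<open>q\<close> central and \<open>p - q \<in> K(A)\<close>. If \<open>\<phi>\<close> is standard and \<open>b = 1\<close>, then \<open>p\<close> and \<open>q\<close>
  are orthogonal idempotents, so \<open>1 = (p - q)\<^sup>2 \<in> K(A)\<close>.
\<close>

subsection \<open>Defects of a Jordan homomorphism\<close>

text \<open>The sandwich identities control a single letter \<open>\<phi> x\<close> between two
  defects, but a product \<open>\<phi> x * \<phi> y\<close> need not be a value of
  \<open>\<phi>\<close>, and expanding a defect creates such products. The argument therefore treats
  whole words in values of \<open>\<phi>\<close> and pays for each extra letter with one more factor
  \<open>\<beta> a b\<close> on the right. The exponent 9 records this cost: 2 beyond the word
  length for defects of one pair, 2 because an inserted defect opens into two letters, 1 to reach a
  pair sharing an argument with \<open>a, b\<close>, then 2 and 1 again to reach an arbitrary pair,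
  and 1 for the letter \<open>\<phi> x\<close>. Only powers of commutators are obtained in this way,
  whence the detour through prime ideals: modulo a prime ideal, commutators that are nil of bounded
  index are zero. In the converse parts \<open>x\<close> and \<open>y\<close> multiply to zero while
  their images merely anticommute. For commutative \<open>A\<close> Jordan products would not notice
  the difference; in general they leave multiples of commutators at
  \<open>e\<^sub>1e\<^sub>2\<close>, and the reduction modulo \<open>K(A)\<close> removes
  these.\<close>

text \<open>
  The unit of the codomain need not be \<open>\<phi> 1\<close>, and 2-torsion is excluded only in the corner of \<open>\<phi> 1\<close>,
  so that the codomain may be a product in which \<open>\<phi>\<close> lives in a single factor.
\<close>

locale jordan_unital =
  fixes \<phi> :: "'r::{Rings.ring,monoid_mult} \<Rightarrow> 'u::{Rings.ring,monoid_mult}"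
  assumes add: "\<phi> (x + y) = \<phi> x + \<phi> y"
    and jordan: "\<phi> (x * y + y * x) = \<phi> x * \<phi> y + \<phi> y * \<phi> x"
    and one_l: "\<phi> 1 * \<phi> x = \<phi> x"
    and one_r: "\<phi> x * \<phi> 1 = \<phi> x"
    and torsion_free: "\<phi> 1 * t = t \<Longrightarrow> t * \<phi> 1 = t \<Longrightarrow> t + t = 0 \<Longrightarrow> t = 0"
begin

section \<open>Squares, triples and Lie triples\<close>

lemma zero [simp]: "\<phi> 0 = 0"
  using add[of 0 0] by simp

lemma minus: "\<phi> (- x) = - \<phi> x"
  using add[of x "- x"] by (simp add: eq_neg_iff_add_eq_0 add.commute)

lemma diff: "\<phi> (x - y) = \<phi> x - \<phi> y"
  using add[of x "- y"] by (simp add: minus)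

lemma one_l': "\<phi> 1 * (\<phi> x * t) = \<phi> x * t"
  by (simp add: one_l flip: mult.assoc)

lemma one_r': "\<phi> x * (\<phi> 1 * t) = \<phi> x * t"
  by (simp add: one_r flip: mult.assoc)

lemmas unit_simps = one_l one_r one_l' one_r'

text \<open>Halving is available only in the corner of \<open>\<phi> 1\<close>, so each use has to
  check that both sides are fixed by \<open>\<phi> 1\<close>.\<close>

lemma cancel2:
  assumes "p + p = q + q" "\<phi> 1 * p = p" "\<phi> 1 * q = q" "p * \<phi> 1 = p" "q * \<phi> 1 = q"
  shows "p = q"
proof -
  have "(p - q) + (p - q) = 0" using assms(1) by (simp add: algebra_simps)
  moreover have "\<phi> 1 * (p - q) = p - q" "(p - q) * \<phi> 1 = p - q"
    using assms by (simp_all add: algebra_simps)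
  ultimately show ?thesis using torsion_free[of "p - q"] by simp
qed

lemma square: "\<phi> (x * x) = \<phi> x * \<phi> x"
  by (rule cancel2) (use jordan[of x x] in \<open>simp_all add: add unit_simps mult.assoc\<close>)

lemma triple: "\<phi> (x * y * x) = \<phi> x * \<phi> y * \<phi> x"
proof (rule cancel2)
  \<comment> \<open>With \<open>o\<close> for the Jordan product,
    \<open>2xyx = x o (x o y) - x^2 o y\<close>; this makes \<open>xyx\<close> accessible to
    \<open>\<phi>\<close>.\<close>
  have "x * y * x + x * y * x = (x * (x * y + y * x) + (x * y + y * x) * x) - (x * x * y + y * (x * x))"
    by (simp add: algebra_simps)
  then have "\<phi> (x * y * x + x * y * x) =
      \<phi> (x * (x * y + y * x) + (x * y + y * x) * x) - \<phi> (x * x * y + y * (x * x))"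
    by (simp only: diff)
  also have "\<dots> = \<phi> x * \<phi> y * \<phi> x + \<phi> x * \<phi> y * \<phi> x"
    by (simp only: jordan square) (simp add: algebra_simps)
  finally show "\<phi> (x * y * x) + \<phi> (x * y * x) = \<phi> x * \<phi> y * \<phi> x + \<phi> x * \<phi> y * \<phi> x"
    by (simp add: add)
qed (simp_all add: unit_simps mult.assoc)

lemma triple_sum: "\<phi> (x * y * z) + \<phi> (z * y * x) = \<phi> x * \<phi> y * \<phi> z + \<phi> z * \<phi> y * \<phi> x"
proof -
  have "\<phi> ((x + z) * y * (x + z)) = (\<phi> x + \<phi> z) * \<phi> y * (\<phi> x + \<phi> z)"
    by (simp only: triple add)
  then show ?thesis
    using triple[of x y] triple[of z y] by (simp add: algebra_simps add)
qed

text \<open>The double commutator is a Jordan expression,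
  \<open>[[a, b], x] = a o (b o x) - b o (a o x)\<close>, so \<open>\<phi>\<close> respects it
  although it need not respect \<open>[a, b]\<close>.\<close>

lemma lie_triple: "\<phi> ((a * b - b * a) * x - x * (a * b - b * a)) =
    (\<phi> a * \<phi> b - \<phi> b * \<phi> a) * \<phi> x - \<phi> x * (\<phi> a * \<phi> b - \<phi> b * \<phi> a)"
proof -
  have "(a * b - b * a) * x - x * (a * b - b * a) =
      (a * (b * x + x * b) + (b * x + x * b) * a) - (b * (a * x + x * a) + (a * x + x * a) * b)"
    by (simp add: algebra_simps)
  then have "\<phi> ((a * b - b * a) * x - x * (a * b - b * a)) =
      \<phi> (a * (b * x + x * b) + (b * x + x * b) * a) - \<phi> (b * (a * x + x * a) + (a * x + x * a) * b)"
    by (simp only: diff)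
  also have "\<dots> = (\<phi> a * \<phi> b - \<phi> b * \<phi> a) * \<phi> x - \<phi> x * (\<phi> a * \<phi> b - \<phi> b * \<phi> a)"
    by (simp only: jordan) (simp add: algebra_simps)
  finally show ?thesis .
qed

section \<open>Identities between the two defects\<close>

definition hom_defect :: "'r \<Rightarrow> 'r \<Rightarrow> 'u"  (\<open>\<alpha>\<close>)
  where "hom_defect a b = \<phi> (a * b) - \<phi> a * \<phi> b"

definition anti_defect :: "'r \<Rightarrow> 'r \<Rightarrow> 'u"  (\<open>\<beta>\<close>)
  where "anti_defect a b = \<phi> (a * b) - \<phi> b * \<phi> a"

lemma defect_unit:
  "\<phi> 1 * \<alpha> a b = \<alpha> a b" "\<alpha> a b * \<phi> 1 = \<alpha> a b" "\<phi> 1 * \<beta> a b = \<beta> a b" "\<beta> a b * \<phi> 1 = \<beta> a b"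
  by (simp_all add: hom_defect_def anti_defect_def algebra_simps unit_simps)

lemma defect_unit':
  "\<phi> 1 * (\<alpha> a b * t) = \<alpha> a b * t" "\<phi> 1 * (\<beta> a b * t) = \<beta> a b * t"
  by (simp_all add: defect_unit flip: mult.assoc)

lemma defect_add:
  "\<alpha> (a + a') b = \<alpha> a b + \<alpha> a' b" "\<alpha> a (b + b') = \<alpha> a b + \<alpha> a b'"
  "\<beta> (a + a') b = \<beta> a b + \<beta> a' b" "\<beta> a (b + b') = \<beta> a b + \<beta> a b'"
  by (simp_all add: hom_defect_def anti_defect_def algebra_simps add)

lemma defect_sum: "\<alpha> a b + \<beta> a b = \<phi> (a * b - b * a)"
  using jordan[of a b] by (simp add: hom_defect_def anti_defect_def diff add algebra_simps)

lemma defect_diff: "\<beta> a b - \<alpha> a b = \<phi> a * \<phi> b - \<phi> b * \<phi> a"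
  by (simp add: hom_defect_def anti_defect_def)

text \<open>The Jordan product with \<open>[a, b]\<close> gives the sum of the two left-hand sides
  and \<open>lie_triple\<close> their difference; subtracting and halving separates them.\<close>

lemma mult_commutator:
  "\<phi> (x * (a * b - b * a)) = \<phi> x * \<beta> a b + \<alpha> a b * \<phi> x" (is ?r)
  "\<phi> ((a * b - b * a) * x) = \<beta> a b * \<phi> x + \<phi> x * \<alpha> a b" (is ?l)
proof -
  let ?u = "a * b - b * a"
  have s: "\<phi> (x * ?u) + \<phi> (?u * x) = \<phi> x * (\<alpha> a b + \<beta> a b) + (\<alpha> a b + \<beta> a b) * \<phi> x"
    unfolding defect_sum by (simp only: jordan flip: add)
  have d: "\<phi> (?u * x) - \<phi> (x * ?u) = (\<beta> a b - \<alpha> a b) * \<phi> x - \<phi> x * (\<beta> a b - \<alpha> a b)"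
    unfolding defect_diff by (simp only: lie_triple flip: diff)
  have "\<phi> (x * ?u) + \<phi> (x * ?u) = (\<phi> x * \<beta> a b + \<alpha> a b * \<phi> x) + (\<phi> x * \<beta> a b + \<alpha> a b * \<phi> x)"
    using arg_cong2[OF s d, of "(-)"] by (simp add: algebra_simps)
  then show ?r
    by (rule cancel2) (simp_all add: algebra_simps unit_simps defect_unit defect_unit')
  then show ?l using s by (simp add: algebra_simps)
qed

text \<open>In the expanded product the outer terms are the images of \<open>abab\<close> and
  \<open>abba\<close>, by \<open>square\<close> and \<open>triple\<close>. The two middle terms are
  known only jointly, through \<open>triple_sum\<close>, and their sum cancels the outer
  ones.\<close>

lemma hom_anti_defect [simp]: "\<alpha> a b * \<beta> a b = 0"
proof -
  have "\<phi> a * \<phi> b * (\<phi> b * \<phi> a) = \<phi> (a * (b * b) * a)"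
    by (simp only: triple square) (simp add: mult.assoc)
  then show ?thesis
    using square[of "a * b"] triple_sum[of "a * b" b a]
    by (simp add: hom_defect_def anti_defect_def algebra_simps)
qed

text \<open>For \<open>u = [a, b]\<close> and \<open>v = [c, d]\<close>,
  \<open>mult_commutator\<close> evaluates the bracketings \<open>(ux)v\<close> and
  \<open>u(xv)\<close> differently; associativity forces the difference to vanish.\<close>

lemma defect_commutator_swap:
  "\<phi> x * (\<alpha> a b * \<beta> c d - \<beta> c d * \<alpha> a b) = (\<beta> a b * \<alpha> c d - \<alpha> c d * \<beta> a b) * \<phi> x"
proof -
  let ?u = "a * b - b * a" and ?v = "c * d - d * c"
  have "\<phi> ((?u * x) * ?v) = \<phi> (?u * (x * ?v))" by (simp only: mult.assoc)
  then show ?thesis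
    unfolding mult_commutator by (simp add: algebra_simps)
qed

lemma defect_commutator_eq:
  "\<alpha> a b * \<beta> c d - \<beta> c d * \<alpha> a b = \<beta> a b * \<alpha> c d - \<alpha> c d * \<beta> a b"
  using defect_commutator_swap[of 1 a b c d]
  by (simp add: algebra_simps defect_unit defect_unit')

lemma defect_commutator_central:
  "\<phi> x * (\<alpha> a b * \<beta> c d - \<beta> c d * \<alpha> a b) = (\<alpha> a b * \<beta> c d - \<beta> c d * \<alpha> a b) * \<phi> x"
  using defect_commutator_swap defect_commutator_eq by simp

text \<open>Commuting with values of \<open>\<phi>\<close> extends to products of values, hence to
  \<open>\<alpha> p q\<close>. This is what \<open>hom_word2\<close> needs.\<close>

lemma defect_commutator_central_defect:
  "\<alpha> p q * (\<alpha> a b * \<beta> c d - \<beta> c d * \<alpha> a b) = (\<alpha> a b * \<beta> c d - \<beta> c d * \<alpha> a b) * \<alpha> p q"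
proof -
  define z where "z = \<alpha> a b * \<beta> c d - \<beta> c d * \<alpha> a b"
  have c: "\<phi> x * z = z * \<phi> x" for x unfolding z_def by (rule defect_commutator_central)
  have "\<phi> p * \<phi> q * z = \<phi> p * (z * \<phi> q)" by (simp only: c mult.assoc)
  also have "\<dots> = z * (\<phi> p * \<phi> q)" by (simp only: c flip: mult.assoc)
  finally show ?thesis
    unfolding z_def[symmetric] hom_defect_def[of p q] left_diff_distrib right_diff_distrib c by simp
qed

lemma anti_hom_defect [simp]: "\<beta> a b * \<alpha> a b = 0"
proof -
  have "\<phi> 1 * (\<beta> a b * \<alpha> a b) = \<beta> a b * \<alpha> a b"
    "\<beta> a b * \<alpha> a b * \<phi> 1 = \<beta> a b * \<alpha> a b"
    by (simp_all add: defect_unit defect_unit' mult.assoc)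
  \<comment> \<open>As \<open>\<alpha> a b * \<beta> a b = 0\<close>, the case of equal pairs reads
    \<open>- t = t\<close> for \<open>t = \<beta> a b * \<alpha> a b\<close>.\<close>
  moreover have "\<beta> a b * \<alpha> a b + \<beta> a b * \<alpha> a b = 0"
    using defect_commutator_eq[of a b a b] by (simp add: neg_eq_iff_add_eq_0)
  ultimately show ?thesis by (rule torsion_free)
qed

lemma defect_mult_0 [simp]: "\<alpha> a b * (\<beta> a b * t) = 0" "\<beta> a b * (\<alpha> a b * t) = 0"
  by (simp_all flip: mult.assoc)

text \<open>The polarization of \<open>\<alpha> a b * \<beta> a b\<close> in the pair
  \<open>(a, b)\<close>. Defects are bilinear in the pair, so the vanishing of that product yields
  zero only for two pairs sharing an argument in the same place.\<close>

definition mixed :: "'r \<Rightarrow> 'r \<Rightarrow> 'r \<Rightarrow> 'r \<Rightarrow> 'u"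
  where "mixed a b c d = \<alpha> a b * \<beta> c d + \<alpha> c d * \<beta> a b"

text \<open>Evaluates \<open>uxv + vxu\<close>, for the two commutators \<open>u\<close> and
  \<open>v\<close>, once by \<open>triple_sum\<close> and once by \<open>mult_commutator\<close> at
  both ends. Terms enclosed by two defects of the same kind cancel.\<close>

lemma sandwich:
  "\<alpha> a b * \<phi> x * \<beta> c d + \<beta> a b * \<phi> x * \<alpha> c d + \<alpha> c d * \<phi> x * \<beta> a b + \<beta> c d * \<phi> x * \<alpha> a b =
    \<phi> x * mixed a b c d + mixed a b c d * \<phi> x"
proof -
  let ?u = "a * b - b * a" and ?v = "c * d - d * c"
  have "\<phi> ((?u * x) * ?v) + \<phi> ((?v * x) * ?u) =
      (\<alpha> a b + \<beta> a b) * \<phi> x * (\<alpha> c d + \<beta> c d) + (\<alpha> c d + \<beta> c d) * \<phi> x * (\<alpha> a b + \<beta> a b)"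
    by (simp only: triple_sum defect_sum)
  then show ?thesis
    unfolding mult_commutator mixed_def by (simp add: algebra_simps)
qed

lemma mixed_eq: "mixed a b c d = \<beta> a b * \<alpha> c d + \<beta> c d * \<alpha> a b"
proof -
  have "mixed a b c d + mixed a b c d = \<alpha> a b * \<beta> c d + \<alpha> c d * \<beta> a b + (\<beta> a b * \<alpha> c d + \<beta> c d * \<alpha> a b)"
    using sandwich[of a b 1 c d] by (simp add: mixed_def algebra_simps defect_unit defect_unit')
  then show ?thesis by (simp add: mixed_def)
qed

lemma sandwich_same: "\<beta> a b * \<phi> x * \<alpha> a b = - (\<alpha> a b * \<phi> x * \<beta> a b)"
proof -
  have "(\<alpha> a b * \<phi> x * \<beta> a b + \<beta> a b * \<phi> x * \<alpha> a b) + (\<alpha> a b * \<phi> x * \<beta> a b + \<beta> a b * \<phi> x * \<alpha> a b) = 0"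
    using sandwich[of a b x a b] by (simp add: mixed_def algebra_simps)
  then have "\<alpha> a b * \<phi> x * \<beta> a b + \<beta> a b * \<phi> x * \<alpha> a b = 0"
    by (rule torsion_free[rotated 2]) (simp_all add: algebra_simps defect_unit defect_unit')
  then show ?thesis by (simp add: eq_neg_iff_add_eq_0 add.commute)
qed

lemma mixed_left [simp]: "mixed a b a e = 0"
proof -
  have "\<alpha> a (b + e) * \<beta> a (b + e) = 0" by simp
  then show ?thesis by (simp add: defect_add mixed_def algebra_simps)
qed

lemma mixed_right [simp]: "mixed a b f b = 0"
proof -
  have "\<alpha> (a + f) b * \<beta> (a + f) b = 0" by simp
  then show ?thesis by (simp add: defect_add mixed_def algebra_simps)
qed

lemma mixed_add:
  "mixed (a + a') b c d = mixed a b c d + mixed a' b c d"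
  "mixed a b (c + c') d = mixed a b c d + mixed a b c' d"
  by (simp_all add: mixed_def defect_add algebra_simps)

text \<open>Linearizing \<open>mixed_left\<close> in its repeated argument gives this skew symmetry.
  It trades an arbitrary pair for pairs that share an argument with the given one, the key to
  \<open>mixed_word\<close>.\<close>

lemma mixed_exchange: "mixed a b f e = - mixed f b a e"
proof -
  have "mixed (a + f) b (a + f) e = 0" by simp
  then show ?thesis
    unfolding mixed_add by (simp add: eq_neg_iff_add_eq_0 add.commute)
qed

section \<open>Words of values between two defects\<close>

abbreviation word :: "'r list \<Rightarrow> 'u"
  where "word cs \<equiv> prod_list (map \<phi> cs)"

text \<open>\<open>sandwich_same\<close> brings \<open>\<alpha> a b\<close> to the right end, where
  the second factor \<open>\<beta> a b\<close> annihilates it.\<close>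

lemma hom_word1: "\<alpha> a b * \<phi> c * \<beta> a b ^ 2 = 0"
proof -
  have "\<alpha> a b * \<phi> c * \<beta> a b = - (\<beta> a b * \<phi> c * \<alpha> a b)"
    by (simp add: sandwich_same)
  then have "\<alpha> a b * \<phi> c * \<beta> a b * \<beta> a b = 0"
    by (simp add: mult.assoc)
  then show ?thesis by (simp add: power2_eq_square mult.assoc)
qed

text \<open>Writing \<open>\<phi> c * \<phi> d\<close> as
  \<open>\<phi> (c * d) - \<alpha> c d\<close> leaves a one-letter word and a term with
  \<open>\<alpha> c d\<close>. The latter dies because the bracket \<open>?z\<close> commutes with
  \<open>\<alpha> a b\<close>.\<close>

lemma hom_word2: "\<alpha> a b * \<phi> c * \<phi> d * \<beta> a b ^ 2 = 0"
proof -
  let ?z = "\<alpha> c d * \<beta> a b - \<beta> a b * \<alpha> c d"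
  have "\<alpha> a b * ?z * \<beta> a b = ?z * (\<alpha> a b * \<beta> a b)"
    by (simp only: defect_commutator_central_defect mult.assoc)
  then have "\<alpha> a b * \<alpha> c d * \<beta> a b ^ 2 = (\<alpha> a b * \<beta> a b) * \<alpha> c d * \<beta> a b"
    by (simp add: algebra_simps power2_eq_square)
  then have "\<alpha> a b * \<alpha> c d * \<beta> a b ^ 2 = 0" by (simp add: mult.assoc)
  moreover have "\<alpha> a b * \<phi> c * \<phi> d * \<beta> a b ^ 2 =
      \<alpha> a b * \<phi> (c * d) * \<beta> a b ^ 2 - \<alpha> a b * \<alpha> c d * \<beta> a b ^ 2"
    unfolding hom_defect_def[of c d] by (simp only: right_diff_distrib left_diff_distrib mult.assoc) simp
  ultimately show ?thesis by (simp add: hom_word1)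
qed

lemma word_power_mono:
  assumes "t * \<beta> a b ^ m = 0" "m \<le> n"
  shows "t * \<beta> a b ^ n = 0"
proof -
  have "t * \<beta> a b ^ n = t * \<beta> a b ^ m * \<beta> a b ^ (n - m)"
    using assms(2) by (simp add: mult.assoc flip: power_add)
  then show ?thesis using assms(1) by simp
qed

text \<open>Modulo shorter words the letters of a word anticommute, so a letter may be moved freely.\<close>

lemma move_letter:
  assumes short: "\<And>cs. length cs = n \<Longrightarrow> \<theta> * word cs * p = 0"
    and len: "length ds + length es = n"
    and front: "\<theta> * word (x # ds @ es) * p = 0"
  shows "\<theta> * word (ds @ x # es) * p = 0"
  using len front
proof (induction ds arbitrary: es rule: rev_induct)
  case Nil
  then show ?case by simp
next
  case (snoc y ds)
  have "\<theta> * word (ds @ x # y # es) * p = 0"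
    using snoc.IH[of "y # es"] snoc.prems by simp
  \<comment> \<open>Merging two neighbours into the letter \<open>x * y + y * x\<close> gives a word
    of the shorter length, so the two orders of the neighbours cancel.\<close>
  moreover have "\<theta> * word (ds @ (x * y + y * x) # es) * p = 0"
    using snoc.prems(1) by (intro short) simp
  then have "\<theta> * word (ds @ x # y # es) * p + \<theta> * word (ds @ y # x # es) * p = 0"
    by (simp add: jordan algebra_simps)
  ultimately show ?case by simp
qed

text \<open>One more letter for one more factor \<open>w\<close>. Multiplying a letter by the
  commutator \<open>u\<close> creates a \<open>w\<close> and a \<open>w'\<close>; the
  \<open>w'\<close> is absorbed by the assumption \<open>w'_short\<close>, and the \<open>w\<close>
  is steered to the right end.\<close>

lemma word_step:
  fixes a b
  defines "w \<equiv> \<beta> a b" and "w' \<equiv> \<alpha> a b"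
  assumes n: "n \<ge> 2"
    and short: "\<And>cs. length cs = n - 1 \<Longrightarrow> \<theta> * word cs * w ^ N = 0"
    and theta_w: "\<And>cs. length cs = n \<Longrightarrow> \<theta> * w * word cs * w ^ N = 0"
    and w'_short: "\<And>cs. length cs \<in> {0, 1, 2, n - 1} \<Longrightarrow> w' * word cs * w ^ N = 0"
    and len: "length cs = n"
  shows "\<theta> * word cs * w ^ Suc N = 0"
proof -
  obtain ds c d where cs: "cs = ds @ [d, c]" and ds: "length ds = n - 2"
  proof -
    have "cs = take (n - 2) cs @ drop (n - 2) cs" by simp
    moreover have "length (drop (n - 2) cs) = 2" using n len by simp
    then obtain d c where "drop (n - 2) cs = [d, c]"
      by (metis (no_types, lifting) One_nat_def Suc_1 length_0_conv length_Suc_conv)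
    ultimately have "cs = take (n - 2) cs @ [d, c]" by simp
    moreover have "length (take (n - 2) cs) = n - 2" using n len by simp
    ultimately show ?thesis using that by blast
  qed
  define u where "u = a * b - b * a"
  have uc: "\<phi> (u * x) = w * \<phi> x + \<phi> x * w'" "\<phi> (x * u) = \<phi> x * w + w' * \<phi> x" for x
    unfolding u_def by (simp_all only: mult_commutator w_def w'_def)
  have w'wN: "w' * w ^ N = 0" using w'_short[of "[]"] by simp
  have swallow: "\<theta> * word ds * w' * word es * w ^ N = 0" if "length es \<in> {0, 1, 2, n - 1}" for ds es
    using arg_cong[OF w'_short[OF that], of "(*) (\<theta> * word ds)"] by (simp add: mult.assoc)
  have len_dsd: "length (ds @ [d]) \<in> {0, 1, 2, n - 1}" for d
    using ds n by auto
  \<comment> \<open>In a word ending in \<open>u * c\<close> that letter may be moved to the front,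
    where its \<open>w\<close> meets \<open>\<theta>\<close> and its \<open>w'\<close> is swallowed;
    so the word vanishes. Read in the original position, it leaves only the term with
    \<open>w\<close> before \<open>\<phi> c\<close>.\<close>
  have star: "\<theta> * word ds * \<phi> d * w * \<phi> c * w ^ N = 0" for d c
  proof -
    have "\<theta> * word ((ds @ [d]) @ (u * c) # []) * w ^ N = 0"
    proof (rule move_letter)
      show "length (ds @ [d]) + length [] = n - 1" using ds n by simp
      have "\<theta> * \<phi> c * w' * word (ds @ [d]) * w ^ N = 0"
        using swallow[of "ds @ [d]" "[c]"] len_dsd by (simp add: mult.assoc)
      then show "\<theta> * word (u * c # (ds @ [d]) @ []) * w ^ N = 0"
        using theta_w[of "c # ds @ [d]"] ds n by (simp add: uc algebra_simps)
    qed (rule short)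
    then show ?thesis
      using w'wN by (simp add: uc algebra_simps)
  qed
  \<comment> \<open>The mirrored letter carries its \<open>w\<close> behind \<open>\<phi> c\<close>.
    In front of \<open>d\<close> its word vanishes by \<open>star\<close>; exchanging it with
    \<open>d\<close> brings this \<open>w\<close> next to \<open>w ^ N\<close>.\<close>
  define e where "e = c * u"
  have e: "\<phi> e = \<phi> c * w + w' * \<phi> c" by (simp add: e_def uc)
  have "\<theta> * word ds * w' * word [c, d] * w ^ N = 0" by (rule swallow) simp
  then have 1: "\<theta> * word (ds @ [e, d]) * w ^ N = 0"
    using star[of c d] by (simp add: e algebra_simps)
  have "\<theta> * word (ds @ [d * e + e * d]) * w ^ N = 0"
    using ds n by (intro short) simp
  then have 2: "\<theta> * word (ds @ [d, e]) * w ^ N = 0"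
    using 1 by (simp add: jordan algebra_simps)
  have "\<theta> * word (ds @ [d]) * w' * word [c] * w ^ N = 0" by (rule swallow) simp
  then show ?thesis
    using 2 by (simp add: cs e algebra_simps)
qed

text \<open>At most two letters are covered by \<open>hom_anti_defect\<close>,
  \<open>hom_word1\<close> and \<open>hom_word2\<close>. From three letters on
  \<open>word_step\<close> applies with \<open>\<theta> = \<alpha> a b\<close>, where
  \<open>\<theta> * w = 0\<close>.\<close>

lemma hom_word: "length cs + 2 \<le> N \<Longrightarrow> \<alpha> a b * word cs * \<beta> a b ^ N = 0"
proof (induction "length cs" arbitrary: cs N rule: less_induct)
  case less
  consider "cs = []" | c where "cs = [c]" | c d where "cs = [c, d]" | "length cs \<ge> 3"
    by (cases cs; cases "tl cs"; cases "tl (tl cs)") auto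
  then show ?case
  proof cases
    case 1
    then show ?thesis using word_power_mono[of "\<alpha> a b" a b 1 N] less.prems by simp
  next
    case 2
    then show ?thesis using word_power_mono[OF hom_word1] less.prems by simp
  next
    case 3
    then show ?thesis
      using word_power_mono[OF hom_word2] less.prems by (simp add: mult.assoc)
  next
    case 4
    obtain M where N: "N = Suc M" using less.prems by (cases N) auto
    show ?thesis unfolding N
    proof (rule word_step)
      show "2 \<le> length cs" using 4 by simp
      show "\<alpha> a b * word ds * \<beta> a b ^ M = 0" if "length ds = length cs - 1" for ds
        using that 4 less.prems N by (intro less.hyps) auto
      show "\<alpha> a b * word ds * \<beta> a b ^ M = 0" if "length ds \<in> {0, 1, 2, length cs - 1}" for ds
        using that 4 less.prems N by (intro less.hyps) auto
    qed simp_all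
  qed
qed

text \<open>Abstracts the passage to another pair \<open>c, d\<close>: there \<open>\<theta>\<close>
  and \<open>\<omega>\<close> are its defects \<open>\<alpha> c d\<close>,
  \<open>\<beta> c d\<close>, and \<open>\<sigma>\<close> is \<open>mixed a b c d\<close>.
  Assumptions \<open>1\<close> and \<open>2\<close> are then \<open>mixed_def\<close> and
  \<open>sandwich\<close> solved for the term with \<open>\<theta>\<close> on the left. Using them
  consumes one factor \<open>w\<close>, hence \<open>M + 1\<close>.\<close>

lemma word_defect:
  fixes a b
  defines "w \<equiv> \<beta> a b" and "w' \<equiv> \<alpha> a b"
  assumes 1: "\<theta> * w = \<sigma> - w' * \<omega>"
    and 2: "\<And>x. \<theta> * \<phi> x * w = \<phi> x * \<sigma> + \<sigma> * \<phi> x - w' * \<phi> x * \<omega> - w * \<phi> x * \<theta> - \<omega> * \<phi> x * w'"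
    and \<sigma>: "\<And>cs N. length cs + M \<le> N \<Longrightarrow> \<sigma> * word cs * w ^ N = 0"
    and \<omega>: "\<And>cs ds N. length cs + length ds + 4 \<le> N \<Longrightarrow> w' * word cs * \<omega> * word ds * w ^ N = 0"
    and M: "M \<ge> 4"
  shows "length cs + M + 1 \<le> N \<Longrightarrow> \<theta> * word cs * w ^ N = 0"
proof (induction "length cs" arbitrary: cs N rule: less_induct)
  case less
  obtain K where N: "N = Suc K" "length cs + M \<le> K" using less.prems by (cases N) auto
  have \<theta>0: "\<theta> * w ^ L = 0" if "M + 1 \<le> L" for L
  proof -
    obtain L' where L: "L = Suc L'" "M \<le> L'" using \<open>M + 1 \<le> L\<close> by (cases L) auto
    have "\<theta> * w ^ L = \<sigma> * w ^ L' - w' * \<omega> * w ^ L'"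
      unfolding L power_Suc mult.assoc[symmetric] 1 by (rule left_diff_distrib)
    then show ?thesis
      using \<sigma>[of "[]" L'] \<omega>[of "[]" "[]" L'] L M by simp
  qed
  consider "cs = []" | c where "cs = [c]" | "length cs \<ge> 2"
    by (cases cs; cases "tl cs") auto
  then show ?case
  proof cases
    case 1
    then show ?thesis using \<theta>0 less.prems by simp
  next
    case 2
    have K: "M + 1 \<le> K" using N 2 by simp
    have "w' * w ^ K = 0"
      using K by (cases K) (simp_all add: w_def w'_def)
    moreover have "\<theta> * w ^ K = 0" using \<theta>0 K by simp
    moreover have "\<sigma> * w ^ K = 0" "\<sigma> * \<phi> c * w ^ K = 0"
      using \<sigma>[of "[]" K] \<sigma>[of "[c]" K] K by simp_all
    moreover have "w' * (\<phi> c * (\<omega> * w ^ K)) = 0"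
      using \<omega>[of "[c]" "[]" K] K M by (simp add: mult.assoc)
    ultimately have "(\<phi> c * \<sigma> + \<sigma> * \<phi> c - w' * \<phi> c * \<omega> - w * \<phi> c * \<theta> - \<omega> * \<phi> c * w') * w ^ K = 0"
      by (simp add: algebra_simps)
    then have "\<theta> * \<phi> c * w * w ^ K = 0" unfolding assms(4) .
    then show ?thesis by (simp add: 2 N mult.assoc)
  next
    case 3
    show ?thesis unfolding N w_def
    proof (rule word_step)
      show "2 \<le> length cs" by fact
      show "\<theta> * word ds * \<beta> a b ^ K = 0" if "length ds = length cs - 1" for ds
        using that 3 N less.hyps[of ds K] by (simp add: w_def)
      show "\<theta> * \<beta> a b * word ds * \<beta> a b ^ K = 0" if "length ds = length cs" for ds
        using that 1 N M \<sigma>[of ds K] \<omega>[of "[]" ds K] by (simp add: w_def left_diff_distrib)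
      show "\<alpha> a b * word ds * \<beta> a b ^ K = 0" if "length ds \<in> {0, 1, 2, length cs - 1}" for ds
        using that 3 N M by (intro hom_word) auto
    qed simp
  qed
qed

text \<open>Opening \<open>\<beta> p q\<close> inserts at most the two letters \<open>q\<close>,
  \<open>p\<close>, hence 4 in place of the 2 of \<open>hom_word\<close>.\<close>

lemma hom_word_anti:
  assumes "length cs + length ds + 4 \<le> N"
  shows "\<alpha> a b * word cs * \<beta> p q * word ds * \<beta> a b ^ N = 0"
proof -
  have "\<alpha> a b * word (cs @ [p * q] @ ds) * \<beta> a b ^ N = 0"
    "\<alpha> a b * word (cs @ [q, p] @ ds) * \<beta> a b ^ N = 0"
    using assms by (intro hom_word; simp)+
  then show ?thesis
    by (simp add: anti_defect_def[of p q] algebra_simps)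
qed

text \<open>Here \<open>\<sigma> = 0\<close>, so the bound is the 4 of \<open>hom_word_anti\<close>
  plus the 1 of \<open>word_defect\<close>.\<close>

lemma shared_defect_word:
  assumes mixed: "mixed a b c d = 0" and N: "length cs + 5 \<le> N"
  shows "\<alpha> c d * word cs * \<beta> a b ^ N = 0"
proof (rule word_defect[where \<sigma> = 0 and \<omega> = "\<beta> c d" and M = 4])
  show "\<alpha> c d * \<beta> a b = 0 - \<alpha> a b * \<beta> c d"
    using mixed by (simp add: mixed_def eq_neg_iff_add_eq_0 add.commute)
  show "\<alpha> c d * \<phi> x * \<beta> a b = \<phi> x * 0 + 0 * \<phi> x - \<alpha> a b * \<phi> x * \<beta> c d - \<beta> a b * \<phi> x * \<alpha> c d -
      \<beta> c d * \<phi> x * \<alpha> a b" for x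
    using sandwich[of a b x c d] mixed by (simp add: algebra_simps eq_neg_iff_add_eq_0)
qed (use N in \<open>simp_all add: hom_word_anti\<close>)

lemma mixed_word:
  assumes "length cs + 7 \<le> N"
  shows "mixed a b c d * word cs * \<beta> a b ^ N = 0"
proof -
  \<comment> \<open>The pairs \<open>(a, d)\<close> and \<open>(c, b)\<close> both share an argument
    with \<open>(a, b)\<close>. After \<open>mixed_exchange\<close> the inner \<open>\<beta>\<close>
    of each product opens into at most two letters, which raises 5 to 7.\<close>
  have "\<alpha> a d * word ([c * b] @ cs) * \<beta> a b ^ N = 0"
    "\<alpha> a d * word ([b, c] @ cs) * \<beta> a b ^ N = 0"
    "\<alpha> c b * word ([a * d] @ cs) * \<beta> a b ^ N = 0"
    "\<alpha> c b * word ([d, a] @ cs) * \<beta> a b ^ N = 0"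
    using assms by (intro shared_defect_word; simp)+
  then have "mixed c b a d * word cs * \<beta> a b ^ N = 0"
    by (simp add: mixed_def anti_defect_def[of c b] anti_defect_def[of a d] algebra_simps)
  then show ?thesis by (simp add: mixed_exchange[of a b c d])
qed

lemma hom_defect_word:
  assumes N: "length cs + 8 \<le> N"
  shows "\<alpha> c d * word cs * \<beta> a b ^ N = 0"
proof (rule word_defect[where \<sigma> = "mixed a b c d" and \<omega> = "\<beta> c d" and M = 7])
  show "\<alpha> c d * \<beta> a b = mixed a b c d - \<alpha> a b * \<beta> c d"
    by (simp add: mixed_def)
  show "\<alpha> c d * \<phi> x * \<beta> a b = \<phi> x * mixed a b c d + mixed a b c d * \<phi> x -
      \<alpha> a b * \<phi> x * \<beta> c d - \<beta> a b * \<phi> x * \<alpha> c d - \<beta> c d * \<phi> x * \<alpha> a b" for x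
    using sandwich[of a b x c d] by (simp add: algebra_simps)
qed (use N in \<open>simp_all add: hom_word_anti mixed_word\<close>)

end

subsection \<open>Commutators that are nil modulo an ideal\<close>

definition two_sided_ideal :: "'a::Rings.ring set \<Rightarrow> bool"
  where "two_sided_ideal J \<longleftrightarrow> 0 \<in> J \<and> (\<forall>x\<in>J. \<forall>y\<in>J. x - y \<in> J) \<and> (\<forall>x\<in>J. \<forall>r. r * x \<in> J \<and> x * r \<in> J)"

lemma two_sided_idealD:
  assumes "two_sided_ideal J"
  shows "0 \<in> J" "x \<in> J \<Longrightarrow> y \<in> J \<Longrightarrow> x - y \<in> J" "x \<in> J \<Longrightarrow> - x \<in> J"
    "x \<in> J \<Longrightarrow> y \<in> J \<Longrightarrow> x + y \<in> J" "x \<in> J \<Longrightarrow> r * x \<in> J" "x \<in> J \<Longrightarrow> x * r \<in> J"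
proof -
  have z: "0 \<in> J" and d: "\<And>x y. x \<in> J \<Longrightarrow> y \<in> J \<Longrightarrow> x - y \<in> J"
    using assms by (auto simp: two_sided_ideal_def)
  have m: "- x \<in> J" if "x \<in> J" for x using d[of 0 x] that z by simp
  show "0 \<in> J" "x \<in> J \<Longrightarrow> y \<in> J \<Longrightarrow> x - y \<in> J" "x \<in> J \<Longrightarrow> - x \<in> J"
    by (fact z, fact d, fact m)
  show "x + y \<in> J" if "x \<in> J" "y \<in> J" using d[of x "- y"] m that by simp
  show "x \<in> J \<Longrightarrow> r * x \<in> J" "x \<in> J \<Longrightarrow> x * r \<in> J"
    using assms by (auto simp: two_sided_ideal_def)
qed

text \<open>The noncommutative notion, with an arbitrary \<open>r\<close> in the middle: a matrix
  ring over a field is prime but has zero divisors.\<close>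

definition prime_ideal :: "'a::{Rings.ring,monoid_mult} set \<Rightarrow> bool"
  where "prime_ideal M \<longleftrightarrow> two_sided_ideal M \<and> 1 \<notin> M \<and>
    (\<forall>x y. (\<forall>r. x * r * y \<in> M) \<longrightarrow> x \<in> M \<or> y \<in> M)"

text \<open>An ideal \<open>M\<close> maximal among those containing \<open>I\<close> and avoiding 1
  is prime: if all \<open>x * r * y\<close> lie in \<open>M\<close> and \<open>x\<close> does not,
  the \<open>z\<close> with all \<open>z * r * y\<close> in \<open>M\<close> form a strictly larger
  ideal, which must contain 1.\<close>

lemma prime_ideal_above:
  fixes I :: "'a::{Rings.ring,monoid_mult} set"
  assumes I: "two_sided_ideal I" "1 \<notin> I"
  obtains M where "prime_ideal M" "I \<subseteq> M"
proof -
  define A where "A = {J. two_sided_ideal J \<and> I \<subseteq> J \<and> 1 \<notin> J}"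
  have "\<exists>M\<in>A. \<forall>J\<in>A. M \<subseteq> J \<longrightarrow> J = M"
  proof (rule subset_Zorn_nonempty)
    show "A \<noteq> {}" using I by (auto simp: A_def)
    fix \<C> assume \<C>: "\<C> \<noteq> {}" "subset.chain A \<C>"
    then have sub: "two_sided_ideal J" "I \<subseteq> J" "1 \<notin> J" if "J \<in> \<C>" for J
      using that by (auto simp: subset_chain_def A_def)
    have "two_sided_ideal (\<Union>\<C>)"
      unfolding two_sided_ideal_def
    proof (intro conjI ballI allI)
      show "0 \<in> \<Union>\<C>" using \<C>(1) sub two_sided_idealD(1) by blast
      show "x - y \<in> \<Union>\<C>" if xy: "x \<in> \<Union>\<C>" "y \<in> \<Union>\<C>" for x y
      proof -
        obtain J K where "J \<in> \<C>" "K \<in> \<C>" "x \<in> J" "y \<in> K" using xy by blast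
        moreover from this have "J \<subseteq> K \<or> K \<subseteq> J" using \<C>(2) by (auto simp: subset_chain_def)
        ultimately show ?thesis using sub two_sided_idealD(2) by blast
      qed
      show "r * x \<in> \<Union>\<C>" "x * r \<in> \<Union>\<C>" if "x \<in> \<Union>\<C>" for x r
        using that sub two_sided_idealD(5,6) by blast+
    qed
    moreover have "I \<subseteq> \<Union>\<C>" "1 \<notin> \<Union>\<C>" using \<C>(1) sub(2,3) by blast+
    ultimately show "\<Union>\<C> \<in> A" by (simp add: A_def)
  qed
  then obtain M where M: "two_sided_ideal M" "I \<subseteq> M" "1 \<notin> M"
    and max: "\<And>J. two_sided_ideal J \<Longrightarrow> M \<subseteq> J \<Longrightarrow> 1 \<notin> J \<Longrightarrow> J = M"
    unfolding A_def by (smt (verit) mem_Collect_eq subset_trans)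
  have "y \<in> M" if xy: "\<forall>r. x * r * y \<in> M" and x: "x \<notin> M" for x y
  proof -
    let ?J = "{z. \<forall>r. z * r * y \<in> M}"
    have "two_sided_ideal ?J"
      unfolding two_sided_ideal_def
      using two_sided_idealD[OF M(1)] by (auto simp: left_diff_distrib mult.assoc) (metis mult.assoc)
    moreover have "M \<subseteq> ?J" using two_sided_idealD[OF M(1)] by (auto simp: mult.assoc)
    ultimately have "1 \<in> ?J" using max[of ?J] xy x by auto
    then have "1 * 1 * y \<in> M" by blast
    then show ?thesis by simp
  qed
  then have "prime_ideal M" unfolding prime_ideal_def using M by blast
  then show ?thesis using that M by blast
qed

text \<open>Levitzki's argument: a prime ring has no nonzero nil one-sided ideal of bounded index.\<close>

lemma prime_ideal_levitzki:
  fixes M :: "'a::{Rings.ring,monoid_mult} set"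
  assumes M: "prime_ideal M"
  shows "\<forall>x. (v * x) ^ n * v \<in> M \<Longrightarrow> v \<in> M"
proof (induction n arbitrary: v)
  case 0
  then show ?case by simp
next
  case (Suc n)
  have I: "two_sided_ideal M" using M by (simp add: prime_ideal_def)
  note ideal = two_sided_idealD[OF I]
  show ?case
  proof (rule ccontr)
    assume v: "v \<notin> M"
    then obtain y0 where y0: "v * y0 * v \<notin> M"
      using M by (auto simp: prime_ideal_def)
    define k where "k = (LEAST k. (v * y0) ^ k * v \<in> M)"
    have k: "(v * y0) ^ k * v \<in> M"
      unfolding k_def using Suc.prems by (rule LeastI[of _ "Suc n", OF spec])
    have min: "(v * y0) ^ i * v \<notin> M" if "i < k" for i
      using that not_less_Least unfolding k_def by blast
    have "k \<noteq> 0" using k v by (metis mult_1 power_0)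
    moreover have "k \<noteq> 1" using k y0 by (metis power_one_right)
    ultimately obtain j where j: "k = Suc (Suc j)" by (metis One_nat_def not0_implies_Suc)
    \<comment> \<open>With \<open>k = j + 2\<close>, \<open>v2\<close> is
      \<open>(v * y0) ^ (k - 1) * v\<close>, the last such element outside \<open>M\<close>, while
      \<open>v * y * v2\<close> lies in \<open>M\<close> because \<open>2 * (k - 1)\<close> is at
      least \<open>k\<close>.\<close>
    define y where "y = y0 * (v * y0) ^ j"
    define v2 where "v2 = v * y * v"
    have vy: "v * y = (v * y0) ^ Suc j" by (simp add: y_def mult.assoc)
    have v2: "v2 \<notin> M" using min[of "Suc j"] j unfolding v2_def vy by simp
    have "v * y * (v * y * v) = (v * y0) ^ j * ((v * y0) ^ k * v)"
      unfolding vy j mult.assoc[symmetric] power_add[symmetric] by simp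
    then have yy: "v * y * v2 \<in> M" unfolding v2_def using k ideal(5) by metis
    have "(v2 * z) ^ n * v2 \<in> M" for z
    proof -
      define p q where "p = v * y" and "q = v2 * z"
      \<comment> \<open>Modulo \<open>M\<close> a \<open>p\<close> followed by another factor
        \<open>q\<close>, or eventually by a second \<open>p\<close>, dies; so \<open>p\<close>
        survives only in the last place. As \<open>p + q\<close> and \<open>q\<close> both have the
        form \<open>v * x\<close>, this isolates \<open>(v2 * z) ^ n * v2\<close> and lowers the
        exponent.\<close>
      have expand: "(p + q) ^ Suc m * v - (q ^ Suc m * v + q ^ m * p * v) \<in> M" for m
      proof (induction m)
        case 0
        then show ?case using ideal(1) by (simp add: algebra_simps)
      next
        case (Suc m)
        have pq: "p * q * t \<in> M" for t
          using ideal(6)[OF yy, of "z * t"] by (simp add: p_def q_def mult.assoc)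
        have pqm: "p * q ^ m * p * v \<in> M"
        proof (cases m)
          case 0
          then show ?thesis using yy by (simp add: p_def v2_def mult.assoc)
        next
          case (Suc m')
          then show ?thesis using pq[of "q ^ m' * p * v"] by (simp add: mult.assoc)
        qed
        have *: "(p + q) ^ Suc (Suc m) * v - (q ^ Suc (Suc m) * v + q ^ Suc m * p * v) =
            (p + q) * ((p + q) ^ Suc m * v - (q ^ Suc m * v + q ^ m * p * v)) +
            (p * q * (q ^ m * v) + p * q ^ m * p * v)"
          by (simp add: algebra_simps)
        show ?case unfolding * by (intro ideal(4,5) Suc.IH pq pqm)
      qed
      have "p + q = v * (y + y * v * z)" "q = v * (y * v * z)"
        by (simp_all add: p_def q_def v2_def algebra_simps)
      then have "(p + q) ^ Suc n * v \<in> M" "q ^ Suc n * v \<in> M" using Suc.prems by metis+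
      moreover have "q ^ n * p * v = (p + q) ^ Suc n * v - q ^ Suc n * v -
          ((p + q) ^ Suc n * v - (q ^ Suc n * v + q ^ n * p * v))"
        by (simp add: algebra_simps)
      ultimately have "q ^ n * p * v \<in> M" using expand[of n] ideal(2) by metis
      then show ?thesis by (simp add: p_def q_def v2_def mult.assoc)
    qed
    then show False using Suc.IH v2 by blast
  qed
qed

text \<open>The last power \<open>v\<close> of a commutator outside \<open>M\<close> satisfies
  \<open>v * v \<in> M\<close>. Powers of \<open>v * x - x * v\<close> and of \<open>v * x\<close>
  then agree modulo \<open>M\<close> in front of \<open>v\<close>, so the nil bound on commutators
  becomes the hypothesis of \<open>prime_ideal_levitzki\<close>.\<close>

lemma prime_ideal_commutators:
  fixes M :: "'a::{Rings.ring,monoid_mult} set"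
  assumes M: "prime_ideal M" and nil: "\<And>a b. (a * b - b * a) ^ n \<in> M"
  shows "a * b - b * a \<in> M"
proof (rule ccontr)
  have I: "two_sided_ideal M" and one: "1 \<notin> M" using M by (simp_all add: prime_ideal_def)
  note ideal = two_sided_idealD[OF I]
  define u where "u = a * b - b * a"
  assume "a * b - b * a \<notin> M"
  then have u: "u \<notin> M" by (simp add: u_def)
  define k where "k = (LEAST k. u ^ k \<in> M)"
  have k: "u ^ k \<in> M" unfolding k_def u_def by (rule LeastI) (rule nil)
  have min: "u ^ i \<notin> M" if "i < k" for i
    using that not_less_Least unfolding k_def by blast
  have "k \<noteq> 0" using k one by (metis power_0)
  moreover have "k \<noteq> 1" using k u by (metis power_one_right)
  ultimately obtain j where j: "k = Suc (Suc j)" by (metis One_nat_def not0_implies_Suc)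
  define v where "v = u ^ Suc j"
  have v: "v \<notin> M" using min[of "Suc j"] j by (simp add: v_def)
  have "v * v = u ^ j * u ^ k"
    unfolding v_def j power_add[symmetric] by simp
  then have vv: "v * v \<in> M" using k ideal(5) by metis
  have "(v * x - x * v) ^ m * v - (v * x) ^ m * v \<in> M" for x m
  proof (induction m)
    case 0
    then show ?case using ideal(1) by simp
  next
    case (Suc m)
    have "v * (v * x) ^ m * v \<in> M"
    proof (cases m)
      case 0
      then show ?thesis using vv by simp
    next
      case (Suc m')
      then show ?thesis using ideal(6)[OF vv, of "x * (v * x) ^ m' * v"] by (simp add: mult.assoc)
    qed
    then have "x * (v * (v * x) ^ m * v) \<in> M" by (rule ideal(5))
    moreover have "(v * x - x * v) ^ Suc m * v - (v * x) ^ Suc m * v =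
        (v * x - x * v) * ((v * x - x * v) ^ m * v - (v * x) ^ m * v) - x * (v * (v * x) ^ m * v)"
      by (simp add: algebra_simps)
    ultimately show ?case using ideal(2,5) Suc.IH by metis
  qed
  moreover have "(v * x - x * v) ^ n * v \<in> M" for x using nil ideal(6) by blast
  moreover have "(v * x) ^ n * v = (v * x - x * v) ^ n * v - ((v * x - x * v) ^ n * v - (v * x) ^ n * v)" for x
    by simp
  ultimately have "(v * x) ^ n * v \<in> M" for x using ideal(2) by metis
  then have "v \<in> M" using prime_ideal_levitzki[OF M] by blast
  then show False using v by simp
qed

text \<open>Hypothesis \<open>K\<close> expresses that the ring equals its commutator ideal modulo
  \<open>Z\<close>. The set \<open>Z\<close> is there because the ring will be a product of which
  only one factor is known to have this property.\<close>

lemma one_mem_of_commutator_powers: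
  fixes I Z :: "'a::{Rings.ring,monoid_mult} set"
  assumes I: "two_sided_ideal I" "Z \<subseteq> I" "\<And>a b. (a * b - b * a) ^ n \<in> I"
    and K: "\<And>J. two_sided_ideal J \<Longrightarrow> Z \<subseteq> J \<Longrightarrow> (\<And>a b. a * b - b * a \<in> J) \<Longrightarrow> 1 \<in> J"
  shows "1 \<in> I"
proof (rule ccontr)
  assume "1 \<notin> I"
  then obtain M where M: "prime_ideal M" "I \<subseteq> M" using prime_ideal_above I(1) by blast
  have "a * b - b * a \<in> M" for a b
    by (rule prime_ideal_commutators[OF M(1)]) (use I(3) M(2) in blast)
  then have "1 \<in> M" using K[of M] M I(2) by (auto simp: prime_ideal_def)
  then show False using M(1) by (simp add: prime_ideal_def)
qed

subsection \<open>The central splitting\<close>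

text \<open>Annihilation of \<open>\<alpha>\<close> by powers of \<open>\<beta>\<close> from the right yields the other three one-sided
  versions by passing to the opposite ring in the domain, the codomain, or both.\<close>

datatype 'a opp = Opp (unopp: 'a)

instantiation opp :: (Rings.ring) Rings.ring
begin
definition "0 = Opp 0"
definition "x + y = Opp (unopp x + unopp y)"
definition "x - y = Opp (unopp x - unopp y)"
definition "- x = Opp (- unopp x)"
definition "x * y = Opp (unopp y * unopp x)"
instance
  by standard (simp_all add: zero_opp_def plus_opp_def minus_opp_def uminus_opp_def times_opp_def
      algebra_simps opp.expand)
end

instantiation opp :: ("{Rings.ring, monoid_mult}") monoid_mult
begin
definition "1 = Opp 1"
instance
  by standard (simp_all add: one_opp_def times_opp_def mult.assoc)
end

lemmas opp_defs = zero_opp_def plus_opp_def minus_opp_def uminus_opp_def times_opp_def one_opp_def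

lemma Opp_power: "(Opp x :: 'a::{Rings.ring,monoid_mult} opp) ^ n = Opp (x ^ n)"
  by (induction n) (simp_all add: one_opp_def times_opp_def power_commutes)

context jordan_unital
begin

lemma jordan_opp_dom: "jordan_unital (\<lambda>x. \<phi> (unopp x))"
  by standard
    (use jordan in \<open>auto simp: opp_defs add one_l one_r add.commute torsion_free\<close>)

lemma jordan_opp_cod: "jordan_unital (\<lambda>x. Opp (\<phi> x))"
proof
  fix t
  assume "Opp (\<phi> 1) * t = t" "t * Opp (\<phi> 1) = t" "t + t = 0"
  then have "\<phi> 1 * unopp t = unopp t" "unopp t * \<phi> 1 = unopp t" "unopp t + unopp t = 0"
    by (cases t; simp add: opp_defs)+
  then show "t = 0"
    using torsion_free[of "unopp t"] by (simp add: opp_defs opp.expand)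
qed (use jordan in \<open>auto simp: opp_defs add one_l one_r add.commute\<close>)

text \<open>Reversing the domain exchanges \<open>\<alpha>\<close> and \<open>\<beta>\<close> and
  swaps their arguments. Reversing the codomain also exchanges them, and reverses the order of the
  factors.\<close>

lemma defect_annihilation:
  "\<alpha> c d * \<phi> x * \<beta> a b ^ 9 = 0"
  "\<beta> c d * \<phi> x * \<alpha> a b ^ 9 = 0"
  "\<alpha> a b ^ 9 * \<phi> x * \<beta> c d = 0"
  "\<beta> a b ^ 9 * \<phi> x * \<alpha> c d = 0"
proof -
  interpret D: jordan_unital "\<lambda>x. \<phi> (unopp x)" by (rule jordan_opp_dom)
  interpret C: jordan_unital "\<lambda>x. Opp (\<phi> x)" by (rule jordan_opp_cod)
  interpret DC: jordan_unital "\<lambda>x. Opp (\<phi> (unopp x))" by (rule D.jordan_opp_cod)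
  show "\<alpha> c d * \<phi> x * \<beta> a b ^ 9 = 0"
    using hom_defect_word[of "[x]" 9 c d a b] by simp
  show "\<beta> c d * \<phi> x * \<alpha> a b ^ 9 = 0"
    using D.hom_defect_word[of "[Opp x]" 9 "Opp d" "Opp c" "Opp b" "Opp a"]
    by (simp add: D.hom_defect_def D.anti_defect_def hom_defect_def anti_defect_def opp_defs)
  show "\<alpha> a b ^ 9 * \<phi> x * \<beta> c d = 0"
    using C.hom_defect_word[of "[x]" 9 c d a b]
    by (simp add: C.hom_defect_def C.anti_defect_def hom_defect_def anti_defect_def opp_defs
        Opp_power[unfolded opp_defs] mult.assoc)
  show "\<beta> a b ^ 9 * \<phi> x * \<alpha> c d = 0"
    using DC.hom_defect_word[of "[Opp x]" 9 "Opp d" "Opp c" "Opp b" "Opp a"]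
    by (simp add: DC.hom_defect_def DC.anti_defect_def hom_defect_def anti_defect_def opp_defs
        Opp_power[unfolded opp_defs] mult.assoc)
qed

lemma hom_square_word: "\<alpha> a b ^ 2 * \<phi> x * \<beta> a b = 0"
proof -
  have "\<alpha> a b ^ 2 * \<phi> x * \<beta> a b = \<alpha> a b * (\<alpha> a b * \<phi> x * \<beta> a b)"
    by (simp add: power2_eq_square mult.assoc)
  also have "\<alpha> a b * \<phi> x * \<beta> a b = - (\<beta> a b * \<phi> x * \<alpha> a b)" by (simp add: sandwich_same)
  finally show ?thesis by (simp add: mult.assoc)
qed

text \<open>Iterating \<open>mult_commutator\<close> produces cross terms with
  \<open>\<alpha> a b ^ i\<close> before and \<open>\<beta> a b ^ j\<close> behind
  \<open>\<phi> x\<close>. They vanish once \<open>i\<close> or \<open>j\<close> is at least 2,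
  which is forced when \<open>i + j\<close> is at least 3.\<close>

lemma mult_commutator_power:
  "\<phi> (x * (a * b - b * a) ^ (n + 3)) = \<phi> x * \<beta> a b ^ (n + 3) + \<alpha> a b ^ (n + 3) * \<phi> x"
proof -
  define u where "u = a * b - b * a"
  have u: "\<phi> (x * u) = \<phi> x * \<beta> a b + \<alpha> a b * \<phi> x" for x
    unfolding u_def by (rule mult_commutator)
  have w: "\<alpha> a b * (\<phi> x * (\<beta> a b * \<beta> a b)) = 0" "\<alpha> a b * (\<alpha> a b * (\<phi> x * \<beta> a b)) = 0" for x
    using hom_word1[of a b x] hom_square_word[of a b x] by (simp_all add: power2_eq_square mult.assoc)
  have "\<phi> (x * u ^ (n + 3)) = \<phi> x * \<beta> a b ^ (n + 3) + \<alpha> a b ^ (n + 3) * \<phi> x"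
  proof (induction n)
    case 0
    have "\<phi> (x * u ^ 3) = \<phi> (x * u * u * u)" by (simp add: eval_nat_numeral mult.assoc)
    also have "\<dots> = \<phi> x * \<beta> a b ^ 3 + \<alpha> a b ^ 3 * \<phi> x"
      by (simp only: u) (simp add: w algebra_simps eval_nat_numeral)
    finally show ?case by simp
  next
    case (Suc n)
    have "\<phi> (x * u ^ (Suc n + 3)) = \<phi> (x * u ^ (n + 3) * u)"
      by (simp only: add_Suc power_Suc2 mult.assoc)
    also have "\<dots> = (\<phi> x * \<beta> a b ^ (n + 3) + \<alpha> a b ^ (n + 3) * \<phi> x) * \<beta> a b +
        \<alpha> a b * (\<phi> x * \<beta> a b ^ (n + 3) + \<alpha> a b ^ (n + 3) * \<phi> x)"
      by (simp only: u Suc.IH)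
    also have "\<dots> = \<phi> x * (\<beta> a b ^ (n + 3) * \<beta> a b) + \<alpha> a b * \<alpha> a b ^ (n + 3) * \<phi> x +
        (\<alpha> a b ^ (n + 3) * \<phi> x * \<beta> a b + \<alpha> a b * \<phi> x * \<beta> a b ^ (n + 3))"
      by (simp add: algebra_simps)
    also have "\<alpha> a b ^ (n + 3) * \<phi> x * \<beta> a b = \<alpha> a b ^ (n + 1) * (\<alpha> a b ^ 2 * \<phi> x * \<beta> a b)"
    proof -
      have n: "n + 3 = (n + 1) + 2" by simp
      show ?thesis unfolding n power_add[of _ "n + 1"] by (simp only: mult.assoc)
    qed
    also have "\<alpha> a b * \<phi> x * \<beta> a b ^ (n + 3) = \<alpha> a b * \<phi> x * \<beta> a b ^ 2 * \<beta> a b ^ (n + 1)"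
      by (simp add: mult.assoc eval_nat_numeral)
    finally show ?case
      by (simp only: hom_word1 hom_square_word add_Suc power_Suc) (simp add: power_commutes)
  qed
  then show ?thesis by (simp only: u_def)
qed

text \<open>Next to \<open>p\<close> the map \<open>\<phi>\<close> becomes multiplicative, next to
  \<open>q\<close> antimultiplicative. The letter \<open>\<phi> x\<close> in the annihilation
  conditions makes them stable when \<open>y\<close> is multiplied by ring elements.\<close>

definition separates :: "'r \<Rightarrow> 'u \<Rightarrow> 'u \<Rightarrow> bool"
  where "separates y p q \<longleftrightarrow>
    (\<forall>x. \<phi> (x * y) = \<phi> x * p + q * \<phi> x \<and> \<phi> (y * x) = p * \<phi> x + \<phi> x * q) \<and>
    (\<forall>c d x. \<alpha> c d * \<phi> x * p = 0 \<and> p * \<phi> x * \<alpha> c d = 0 \<and> \<beta> c d * \<phi> x * q = 0 \<and> q * \<phi> x * \<beta> c d = 0)"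

lemma separates_commutator_power: "separates ((a * b - b * a) ^ 9) (\<beta> a b ^ 9) (\<alpha> a b ^ 9)"
proof -
  define y p q where "y = (a * b - b * a) ^ 9" and "p = \<beta> a b ^ 9" and "q = \<alpha> a b ^ 9"
  have r: "\<phi> (x * y) = \<phi> x * p + q * \<phi> x" for x
    using mult_commutator_power[of x a b 6] by (simp add: y_def p_def q_def)
  have "\<phi> y = p + q"
    using r[of 1] by (simp add: p_def q_def eval_nat_numeral defect_unit defect_unit' mult.assoc)
  then have "\<phi> (y * x) = p * \<phi> x + \<phi> x * q" for x
    using jordan[of x y] r[of x] by (simp add: add algebra_simps)
  with r show ?thesis
    by (simp add: separates_def defect_annihilation flip: y_def p_def q_def)
       (simp add: p_def q_def defect_annihilation)
qed

lemma separatesD: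
  assumes "separates y p q"
  shows "\<phi> (x * y) = \<phi> x * p + q * \<phi> x" "\<phi> (y * x) = p * \<phi> x + \<phi> x * q"
    "\<alpha> c d * (\<phi> x * p) = 0" "p * (\<phi> x * \<alpha> c d) = 0" "\<beta> c d * (\<phi> x * q) = 0" "q * (\<phi> x * \<beta> c d) = 0"
    "\<alpha> c d * p = 0" "p * \<alpha> c d = 0" "\<beta> c d * q = 0" "q * \<beta> c d = 0"
proof -
  have *: "\<alpha> c d * (\<phi> x * p) = 0" "p * (\<phi> x * \<alpha> c d) = 0" "\<beta> c d * (\<phi> x * q) = 0" "q * (\<phi> x * \<beta> c d) = 0"
    for x using assms by (simp_all add: separates_def mult.assoc)
  show "\<alpha> c d * (\<phi> x * p) = 0" "p * (\<phi> x * \<alpha> c d) = 0" "\<beta> c d * (\<phi> x * q) = 0" "q * (\<phi> x * \<beta> c d) = 0"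
    by (fact *)+
  show "\<alpha> c d * p = 0" "p * \<alpha> c d = 0" "\<beta> c d * q = 0" "q * \<beta> c d = 0"
    using *[of 1] by (simp_all add: defect_unit flip: mult.assoc)
qed (use assms in \<open>simp_all add: separates_def\<close>)

lemma separates_mult:
  assumes s: "separates y p q"
  shows "separates (r * y) (\<phi> r * p) (q * \<phi> r)" "separates (y * r) (p * \<phi> r) (\<phi> r * q)"
proof -
  note [simp] = separatesD(3-)[OF s]
  have \<alpha>: "\<phi> (c * d) = \<alpha> c d + \<phi> c * \<phi> d" and \<beta>: "\<phi> (c * d) = \<beta> c d + \<phi> d * \<phi> c" for c d
    by (simp_all add: hom_defect_def anti_defect_def)
  have p: "\<phi> (c * d) * p = \<phi> c * (\<phi> d * p)" "p * \<phi> (c * d) = p * (\<phi> c * \<phi> d)" for c d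
    unfolding \<alpha> by (simp_all add: algebra_simps)
  have q: "\<phi> (c * d) * q = \<phi> d * (\<phi> c * q)" "q * \<phi> (c * d) = q * (\<phi> d * \<phi> c)" for c d
    unfolding \<beta> by (simp_all add: algebra_simps)
  have l: "\<phi> (x * (r * y)) = \<phi> x * (\<phi> r * p) + q * \<phi> r * \<phi> x" for x
    using separatesD(1)[OF s, of "x * r"] by (simp add: p q mult.assoc)
  have l': "\<phi> (r * y * x) = \<phi> r * p * \<phi> x + \<phi> x * (q * \<phi> r)" for x
    using jordan[of x "r * y"] l[of x] separatesD(1)[OF s, of r] by (simp add: add algebra_simps)
  have rr: "\<phi> (y * r * x) = p * \<phi> r * \<phi> x + \<phi> x * (\<phi> r * q)" for x
    using separatesD(2)[OF s, of "r * x"] by (simp add: p q mult.assoc)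
  have rr': "\<phi> (x * (y * r)) = \<phi> x * (p * \<phi> r) + \<phi> r * q * \<phi> x" for x
    using jordan[of x "y * r"] rr[of x] separatesD(2)[OF s, of r] by (simp add: add algebra_simps)
  have z1: "\<alpha> c d * (\<phi> x * (\<phi> r * p)) = 0" "\<beta> c d * (\<phi> x * (\<phi> r * q)) = 0" for c d x
    by (simp_all flip: p q)
  have "p * \<phi> r * \<phi> x = p * \<phi> (r * x)" "q * \<phi> r * \<phi> x = q * \<phi> (x * r)" for x
    by (simp_all add: p q mult.assoc)
  then have z2: "p * \<phi> r * \<phi> x * \<alpha> c d = 0" "q * \<phi> r * \<phi> x * \<beta> c d = 0" for c d x
    by (simp_all add: mult.assoc)
  have z3: "\<alpha> c d * (\<phi> x * (p * t)) = 0" "\<beta> c d * (\<phi> x * (q * t)) = 0" for c d x t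
  proof -
    have "\<alpha> c d * (\<phi> x * (p * t)) = \<alpha> c d * (\<phi> x * p) * t"
      "\<beta> c d * (\<phi> x * (q * t)) = \<beta> c d * (\<phi> x * q) * t"
      by (simp_all only: mult.assoc)
    then show "\<alpha> c d * (\<phi> x * (p * t)) = 0" "\<beta> c d * (\<phi> x * (q * t)) = 0"
      by simp_all
  qed
  show "separates (r * y) (\<phi> r * p) (q * \<phi> r)"
    unfolding separates_def using l l' z1 z2 by (simp add: z3 mult.assoc)
  show "separates (y * r) (p * \<phi> r) (\<phi> r * q)"
    unfolding separates_def using rr rr' z1 z2 by (simp add: z3 mult.assoc)
qed

lemma two_sided_ideal_separated: "two_sided_ideal {y. \<exists>p q. separates y p q}"
  unfolding two_sided_ideal_def
proof (intro conjI ballI allI)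
  have "separates 0 0 0" by (simp add: separates_def)
  then show "0 \<in> {y. \<exists>p q. separates y p q}" by blast
  fix x assume "x \<in> {y. \<exists>p q. separates y p q}"
  then obtain p q where x: "separates x p q" by blast
  then show "r * x \<in> {y. \<exists>p q. separates y p q}" "x * r \<in> {y. \<exists>p q. separates y p q}" for r
    using separates_mult by blast+
  fix y assume "y \<in> {y. \<exists>p q. separates y p q}"
  then obtain p' q' where y: "separates y p' q'" by blast
  have "separates (x - y) (p - p') (q - q')"
    using x y by (simp add: separates_def algebra_simps diff)
  then show "x - y \<in> {y. \<exists>p q. separates y p q}" by blast
qed

theorem standard_decomposition:
  assumes Z: "\<And>z x. z \<in> Z \<Longrightarrow> \<phi> (x * z) = 0 \<and> \<phi> (z * x) = 0"
    and K: "\<And>J. two_sided_ideal J \<Longrightarrow> Z \<subseteq> J \<Longrightarrow> (\<And>a b. a * b - b * a \<in> J) \<Longrightarrow> 1 \<in> J"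
  obtains e e' where "\<And>x. \<phi> x = e * \<phi> x + e' * \<phi> x"
    "\<And>x y. e * \<phi> (x * y) = (e * \<phi> x) * (e * \<phi> y)"
    "\<And>x y. e' * \<phi> (x * y) = (e' * \<phi> y) * (e' * \<phi> x)"
    "\<And>x y. (e * \<phi> x) * (e' * \<phi> y) = 0" "\<And>x y. (e' * \<phi> x) * (e * \<phi> y) = 0"
    "\<phi> 1 * e = e" "\<phi> 1 * e' = e'" "e * \<phi> 1 = e" "e' * \<phi> 1 = e'"
proof -
  have "1 \<in> {y. \<exists>p q. separates y p q}"
  proof (rule one_mem_of_commutator_powers[OF two_sided_ideal_separated _ _ K])
    have "separates z 0 0" if "z \<in> Z" for z using Z[OF that] by (simp add: separates_def)
    then show "Z \<subseteq> {y. \<exists>p q. separates y p q}" by blast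
    show "(a * b - b * a) ^ 9 \<in> {y. \<exists>p q. separates y p q}" for a b
      using separates_commutator_power by blast
  qed
  then obtain p q where s: "separates 1 p q" by blast
  \<comment> \<open>Cutting down to the corner makes \<open>\<phi> 1\<close> a unit for both
    elements. Then \<open>x = 1\<close> gives \<open>e + e' = \<phi> 1\<close>, and
    \<open>sum\<close> turns into commutation with all values of \<open>\<phi>\<close>.\<close>
  define e e' where "e = \<phi> 1 * p * \<phi> 1" and "e' = \<phi> 1 * q * \<phi> 1"
  have sum: "\<phi> x = \<phi> x * e + e' * \<phi> x" for x
    using arg_cong[OF separatesD(1)[OF s, of x], of "\<lambda>t. \<phi> 1 * t * \<phi> 1"]
    by (simp add: e_def e'_def algebra_simps unit_simps)
  have unit: "\<phi> 1 * e = e" "\<phi> 1 * e' = e'" "e * \<phi> 1 = e" "e' * \<phi> 1 = e'"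
    by (simp_all add: e_def e'_def mult.assoc unit_simps)
  have one: "e' = \<phi> 1 - e" using sum[of 1] by (simp add: unit algebra_simps)
  have comm: "e * \<phi> x = \<phi> x * e" for x
    using sum[of x] by (simp add: one algebra_simps unit_simps)
  have comm': "e' * \<phi> x = \<phi> x * e'" for x
    by (simp add: one algebra_simps unit_simps comm)
  have \<alpha>: "e * \<alpha> c d = 0" for c d
    using separatesD(8)[OF s] by (simp add: e_def mult.assoc defect_unit defect_unit')
  have \<beta>: "e' * \<beta> c d = 0" for c d
    using separatesD(10)[OF s] by (simp add: e'_def mult.assoc defect_unit defect_unit')
  have mult: "e * \<phi> (c * d) = e * (\<phi> c * \<phi> d)" "e' * \<phi> (c * d) = e' * (\<phi> d * \<phi> c)" for c d
    using \<alpha>[of c d] \<beta>[of c d] by (simp_all add: hom_defect_def anti_defect_def algebra_simps)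
  define f where "f = e * e'"
  have f: "f = e' * e" by (simp add: f_def one algebra_simps unit)
  have f_comm: "f * \<phi> x = \<phi> x * f" for x
    by (simp add: f_def mult.assoc comm') (simp add: comm flip: mult.assoc)
  have f_mult: "f * \<phi> (c * d) = f * (\<phi> c * \<phi> d)" for c d
    by (simp add: f mult.assoc mult)
  \<comment> \<open>Both defects are killed by \<open>f\<close>, hence so is their sum
    \<open>\<phi> (a * b - b * a)\<close>. The kernel is thus an ideal containing \<open>Z\<close>
    and all commutators, so \<open>K\<close> puts 1 into it and \<open>f = f * \<phi> 1\<close>
    vanishes.\<close>
  have "1 \<in> {x. f * \<phi> x = 0}"
  proof (rule K)
    show "two_sided_ideal {x. f * \<phi> x = 0}"
      unfolding two_sided_ideal_def
    proof (intro conjI ballI allI; simp add: diff right_diff_distrib)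
      fix x r assume x: "f * \<phi> x = 0"
      have "f * \<phi> (r * x) = \<phi> r * (f * \<phi> x)"
        unfolding f_mult by (metis f_comm mult.assoc)
      then show "f * \<phi> (r * x) = 0" using x by simp
      have "f * \<phi> (x * r) = f * \<phi> x * \<phi> r" unfolding f_mult by (simp add: mult.assoc)
      then show "f * \<phi> (x * r) = 0" using x by simp
    qed
    show "Z \<subseteq> {x. f * \<phi> x = 0}" using Z[of _ 1] by auto
    show "a * b - b * a \<in> {x. f * \<phi> x = 0}" for a b
    proof -
      have "f * \<alpha> a b = 0" unfolding f by (simp add: mult.assoc \<alpha>)
      moreover have "f * \<beta> a b = 0" unfolding f_def by (simp add: mult.assoc \<beta>)
      ultimately show ?thesis by (simp flip: defect_sum add: distrib_left)
    qed
  qed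
  then have f0: "e * e' = 0" "e' * e = 0"
    using unit(3,4) f by (simp_all add: f_def mult.assoc)
  have ee: "e * e = e" "e' * e' = e'"
    using f0 by (simp_all add: one algebra_simps unit unit_simps)
  show ?thesis
  proof
    show "\<phi> x = e * \<phi> x + e' * \<phi> x" for x using sum[of x] comm by simp
    show "e * \<phi> (x * y) = (e * \<phi> x) * (e * \<phi> y)" "e' * \<phi> (x * y) = (e' * \<phi> y) * (e' * \<phi> x)"
      "(e * \<phi> x) * (e' * \<phi> y) = 0" "(e' * \<phi> x) * (e * \<phi> y) = 0" for x y
    proof -
      have "(a * \<phi> x) * (b * \<phi> y) = (a * b) * (\<phi> x * \<phi> y)" if "b \<in> {e, e'}" for a b x y
      proof -
        have "\<phi> x * b = b * \<phi> x" using that comm comm' by auto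
        then have "(a * (\<phi> x * b)) * \<phi> y = (a * b) * (\<phi> x * \<phi> y)"
          by (simp add: mult.assoc)
        then show ?thesis by (simp add: mult.assoc)
      qed
      then show "e * \<phi> (x * y) = (e * \<phi> x) * (e * \<phi> y)" "e' * \<phi> (x * y) = (e' * \<phi> y) * (e' * \<phi> x)"
        "(e * \<phi> x) * (e' * \<phi> y) = 0" "(e' * \<phi> x) * (e * \<phi> y) = 0"
        by (simp_all add: ee f0 mult)
    qed
  qed (fact unit)+
qed

end

subsection \<open>Rings with a carrier\<close>

text \<open>
  The product of all rings with elements in \<open>'a\<close> is an instance of the type classes and has every
  such ring as a factor. Statements proved for type classes thereby carry over to rings with an
  explicit carrier.
\<close>

typedef 'a ring_prod = "{f :: 'a ring \<Rightarrow> 'a. \<forall>S. if Ring.ring S then f S \<in> carrier S else f S = undefined}"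
  morphisms component Abs_ring_prod
proof
  show "(\<lambda>S. if Ring.ring S then \<zero>\<^bsub>S\<^esub> else undefined) \<in>
      {f. \<forall>S. if Ring.ring S then f S \<in> carrier S else f S = undefined}"
    by (auto simp: ring.ring_simprules)
qed

setup_lifting type_definition_ring_prod

instantiation ring_prod :: (type) Rings.ring
begin

lift_definition zero_ring_prod :: "'a ring_prod" is "\<lambda>S. if Ring.ring S then \<zero>\<^bsub>S\<^esub> else undefined"
  by (auto simp: ring.ring_simprules)
lift_definition plus_ring_prod :: "'a ring_prod \<Rightarrow> 'a ring_prod \<Rightarrow> 'a ring_prod"
  is "\<lambda>f g S. if Ring.ring S then f S \<oplus>\<^bsub>S\<^esub> g S else undefined"
  by (auto simp: ring.ring_simprules)
lift_definition uminus_ring_prod :: "'a ring_prod \<Rightarrow> 'a ring_prod"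
  is "\<lambda>f S. if Ring.ring S then \<ominus>\<^bsub>S\<^esub> f S else undefined"
  by (auto simp: ring.ring_simprules)
lift_definition minus_ring_prod :: "'a ring_prod \<Rightarrow> 'a ring_prod \<Rightarrow> 'a ring_prod"
  is "\<lambda>f g S. if Ring.ring S then f S \<ominus>\<^bsub>S\<^esub> g S else undefined"
  by (auto simp: ring.ring_simprules)
lift_definition times_ring_prod :: "'a ring_prod \<Rightarrow> 'a ring_prod \<Rightarrow> 'a ring_prod"
  is "\<lambda>f g S. if Ring.ring S then f S \<otimes>\<^bsub>S\<^esub> g S else undefined"
  by (auto simp: ring.ring_simprules)

instance
  by standard (transfer; auto simp: fun_eq_iff ring.ring_simprules)+

end

instantiation ring_prod :: (type) monoid_mult
begin
lift_definition one_ring_prod :: "'a ring_prod" is "\<lambda>S. if Ring.ring S then \<one>\<^bsub>S\<^esub> else undefined"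
  by (auto simp: ring.ring_simprules)
instance
  by standard (transfer; auto simp: fun_eq_iff ring.ring_simprules monoid.r_one ring.is_monoid)+
end

text \<open>Additive and multiplicative on the carrier, but in general not unital; hence the role of
  the corner of \<open>\<phi> 1\<close> in \<open>jordan_unital\<close>.\<close>

lift_definition ring_embed :: "'a ring \<Rightarrow> 'a \<Rightarrow> 'a ring_prod"
  is "\<lambda>S a T. if Ring.ring T then (if T = S \<and> a \<in> carrier S then a else \<zero>\<^bsub>T\<^esub>) else undefined"
  by (auto simp: ring.ring_simprules)

context
  fixes S :: "'a ring"
  assumes S: "Ring.ring S"
begin

lemma component_simps:
  "component x S \<in> carrier S"
  "component 0 S = \<zero>\<^bsub>S\<^esub>" "component 1 S = \<one>\<^bsub>S\<^esub>"
  "component (x + y) S = component x S \<oplus>\<^bsub>S\<^esub> component y S"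
  "component (x - y) S = component x S \<ominus>\<^bsub>S\<^esub> component y S"
  "component (x * y) S = component x S \<otimes>\<^bsub>S\<^esub> component y S"
  using S component[of x] by (simp_all add: zero_ring_prod.rep_eq one_ring_prod.rep_eq plus_ring_prod.rep_eq
      minus_ring_prod.rep_eq times_ring_prod.rep_eq)

lemma component_ring_embed: "a \<in> carrier S \<Longrightarrow> component (ring_embed S a) S = a"
  using S by (simp add: ring_embed.rep_eq)

lemma ring_embed_eqI:
  assumes "a \<in> carrier S" "component t S = a" "\<And>T. Ring.ring T \<Longrightarrow> T \<noteq> S \<Longrightarrow> component t T = \<zero>\<^bsub>T\<^esub>"
  shows "t = ring_embed S a"
proof (rule component_inject[THEN iffD1], rule ext)
  fix T show "component t T = component (ring_embed S a) T"
    using assms component[of t] S by (cases "Ring.ring T") (auto simp: ring_embed.rep_eq)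
qed

lemma component_ring_embed_other: "T \<noteq> S \<Longrightarrow> Ring.ring T \<Longrightarrow> component (ring_embed S a) T = \<zero>\<^bsub>T\<^esub>"
  by (simp add: ring_embed.rep_eq)

end

lemma ring_embed_simps:
  assumes S: "Ring.ring S" and "a \<in> carrier S" "b \<in> carrier S"
  shows "ring_embed S a + ring_embed S b = ring_embed S (a \<oplus>\<^bsub>S\<^esub> b)" "ring_embed S a * ring_embed S b = ring_embed S (a \<otimes>\<^bsub>S\<^esub> b)"
  using assms
  by (intro ring_embed_eqI; simp add: component_simps component_ring_embed component_ring_embed_other ring.ring_simprules)+

text \<open>Hypothesis \<open>K\<close> applies to the projection of \<open>J\<close> to the factor
  \<open>S\<close>. An element of \<open>J\<close> with component \<open>\<one>\<close> at
  \<open>S\<close> differs from 1 by one with component zero, and all of those lie in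
  \<open>J\<close>.\<close>

lemma one_mem_two_sided_ideal:
  fixes S :: "'a ring"
  assumes S: "Ring.ring S"
    and K: "\<And>I. ideal I S \<Longrightarrow> (\<And>a b. a \<in> carrier S \<Longrightarrow> b \<in> carrier S \<Longrightarrow> a \<otimes>\<^bsub>S\<^esub> b \<ominus>\<^bsub>S\<^esub> b \<otimes>\<^bsub>S\<^esub> a \<in> I) \<Longrightarrow> \<one>\<^bsub>S\<^esub> \<in> I"
    and J: "two_sided_ideal J" "{z. component z S = \<zero>\<^bsub>S\<^esub>} \<subseteq> J" "\<And>a b. a * b - b * a \<in> J"
  shows "1 \<in> J"
proof -
  interpret S: ring S by (rule S)
  let ?I = "(\<lambda>x. component x S) ` J"
  note J' = two_sided_idealD[OF J(1)]
  have "ideal ?I S"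
  proof (rule idealI)
    show "subgroup ?I (add_monoid S)"
    proof (rule S.add.subgroupI)
      show "?I \<subseteq> carrier S" using component_simps(1)[OF S] by auto
      show "?I \<noteq> {}" using J'(1) by auto
      show "\<ominus>\<^bsub>S\<^esub> a \<in> ?I" if a: "a \<in> ?I" for a
      proof -
        obtain x where x: "x \<in> J" "a = component x S" using a by blast
        have "component (0 - x) S = \<ominus>\<^bsub>S\<^esub> a"
          unfolding component_simps[OF S] x(2)
          using component_simps(1)[OF S, of x] by (simp add: S.ring_simprules)
        then show ?thesis using J'(2)[OF J'(1) x(1)] by (rule image_eqI[OF sym])
      qed
      show "a \<oplus>\<^bsub>S\<^esub> b \<in> ?I" if ab: "a \<in> ?I" "b \<in> ?I" for a b
      proof -
        obtain x y where "x \<in> J" "y \<in> J" "a = component x S" "b = component y S" using ab by blast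
        then have "a \<oplus>\<^bsub>S\<^esub> b = component (x + y) S" "x + y \<in> J"
          using J'(4) component_simps(4)[OF S] by auto
        then show ?thesis by (rule image_eqI)
      qed
    qed
    show "x \<otimes>\<^bsub>S\<^esub> a \<in> ?I" "a \<otimes>\<^bsub>S\<^esub> x \<in> ?I" if ax: "a \<in> ?I" "x \<in> carrier S" for a x
    proof -
      obtain y where y: "y \<in> J" "a = component y S" using ax(1) by blast
      have "x \<otimes>\<^bsub>S\<^esub> a = component (ring_embed S x * y) S" "a \<otimes>\<^bsub>S\<^esub> x = component (y * ring_embed S x) S"
        using ax y by (simp_all add: component_simps[OF S] component_ring_embed[OF S])
      then show "x \<otimes>\<^bsub>S\<^esub> a \<in> ?I" "a \<otimes>\<^bsub>S\<^esub> x \<in> ?I" using J'(5,6) y by auto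
    qed
  qed (rule S)
  moreover have "a \<otimes>\<^bsub>S\<^esub> b \<ominus>\<^bsub>S\<^esub> b \<otimes>\<^bsub>S\<^esub> a \<in> ?I" if "a \<in> carrier S" "b \<in> carrier S" for a b
  proof -
    have "component (ring_embed S a * ring_embed S b - ring_embed S b * ring_embed S a) S = a \<otimes>\<^bsub>S\<^esub> b \<ominus>\<^bsub>S\<^esub> b \<otimes>\<^bsub>S\<^esub> a"
      using that by (simp add: component_simps[OF S] component_ring_embed[OF S])
    then show ?thesis using J(3) by (rule image_eqI[OF sym])
  qed
  ultimately have "\<one>\<^bsub>S\<^esub> \<in> ?I" by (rule K)
  then obtain j where j: "j \<in> J" "component j S = \<one>\<^bsub>S\<^esub>" by auto
  have "1 - j \<in> J"
    using J(2) j by (auto simp: component_simps[OF S] S.r_right_minus_eq)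
  then show ?thesis using J'(4)[OF _ j(1), of "1 - j"] by simp
qed

theorem standard_decomposition_carrier:
  fixes R :: "'r ring" and U :: "'u ring"
  assumes R: "Ring.ring R" and U: "Ring.ring U"
    and K: "\<And>I. ideal I R \<Longrightarrow> (\<And>a b. a \<in> carrier R \<Longrightarrow> b \<in> carrier R \<Longrightarrow> a \<otimes>\<^bsub>R\<^esub> b \<ominus>\<^bsub>R\<^esub> b \<otimes>\<^bsub>R\<^esub> a \<in> I) \<Longrightarrow> \<one>\<^bsub>R\<^esub> \<in> I"
    and closed: "\<And>x. x \<in> carrier R \<Longrightarrow> \<phi> x \<in> carrier U"
    and add: "\<And>x y. x \<in> carrier R \<Longrightarrow> y \<in> carrier R \<Longrightarrow> \<phi> (x \<oplus>\<^bsub>R\<^esub> y) = \<phi> x \<oplus>\<^bsub>U\<^esub> \<phi> y"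
    and jordan: "\<And>x y. x \<in> carrier R \<Longrightarrow> y \<in> carrier R \<Longrightarrow>
      \<phi> (x \<otimes>\<^bsub>R\<^esub> y \<oplus>\<^bsub>R\<^esub> y \<otimes>\<^bsub>R\<^esub> x) = \<phi> x \<otimes>\<^bsub>U\<^esub> \<phi> y \<oplus>\<^bsub>U\<^esub> \<phi> y \<otimes>\<^bsub>U\<^esub> \<phi> x"
    and one: "\<phi> \<one>\<^bsub>R\<^esub> = \<one>\<^bsub>U\<^esub>"
    and torsion_free: "\<And>t. t \<in> carrier U \<Longrightarrow> t \<oplus>\<^bsub>U\<^esub> t = \<zero>\<^bsub>U\<^esub> \<Longrightarrow> t = \<zero>\<^bsub>U\<^esub>"
  obtains e e' where "e \<in> carrier U" "e' \<in> carrier U"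
    "\<And>x. x \<in> carrier R \<Longrightarrow> \<phi> x = e \<otimes>\<^bsub>U\<^esub> \<phi> x \<oplus>\<^bsub>U\<^esub> e' \<otimes>\<^bsub>U\<^esub> \<phi> x"
    "\<And>x y. x \<in> carrier R \<Longrightarrow> y \<in> carrier R \<Longrightarrow>
      e \<otimes>\<^bsub>U\<^esub> \<phi> (x \<otimes>\<^bsub>R\<^esub> y) = (e \<otimes>\<^bsub>U\<^esub> \<phi> x) \<otimes>\<^bsub>U\<^esub> (e \<otimes>\<^bsub>U\<^esub> \<phi> y)"
    "\<And>x y. x \<in> carrier R \<Longrightarrow> y \<in> carrier R \<Longrightarrow>
      e' \<otimes>\<^bsub>U\<^esub> \<phi> (x \<otimes>\<^bsub>R\<^esub> y) = (e' \<otimes>\<^bsub>U\<^esub> \<phi> y) \<otimes>\<^bsub>U\<^esub> (e' \<otimes>\<^bsub>U\<^esub> \<phi> x)"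
    "\<And>x y. x \<in> carrier R \<Longrightarrow> y \<in> carrier R \<Longrightarrow> (e \<otimes>\<^bsub>U\<^esub> \<phi> x) \<otimes>\<^bsub>U\<^esub> (e' \<otimes>\<^bsub>U\<^esub> \<phi> y) = \<zero>\<^bsub>U\<^esub>"
    "\<And>x y. x \<in> carrier R \<Longrightarrow> y \<in> carrier R \<Longrightarrow> (e' \<otimes>\<^bsub>U\<^esub> \<phi> x) \<otimes>\<^bsub>U\<^esub> (e \<otimes>\<^bsub>U\<^esub> \<phi> y) = \<zero>\<^bsub>U\<^esub>"
proof -
  interpret R: ring R by (rule R)
  interpret U: ring U by (rule U)
  let ?R = "\<lambda>x. component x R" and ?U = "\<lambda>x. component x U"
  define \<Phi> where "\<Phi> x = ring_embed U (\<phi> (?R x))" for x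
  note cR = component_simps[OF R] component_ring_embed[OF R]
  note cU = component_simps[OF U] component_ring_embed[OF U]
  have c: "\<phi> (?R x) \<in> carrier U" for x by (intro closed cR)
  have z: "\<phi> \<zero>\<^bsub>R\<^esub> = \<zero>\<^bsub>U\<^esub>"
    using add[of "\<zero>\<^bsub>R\<^esub>" "\<zero>\<^bsub>R\<^esub>"] closed[of "\<zero>\<^bsub>R\<^esub>"] by (simp add: U.add.r_cancel_one)
  have e0: "ring_embed U \<zero>\<^bsub>U\<^esub> = 0"
    by (rule ring_embed_eqI[OF U, symmetric]) (simp_all add: component_simps U)
  interpret jordan_unital \<Phi>
  proof
    show "\<Phi> (x + y) = \<Phi> x + \<Phi> y" for x y
      by (simp add: \<Phi>_def ring_embed_simps[OF U] c cR add)
    show "\<Phi> (x * y + y * x) = \<Phi> x * \<Phi> y + \<Phi> y * \<Phi> x" for x y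
      by (simp add: \<Phi>_def ring_embed_simps[OF U] c cR jordan)
    show "\<Phi> 1 * \<Phi> x = \<Phi> x" "\<Phi> x * \<Phi> 1 = \<Phi> x" for x
      by (simp_all add: \<Phi>_def ring_embed_simps[OF U] c cR one)
    fix t assume t: "\<Phi> 1 * t = t" "t + t = 0"
    \<comment> \<open>\<open>\<Phi> 1\<close> vanishes outside the factor \<open>U\<close>, so
      \<open>t = \<Phi> 1 * t\<close> does too, and 2-torsion in the other factors does no
      harm.\<close>
    have "t = ring_embed U (?U t)"
    proof (rule ring_embed_eqI[OF U])
      fix T :: "'u ring" assume T: "Ring.ring T" "T \<noteq> U"
      have "component (\<Phi> 1 * t) T = \<zero>\<^bsub>T\<^esub>"
        using T component_simps(1)[OF T(1), of t]
        by (simp add: component_simps[OF T(1)] \<Phi>_def component_ring_embed_other[OF U T(2,1)] ring.ring_simprules)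
      then show "component t T = \<zero>\<^bsub>T\<^esub>" by (simp add: t)
    qed (simp_all add: cU)
    moreover have "?U t = \<zero>\<^bsub>U\<^esub>"
      using arg_cong[OF t(2), of ?U] torsion_free[of "?U t"] by (simp add: cU)
    ultimately show "t = 0" by (simp add: e0)
  qed
  have U\<Phi>: "?U (\<Phi> x) = \<phi> (?R x)" for x by (simp add: \<Phi>_def cU c)
  obtain e e' where e: "\<And>x. \<Phi> x = e * \<Phi> x + e' * \<Phi> x"
    "\<And>x y. e * \<Phi> (x * y) = (e * \<Phi> x) * (e * \<Phi> y)"
    "\<And>x y. e' * \<Phi> (x * y) = (e' * \<Phi> y) * (e' * \<Phi> x)"
    "\<And>x y. (e * \<Phi> x) * (e' * \<Phi> y) = 0" "\<And>x y. (e' * \<Phi> x) * (e * \<Phi> y) = 0"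
    "\<Phi> 1 * e = e" "\<Phi> 1 * e' = e'" "e * \<Phi> 1 = e" "e' * \<Phi> 1 = e'"
  proof (rule standard_decomposition[of "{z. ?R z = \<zero>\<^bsub>R\<^esub>}"])
    show "\<Phi> (x * z) = 0 \<and> \<Phi> (z * x) = 0" if "z \<in> {z. ?R z = \<zero>\<^bsub>R\<^esub>}" for z x
      using that by (simp add: \<Phi>_def cR z e0)
    show "1 \<in> J" if "two_sided_ideal J" "{z. ?R z = \<zero>\<^bsub>R\<^esub>} \<subseteq> J" "\<And>a b. a * b - b * a \<in> J" for J
      by (rule one_mem_two_sided_ideal[OF R K that])
  qed (rule that)
  show ?thesis
  proof (rule that[of "?U e" "?U e'"])
    fix x y assume xy: "x \<in> carrier R" "y \<in> carrier R"
    note a = arg_cong[of _ _ ?U]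
    show "?U e \<otimes>\<^bsub>U\<^esub> \<phi> (x \<otimes>\<^bsub>R\<^esub> y) = (?U e \<otimes>\<^bsub>U\<^esub> \<phi> x) \<otimes>\<^bsub>U\<^esub> (?U e \<otimes>\<^bsub>U\<^esub> \<phi> y)"
      using a[OF e(2)[of "ring_embed R x" "ring_embed R y"]] xy by (simp add: cU U\<Phi> cR)
    show "?U e' \<otimes>\<^bsub>U\<^esub> \<phi> (x \<otimes>\<^bsub>R\<^esub> y) = (?U e' \<otimes>\<^bsub>U\<^esub> \<phi> y) \<otimes>\<^bsub>U\<^esub> (?U e' \<otimes>\<^bsub>U\<^esub> \<phi> x)"
      using a[OF e(3)[of "ring_embed R x" "ring_embed R y"]] xy by (simp add: cU U\<Phi> cR)
    show "(?U e \<otimes>\<^bsub>U\<^esub> \<phi> x) \<otimes>\<^bsub>U\<^esub> (?U e' \<otimes>\<^bsub>U\<^esub> \<phi> y) = \<zero>\<^bsub>U\<^esub>"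
      using a[OF e(4)[of "ring_embed R x" "ring_embed R y"]] xy by (simp add: cU U\<Phi> cR)
    show "(?U e' \<otimes>\<^bsub>U\<^esub> \<phi> x) \<otimes>\<^bsub>U\<^esub> (?U e \<otimes>\<^bsub>U\<^esub> \<phi> y) = \<zero>\<^bsub>U\<^esub>"
      using a[OF e(5)[of "ring_embed R x" "ring_embed R y"]] xy by (simp add: cU U\<Phi> cR)
  next
    fix x assume "x \<in> carrier R"
    then show "\<phi> x = ?U e \<otimes>\<^bsub>U\<^esub> \<phi> x \<oplus>\<^bsub>U\<^esub> ?U e' \<otimes>\<^bsub>U\<^esub> \<phi> x"
      using arg_cong[OF e(1)[of "ring_embed R x"], of ?U] by (simp add: cU U\<Phi> cR)
  qed (simp_all add: cU)
qed

section \<open>Peirce corners and the transfer to algebras over \<open>F\<close>\<close>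

context assoc_algebra
begin

lemmas mult_rules = mult_closed mult_assoc mult_l_distr mult_r_distr smult_mult_l smult_mult_r

lemma mult_zero:
  assumes "x \<in> carrier A"
  shows "x \<otimes>\<^bsub>A\<^esub> \<zero>\<^bsub>A\<^esub> = \<zero>\<^bsub>A\<^esub>" "\<zero>\<^bsub>A\<^esub> \<otimes>\<^bsub>A\<^esub> x = \<zero>\<^bsub>A\<^esub>"
  using mult_r_distr[of "\<zero>\<^bsub>A\<^esub>" "\<zero>\<^bsub>A\<^esub>" x] mult_l_distr[of "\<zero>\<^bsub>A\<^esub>" "\<zero>\<^bsub>A\<^esub>" x] assms
  by (simp_all add: mult_closed)

lemma torsion_free:
  assumes two: "\<one> \<oplus> \<one> \<noteq> \<zero>" and t: "t \<in> carrier A" "t \<oplus>\<^bsub>A\<^esub> t = \<zero>\<^bsub>A\<^esub>"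
  shows "t = \<zero>\<^bsub>A\<^esub>"
proof -
  have *: "(\<one> \<oplus> \<one>) \<odot>\<^bsub>A\<^esub> t = \<zero>\<^bsub>A\<^esub>"
    using t by (simp add: smult_l_distr)
  have u: "\<one> \<oplus> \<one> \<in> Units F" using two by (simp add: field_Units)
  have "t = (inv (\<one> \<oplus> \<one>) \<otimes> (\<one> \<oplus> \<one>)) \<odot>\<^bsub>A\<^esub> t" using u t by simp
  also have "\<dots> = inv (\<one> \<oplus> \<one>) \<odot>\<^bsub>A\<^esub> ((\<one> \<oplus> \<one>) \<odot>\<^bsub>A\<^esub> t)"
    using u t by (intro smult_assoc1) simp_all
  finally show ?thesis using * u by simp
qed

lemma cancel2:
  assumes two: "\<one> \<oplus> \<one> \<noteq> \<zero>" and xy: "x \<in> carrier A" "y \<in> carrier A" "x \<oplus>\<^bsub>A\<^esub> x = y \<oplus>\<^bsub>A\<^esub> y"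
  shows "x = y"
proof -
  have "(x \<ominus>\<^bsub>A\<^esub> y) \<oplus>\<^bsub>A\<^esub> (x \<ominus>\<^bsub>A\<^esub> y) = (x \<oplus>\<^bsub>A\<^esub> x) \<ominus>\<^bsub>A\<^esub> (y \<oplus>\<^bsub>A\<^esub> y)"
    using xy(1,2) by (simp add: a_minus_def M.minus_add M.a_ac)
  then have "x \<ominus>\<^bsub>A\<^esub> y = \<zero>\<^bsub>A\<^esub>"
    using xy by - (rule torsion_free[OF two], simp_all add: a_minus_def M.r_neg)
  moreover have "x = (x \<ominus>\<^bsub>A\<^esub> y) \<oplus>\<^bsub>A\<^esub> y"
    using xy(1,2) by (simp add: a_minus_def M.a_assoc M.l_neg)
  ultimately show ?thesis using xy(2) by simp
qed

text \<open>For an idempotent \<open>i\<close> this is the Peirce corner \<open>iAi\<close>, a ring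
  with unit \<open>i\<close> even when the algebra has no unit.\<close>

definition corner :: "'c \<Rightarrow> 'c ring"
  where "corner i = \<lparr>carrier = {b \<in> carrier A. i \<otimes>\<^bsub>A\<^esub> b = b \<and> b \<otimes>\<^bsub>A\<^esub> i = b},
    monoid.mult = monoid.mult A, one = i, ring.zero = \<zero>\<^bsub>A\<^esub>, ring.add = ring.add A\<rparr>"

lemma ring_corner:
  assumes i: "i \<in> carrier A" "i \<otimes>\<^bsub>A\<^esub> i = i"
  shows "Ring.ring (corner i)"
proof (rule ringI)
  show "abelian_group (corner i)"
  proof (rule abelian_groupI)
    show "\<exists>y\<in>carrier (corner i). y \<oplus>\<^bsub>corner i\<^esub> x = \<zero>\<^bsub>corner i\<^esub>" if "x \<in> carrier (corner i)" for x
    proof -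
      have x: "x \<in> carrier A" "i \<otimes>\<^bsub>A\<^esub> x = x" "x \<otimes>\<^bsub>A\<^esub> i = x" using that by (auto simp: corner_def)
      have "i \<otimes>\<^bsub>A\<^esub> (\<ominus>\<^bsub>A\<^esub> x) = \<ominus>\<^bsub>A\<^esub> x"
      proof (rule M.minus_equality[symmetric])
        show "i \<otimes>\<^bsub>A\<^esub> (\<ominus>\<^bsub>A\<^esub> x) \<oplus>\<^bsub>A\<^esub> x = \<zero>\<^bsub>A\<^esub>"
          using mult_r_distr[of "\<ominus>\<^bsub>A\<^esub> x" x i] i x by (simp add: M.l_neg mult_zero)
      qed (use i x in \<open>simp_all add: mult_closed\<close>)
      moreover have "(\<ominus>\<^bsub>A\<^esub> x) \<otimes>\<^bsub>A\<^esub> i = \<ominus>\<^bsub>A\<^esub> x"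
      proof (rule M.minus_equality[symmetric])
        show "(\<ominus>\<^bsub>A\<^esub> x) \<otimes>\<^bsub>A\<^esub> i \<oplus>\<^bsub>A\<^esub> x = \<zero>\<^bsub>A\<^esub>"
          using mult_l_distr[of "\<ominus>\<^bsub>A\<^esub> x" x i] i x by (simp add: M.l_neg mult_zero)
      qed (use i x in \<open>simp_all add: mult_closed\<close>)
      ultimately have "\<ominus>\<^bsub>A\<^esub> x \<in> carrier (corner i)" using x by (simp add: corner_def)
      then show ?thesis using x by (intro bexI[of _ "\<ominus>\<^bsub>A\<^esub> x"]) (simp_all add: corner_def M.l_neg)
    qed
  qed (use i in \<open>auto simp: corner_def mult_rules mult_zero M.a_ac\<close>)
  show "monoid (corner i)"
  proof -
    have "i \<otimes>\<^bsub>A\<^esub> (x \<otimes>\<^bsub>A\<^esub> y) = x \<otimes>\<^bsub>A\<^esub> y" if "x \<in> carrier A" "y \<in> carrier A" "i \<otimes>\<^bsub>A\<^esub> x = x" for x y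
      using that i by (simp flip: mult_assoc)
    then show ?thesis
      by (intro monoidI) (use i in \<open>auto simp: corner_def mult_closed mult_assoc\<close>)
  qed
qed (use i in \<open>auto simp: corner_def mult_rules\<close>)

end

text \<open>The factors of \<open>'a ring_prod\<close> are indexed by records of type
  \<open>'a ring\<close>, so the scalar multiplication and any further fields must be cut
  off.\<close>

definition ring_reduct :: "('a, 'm) ring_scheme \<Rightarrow> 'a ring"
  where "ring_reduct T = \<lparr>carrier = carrier T, monoid.mult = monoid.mult T, one = one T,
    ring.zero = ring.zero T, ring.add = ring.add T\<rparr>"

theorem jordan_hom_standard:
  fixes T :: "('f, 't) module" and B :: "('f, 'b) module"
  assumes B: "assoc_algebra F B" and two: "\<one>\<^bsub>F\<^esub> \<oplus>\<^bsub>F\<^esub> \<one>\<^bsub>F\<^esub> \<noteq> \<zero>\<^bsub>F\<^esub>"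
    and T: "Ring.ring (ring_reduct T)"
    and K: "\<And>I. ideal I (ring_reduct T) \<Longrightarrow>
      (\<And>a b. a \<in> carrier T \<Longrightarrow> b \<in> carrier T \<Longrightarrow>
        a \<otimes>\<^bsub>T\<^esub> b \<ominus>\<^bsub>ring_reduct T\<^esub> b \<otimes>\<^bsub>T\<^esub> a \<in> I) \<Longrightarrow> \<one>\<^bsub>T\<^esub> \<in> I"
    and \<phi>: "jordan_hom F T B \<phi>"
  shows "standard_map F T B \<phi>"
proof -
  interpret B: assoc_algebra F B by (rule B)
  let ?R = "ring_reduct T"
  interpret R: ring ?R by (rule T)
  have R: "carrier ?R = carrier T" "\<one>\<^bsub>?R\<^esub> = \<one>\<^bsub>T\<^esub>" "x \<otimes>\<^bsub>?R\<^esub> y = x \<otimes>\<^bsub>T\<^esub> y" "x \<oplus>\<^bsub>?R\<^esub> y = x \<oplus>\<^bsub>T\<^esub> y" for x y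
    by (simp_all add: ring_reduct_def)
  have closed: "\<phi> x \<in> carrier B" if "x \<in> carrier T" for x
    using \<phi> that by (auto simp: jordan_hom_def linear_map_def)
  have add: "\<phi> (x \<oplus>\<^bsub>T\<^esub> y) = \<phi> x \<oplus>\<^bsub>B\<^esub> \<phi> y" if "x \<in> carrier T" "y \<in> carrier T" for x y
    using \<phi> that by (auto simp: jordan_hom_def linear_map_def)
  have jordan: "\<phi> (x \<otimes>\<^bsub>T\<^esub> y \<oplus>\<^bsub>T\<^esub> y \<otimes>\<^bsub>T\<^esub> x) = \<phi> x \<otimes>\<^bsub>B\<^esub> \<phi> y \<oplus>\<^bsub>B\<^esub> \<phi> y \<otimes>\<^bsub>B\<^esub> \<phi> x"
    if "x \<in> carrier T" "y \<in> carrier T" for x y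
    using \<phi> that by (auto simp: jordan_hom_def jordan_product_def)
  define i where "i = \<phi> \<one>\<^bsub>T\<^esub>"
  have one: "\<one>\<^bsub>T\<^esub> \<in> carrier T" "x \<in> carrier T \<Longrightarrow> \<one>\<^bsub>T\<^esub> \<otimes>\<^bsub>T\<^esub> x = x" "x \<in> carrier T \<Longrightarrow> x \<otimes>\<^bsub>T\<^esub> \<one>\<^bsub>T\<^esub> = x" for x
    using R.one_closed R.l_one[of x] R.r_one[of x] by (simp_all add: R)
  have i: "i \<in> carrier B" unfolding i_def by (rule closed) (rule one)
  have double: "\<phi> x \<oplus>\<^bsub>B\<^esub> \<phi> x = i \<otimes>\<^bsub>B\<^esub> \<phi> x \<oplus>\<^bsub>B\<^esub> \<phi> x \<otimes>\<^bsub>B\<^esub> i" if "x \<in> carrier T" for x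
    using jordan[OF one(1) that] add[OF that that] that by (simp add: one i_def)
  have ii: "i \<otimes>\<^bsub>B\<^esub> i = i"
    using double[OF one(1)] i by - (rule B.cancel2[OF two], simp_all add: i_def B.mult_closed)
  \<comment> \<open>Multiplying \<open>double\<close> by \<open>i\<close> on the left and on the
    right shows that \<open>i \<phi>(x)\<close> and \<open>\<phi>(x) i\<close> both equal
    \<open>i \<phi>(x) i\<close>; \<open>double\<close> then identifies this with
    \<open>\<phi>(x)\<close>.\<close>
  have unit: "i \<otimes>\<^bsub>B\<^esub> \<phi> x = \<phi> x" "\<phi> x \<otimes>\<^bsub>B\<^esub> i = \<phi> x" if x: "x \<in> carrier T" for x
  proof -
    note c = closed[OF x] i
    have 1: "i \<otimes>\<^bsub>B\<^esub> (i \<otimes>\<^bsub>B\<^esub> y) = i \<otimes>\<^bsub>B\<^esub> y" if "y \<in> carrier B" for y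
      using that i ii by (simp flip: B.mult_assoc)
    have "i \<otimes>\<^bsub>B\<^esub> \<phi> x \<oplus>\<^bsub>B\<^esub> i \<otimes>\<^bsub>B\<^esub> \<phi> x = i \<otimes>\<^bsub>B\<^esub> \<phi> x \<oplus>\<^bsub>B\<^esub> i \<otimes>\<^bsub>B\<^esub> (\<phi> x \<otimes>\<^bsub>B\<^esub> i)"
      using arg_cong[OF double[OF x], of "\<lambda>y. i \<otimes>\<^bsub>B\<^esub> y"] c by (simp add: B.mult_rules 1)
    then have l: "i \<otimes>\<^bsub>B\<^esub> \<phi> x = i \<otimes>\<^bsub>B\<^esub> (\<phi> x \<otimes>\<^bsub>B\<^esub> i)"
      using c by (simp add: B.mult_closed)
    have "\<phi> x \<otimes>\<^bsub>B\<^esub> i \<oplus>\<^bsub>B\<^esub> \<phi> x \<otimes>\<^bsub>B\<^esub> i = i \<otimes>\<^bsub>B\<^esub> (\<phi> x \<otimes>\<^bsub>B\<^esub> i) \<oplus>\<^bsub>B\<^esub> \<phi> x \<otimes>\<^bsub>B\<^esub> i"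
      using arg_cong[OF double[OF x], of "\<lambda>y. y \<otimes>\<^bsub>B\<^esub> i"] c by (simp add: B.mult_rules ii)
    then have r: "\<phi> x \<otimes>\<^bsub>B\<^esub> i = i \<otimes>\<^bsub>B\<^esub> (\<phi> x \<otimes>\<^bsub>B\<^esub> i)"
      using c by (simp add: B.mult_closed)
    have "\<phi> x \<oplus>\<^bsub>B\<^esub> \<phi> x = i \<otimes>\<^bsub>B\<^esub> \<phi> x \<oplus>\<^bsub>B\<^esub> i \<otimes>\<^bsub>B\<^esub> \<phi> x"
      using double[OF x] l r by simp
    then show "i \<otimes>\<^bsub>B\<^esub> \<phi> x = \<phi> x" using c by - (rule B.cancel2[OF two], simp_all add: B.mult_closed)
    with l r show "\<phi> x \<otimes>\<^bsub>B\<^esub> i = \<phi> x" by simp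
  qed
  let ?U = "B.corner i"
  have U: "carrier ?U \<subseteq> carrier B" "\<one>\<^bsub>?U\<^esub> = i" "\<zero>\<^bsub>?U\<^esub> = \<zero>\<^bsub>B\<^esub>" "x \<otimes>\<^bsub>?U\<^esub> y = x \<otimes>\<^bsub>B\<^esub> y" "x \<oplus>\<^bsub>?U\<^esub> y = x \<oplus>\<^bsub>B\<^esub> y" for x y
    by (auto simp: B.corner_def)
  obtain e e' where e: "e \<in> carrier ?U" "e' \<in> carrier ?U"
    "\<And>x. x \<in> carrier T \<Longrightarrow> \<phi> x = e \<otimes>\<^bsub>B\<^esub> \<phi> x \<oplus>\<^bsub>B\<^esub> e' \<otimes>\<^bsub>B\<^esub> \<phi> x"
    "\<And>x y. x \<in> carrier T \<Longrightarrow> y \<in> carrier T \<Longrightarrow>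
      e \<otimes>\<^bsub>B\<^esub> \<phi> (x \<otimes>\<^bsub>T\<^esub> y) = (e \<otimes>\<^bsub>B\<^esub> \<phi> x) \<otimes>\<^bsub>B\<^esub> (e \<otimes>\<^bsub>B\<^esub> \<phi> y)"
    "\<And>x y. x \<in> carrier T \<Longrightarrow> y \<in> carrier T \<Longrightarrow>
      e' \<otimes>\<^bsub>B\<^esub> \<phi> (x \<otimes>\<^bsub>T\<^esub> y) = (e' \<otimes>\<^bsub>B\<^esub> \<phi> y) \<otimes>\<^bsub>B\<^esub> (e' \<otimes>\<^bsub>B\<^esub> \<phi> x)"
    "\<And>x y. x \<in> carrier T \<Longrightarrow> y \<in> carrier T \<Longrightarrow> (e \<otimes>\<^bsub>B\<^esub> \<phi> x) \<otimes>\<^bsub>B\<^esub> (e' \<otimes>\<^bsub>B\<^esub> \<phi> y) = \<zero>\<^bsub>B\<^esub>"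
    "\<And>x y. x \<in> carrier T \<Longrightarrow> y \<in> carrier T \<Longrightarrow> (e' \<otimes>\<^bsub>B\<^esub> \<phi> x) \<otimes>\<^bsub>B\<^esub> (e \<otimes>\<^bsub>B\<^esub> \<phi> y) = \<zero>\<^bsub>B\<^esub>"
  proof (rule standard_decomposition_carrier[of ?R ?U \<phi>, unfolded R U(2-)])
    show "Ring.ring ?U" by (rule B.ring_corner) (fact i ii)+
    show "t = \<zero>\<^bsub>B\<^esub>" if "t \<in> carrier ?U" "t \<oplus>\<^bsub>B\<^esub> t = \<zero>\<^bsub>B\<^esub>" for t
      using that U(1) B.torsion_free[OF two, of t] by auto
    show "\<phi> x \<in> carrier ?U" if "x \<in> carrier T" for x
      using that closed unit by (simp add: B.corner_def)
    show "Ring.ring ?R" by (rule T)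
    show "\<one>\<^bsub>T\<^esub> \<in> I" if "ideal I ?R"
      "\<And>a b. a \<in> carrier T \<Longrightarrow> b \<in> carrier T \<Longrightarrow> a \<otimes>\<^bsub>T\<^esub> b \<ominus>\<^bsub>?R\<^esub> b \<otimes>\<^bsub>T\<^esub> a \<in> I" for I
      by (rule K[OF that])
    show "\<phi> (x \<oplus>\<^bsub>T\<^esub> y) = \<phi> x \<oplus>\<^bsub>B\<^esub> \<phi> y" if "x \<in> carrier T" "y \<in> carrier T" for x y
      by (rule add[OF that])
    show "\<phi> (x \<otimes>\<^bsub>T\<^esub> y \<oplus>\<^bsub>T\<^esub> y \<otimes>\<^bsub>T\<^esub> x) = \<phi> x \<otimes>\<^bsub>B\<^esub> \<phi> y \<oplus>\<^bsub>B\<^esub> \<phi> y \<otimes>\<^bsub>B\<^esub> \<phi> x"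
      if "x \<in> carrier T" "y \<in> carrier T" for x y
      by (rule jordan[OF that])
    show "\<phi> \<one>\<^bsub>T\<^esub> = i" by (simp add: i_def)
  qed (rule that)
  have eB: "e \<in> carrier B" "e' \<in> carrier B" using e(1,2) U(1) by auto
  have lin: "linear_map F T B (\<lambda>x. c \<otimes>\<^bsub>B\<^esub> \<phi> x)" if c: "c \<in> carrier B" for c
    using \<phi> c closed by (auto simp: linear_map_def jordan_hom_def B.mult_rules)
  show ?thesis
    unfolding standard_map_def algebra_hom_def algebra_antihom_def
    by (rule exI[of _ "\<lambda>x. e \<otimes>\<^bsub>B\<^esub> \<phi> x"], rule exI[of _ "\<lambda>x. e' \<otimes>\<^bsub>B\<^esub> \<phi> x"])
      (use lin eB e(3-) in auto)
qed

text \<open>Orthogonality allows the missing summand of \<open>\<phi> x\<close> to be added in each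
  product. The maps \<open>f\<close> and \<open>g\<close> stay explicit because
  \<open>twist_standard\<close> needs the formula for its own decomposition.\<close>

lemma standard_mult:
  assumes B: "assoc_algebra F B" and T: "\<And>x y. x \<in> carrier T \<Longrightarrow> y \<in> carrier T \<Longrightarrow> x \<otimes>\<^bsub>T\<^esub> y \<in> carrier T"
    and fg: "algebra_hom F T B f" "algebra_antihom F T B g"
    and sum: "\<And>x. x \<in> carrier T \<Longrightarrow> \<phi> x = f x \<oplus>\<^bsub>B\<^esub> g x"
    and orth: "\<And>x y. x \<in> carrier T \<Longrightarrow> y \<in> carrier T \<Longrightarrow> f x \<otimes>\<^bsub>B\<^esub> g y = \<zero>\<^bsub>B\<^esub> \<and> g y \<otimes>\<^bsub>B\<^esub> f x = \<zero>\<^bsub>B\<^esub>"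
    and xy: "x \<in> carrier T" "y \<in> carrier T"
  shows "\<phi> (x \<otimes>\<^bsub>T\<^esub> y) = \<phi> x \<otimes>\<^bsub>B\<^esub> f y \<oplus>\<^bsub>B\<^esub> g y \<otimes>\<^bsub>B\<^esub> \<phi> x"
proof -
  interpret B: assoc_algebra F B by (rule B)
  have c: "f x \<in> carrier B" "f y \<in> carrier B" "g x \<in> carrier B" "g y \<in> carrier B"
    using fg xy by (auto simp: algebra_hom_def algebra_antihom_def linear_map_def)
  have "\<phi> (x \<otimes>\<^bsub>T\<^esub> y) = f x \<otimes>\<^bsub>B\<^esub> f y \<oplus>\<^bsub>B\<^esub> g y \<otimes>\<^bsub>B\<^esub> g x"
    using fg sum xy T by (simp add: algebra_hom_def algebra_antihom_def)
  also have "\<dots> = (f x \<oplus>\<^bsub>B\<^esub> g x) \<otimes>\<^bsub>B\<^esub> f y \<oplus>\<^bsub>B\<^esub> g y \<otimes>\<^bsub>B\<^esub> (f x \<oplus>\<^bsub>B\<^esub> g x)"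
    using orth xy c by (simp add: B.mult_rules)
  finally show ?thesis using sum xy by simp
qed

lemma standard_imp_nearly_standard:
  assumes B: "assoc_algebra F B" and T: "\<And>x y. x \<in> carrier T \<Longrightarrow> y \<in> carrier T \<Longrightarrow> x \<otimes>\<^bsub>T\<^esub> y \<in> carrier T"
    and \<phi>: "standard_map F T B \<phi>"
  shows "nearly_standard_map T B \<phi>"
proof -
  obtain f g where fg: "algebra_hom F T B f" "algebra_antihom F T B g"
    and sum: "\<And>x. x \<in> carrier T \<Longrightarrow> \<phi> x = f x \<oplus>\<^bsub>B\<^esub> g x"
    and orth: "\<And>x y. x \<in> carrier T \<Longrightarrow> y \<in> carrier T \<Longrightarrow> f x \<otimes>\<^bsub>B\<^esub> g y = \<zero>\<^bsub>B\<^esub> \<and> g y \<otimes>\<^bsub>B\<^esub> f x = \<zero>\<^bsub>B\<^esub>"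
    using \<phi> unfolding standard_map_def by blast
  have "f \<in> carrier T \<rightarrow> carrier B" and "g \<in> carrier T \<rightarrow> carrier B"
    using fg by (auto simp: algebra_hom_def algebra_antihom_def linear_map_def)
  moreover have "\<phi> (x \<otimes>\<^bsub>T\<^esub> y) = \<phi> x \<otimes>\<^bsub>B\<^esub> f y \<oplus>\<^bsub>B\<^esub> g y \<otimes>\<^bsub>B\<^esub> \<phi> x"
    if "x \<in> carrier T" "y \<in> carrier T" for x y
    using standard_mult[OF B T fg sum orth that] by simp
  ultimately show ?thesis
    unfolding nearly_standard_map_def using sum by (metis (no_types, lifting))
qed

subsection \<open>Jordan homomorphisms on tensor products\<close>

locale monoid_algebra_setup = F: field F + G: monoid G
  for F :: "('f, 'm) ring_scheme" (structure) and G :: "('g, 'n) monoid_scheme"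
begin

abbreviation "P \<equiv> monoid_algebra F G"
abbreviation "e \<equiv> basis_elt F"
abbreviation "supp u \<equiv> {x. u x \<noteq> \<zero>}"

lemma mem_P: "u \<in> carrier P \<longleftrightarrow>
    (\<forall>x \<in> carrier G. u x \<in> carrier F) \<and> (\<forall>x. x \<notin> carrier G \<longrightarrow> u x = \<zero>) \<and> finite (supp u)"
  by (simp add: monoid_algebra_def)

lemma P_D:
  assumes "u \<in> carrier P"
  shows "u x \<in> carrier F" "finite (supp u)" "supp u \<subseteq> carrier G"
  using assms by (cases "x \<in> carrier G"; auto simp: mem_P)+

lemma P_simps:
  "(u \<oplus>\<^bsub>P\<^esub> v) x = u x \<oplus> v x" "(k \<odot>\<^bsub>P\<^esub> u) x = k \<otimes> u x" "\<zero>\<^bsub>P\<^esub> x = \<zero>"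
  by (simp_all add: monoid_algebra_def)

lemma zero_P: "\<zero>\<^bsub>P\<^esub> \<in> carrier P"
  by (simp add: monoid_algebra_def)

lemma add_P:
  assumes "u \<in> carrier P" "v \<in> carrier P"
  shows "u \<oplus>\<^bsub>P\<^esub> v \<in> carrier P"
proof -
  have "supp (u \<oplus>\<^bsub>P\<^esub> v) \<subseteq> supp u \<union> supp v" by (auto simp: P_simps)
  then show ?thesis
    using assms P_D(2)[OF assms(1)] P_D(2)[OF assms(2)] finite_subset by (auto simp: mem_P P_simps)
qed

lemma smult_P:
  assumes "k \<in> carrier F" "u \<in> carrier P"
  shows "k \<odot>\<^bsub>P\<^esub> u \<in> carrier P"
proof -
  have "supp (k \<odot>\<^bsub>P\<^esub> u) \<subseteq> supp u" using assms by (auto simp: P_simps)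
  then show ?thesis
    using assms P_D(2)[OF assms(2)] finite_subset by (auto simp: mem_P P_simps)
qed

lemma abelian_group_P: "abelian_group P"
proof (rule abelian_groupI)
  show "\<exists>v\<in>carrier P. v \<oplus>\<^bsub>P\<^esub> u = \<zero>\<^bsub>P\<^esub>" if u: "u \<in> carrier P" for u
  proof
    show "(\<ominus> \<one>) \<odot>\<^bsub>P\<^esub> u \<in> carrier P" using u by (intro smult_P) auto
    show "(\<ominus> \<one>) \<odot>\<^bsub>P\<^esub> u \<oplus>\<^bsub>P\<^esub> u = \<zero>\<^bsub>P\<^esub>"
      using P_D(1)[OF u] by (auto simp: fun_eq_iff P_simps F.l_minus F.l_neg)
  qed
qed (auto simp: fun_eq_iff P_simps add_P zero_P P_D(1) F.a_ac)

lemma module_P: "module F P"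
proof (rule moduleI)
  show "cring F" by (rule F.is_cring)
  show "abelian_group P" by (rule abelian_group_P)
qed (auto simp: fun_eq_iff P_simps smult_P P_D(1) F.l_distr F.r_distr F.m_assoc)

sublocale P: module F P by (rule module_P)

lemma e_P: "g \<in> carrier G \<Longrightarrow> e g \<in> carrier P"
  by (auto simp: mem_P basis_elt_def)

lemma basis_induct [consumes 1, case_names zero basis add smult]:
  assumes "u \<in> carrier P" and "Q \<zero>\<^bsub>P\<^esub>" "\<And>g. g \<in> carrier G \<Longrightarrow> Q (e g)"
    and add: "\<And>u v. u \<in> carrier P \<Longrightarrow> v \<in> carrier P \<Longrightarrow> Q u \<Longrightarrow> Q v \<Longrightarrow> Q (u \<oplus>\<^bsub>P\<^esub> v)"
    and smult: "\<And>k u. k \<in> carrier F \<Longrightarrow> u \<in> carrier P \<Longrightarrow> Q u \<Longrightarrow> Q (k \<odot>\<^bsub>P\<^esub> u)"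
  shows "Q u"
proof -
  have "Q u" if "finite S" "u \<in> carrier P" "supp u \<subseteq> S" for S u
    using that
  proof (induction S arbitrary: u rule: finite_induct)
    case empty
    then have "u = \<zero>\<^bsub>P\<^esub>" by (auto simp: fun_eq_iff P_simps)
    then show ?case using assms(2) by simp
  next
    case (insert g S)
    let ?v = "u(g := \<zero>)"
    have v: "?v \<in> carrier P" using insert.prems(1) by (auto simp: mem_P elim: rev_finite_subset)
    have Qv: "Q ?v" using insert.prems by (intro insert.IH v) auto
    show ?case
    proof (cases "g \<in> carrier G")
      case True
      have "u = u g \<odot>\<^bsub>P\<^esub> e g \<oplus>\<^bsub>P\<^esub> ?v"
        using P_D(1)[OF insert.prems(1)] by (auto simp: fun_eq_iff P_simps basis_elt_def)
      moreover have "Q (u g \<odot>\<^bsub>P\<^esub> e g)"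
        using True P_D(1)[OF insert.prems(1)] by (intro smult e_P assms(3)) auto
      ultimately show ?thesis
        using add[OF smult_P[OF P_D(1)[OF insert.prems(1)] e_P[OF True]] v] Qv by metis
    next
      case False
      then have "?v = u" using insert.prems(1) by (auto simp: fun_eq_iff mem_P)
      then show ?thesis using Qv by simp
    qed
  qed
  then show ?thesis using assms(1) P_D(2) by blast
qed

text \<open>The index set of the convolution depends on both supports. Padding with zeros to any
  finite \<open>D\<close> lets several products be summed over one index set.\<close>

lemma mult_apply:
  assumes u: "u \<in> carrier P" and v: "v \<in> carrier P" and D: "finite D" "supp u \<times> supp v \<subseteq> D"
  shows "(u \<otimes>\<^bsub>P\<^esub> v) x = (\<Oplus>r\<in>D. if fst r \<otimes>\<^bsub>G\<^esub> snd r = x then u (fst r) \<otimes> v (snd r) else \<zero>)"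
proof -
  have "(u \<otimes>\<^bsub>P\<^esub> v) x = (\<Oplus>r\<in>{(p, q). u p \<noteq> \<zero> \<and> v q \<noteq> \<zero> \<and> p \<otimes>\<^bsub>G\<^esub> q = x}. u (fst r) \<otimes> v (snd r))"
    by (simp add: monoid_algebra_def)
  also have "\<dots> = (\<Oplus>r\<in>D. if fst r \<otimes>\<^bsub>G\<^esub> snd r = x then u (fst r) \<otimes> v (snd r) else \<zero>)"
  proof (rule F.add.finprod_mono_neutral_cong_left)
    show "{(p, q). u p \<noteq> \<zero> \<and> v q \<noteq> \<zero> \<and> p \<otimes>\<^bsub>G\<^esub> q = x} \<subseteq> D" using D(2) by auto
    show "(if fst r \<otimes>\<^bsub>G\<^esub> snd r = x then u (fst r) \<otimes> v (snd r) else \<zero>) = \<zero>"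
      if "r \<in> D - {(p, q). u p \<noteq> \<zero> \<and> v q \<noteq> \<zero> \<and> p \<otimes>\<^bsub>G\<^esub> q = x}" for r
      using that P_D(1)[OF u] P_D(1)[OF v] by (cases r) (auto simp: F.integral_iff)
  qed (use D P_D(1)[OF u] P_D(1)[OF v] in auto)
  finally show ?thesis .
qed

lemma mult_P:
  assumes u: "u \<in> carrier P" and v: "v \<in> carrier P"
  shows "u \<otimes>\<^bsub>P\<^esub> v \<in> carrier P"
proof -
  let ?D = "supp u \<times> supp v"
  have D: "finite ?D" using P_D(2) u v by auto
  note m = mult_apply[OF u v D subset_refl]
  have sub: "x \<in> (\<lambda>r. fst r \<otimes>\<^bsub>G\<^esub> snd r) ` ?D" if x: "(u \<otimes>\<^bsub>P\<^esub> v) x \<noteq> \<zero>" for x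
  proof (rule ccontr)
    assume "x \<notin> (\<lambda>r. fst r \<otimes>\<^bsub>G\<^esub> snd r) ` ?D"
    then have "(u \<otimes>\<^bsub>P\<^esub> v) x = \<zero>" unfolding m by (intro F.add.finprod_one_eqI) force
    then show False using x by simp
  qed
  have "(\<lambda>r. fst r \<otimes>\<^bsub>G\<^esub> snd r) ` ?D \<subseteq> carrier G" using P_D(3) u v by fastforce
  moreover have "supp (u \<otimes>\<^bsub>P\<^esub> v) \<subseteq> (\<lambda>r. fst r \<otimes>\<^bsub>G\<^esub> snd r) ` ?D" using sub by blast
  moreover have "(u \<otimes>\<^bsub>P\<^esub> v) x \<in> carrier F" for x
    unfolding m using P_D(1) u v by (intro F.finsum_closed) auto
  ultimately show ?thesis
    unfolding mem_P using D finite_subset by blast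
qed

lemma mult_add_left:
  assumes u: "u \<in> carrier P" and u': "u' \<in> carrier P" and v: "v \<in> carrier P"
  shows "(u \<oplus>\<^bsub>P\<^esub> u') \<otimes>\<^bsub>P\<^esub> v = u \<otimes>\<^bsub>P\<^esub> v \<oplus>\<^bsub>P\<^esub> u' \<otimes>\<^bsub>P\<^esub> v"
proof
  fix x
  let ?D = "(supp u \<union> supp u') \<times> supp v"
  have D: "finite ?D" using P_D(2) u u' v by auto
  have s: "supp (u \<oplus>\<^bsub>P\<^esub> u') \<times> supp v \<subseteq> ?D" "supp u \<times> supp v \<subseteq> ?D" "supp u' \<times> supp v \<subseteq> ?D"
    by (auto simp: P_simps)
  note c = P_D(1)[OF u] P_D(1)[OF u'] P_D(1)[OF v]
  have "((u \<oplus>\<^bsub>P\<^esub> u') \<otimes>\<^bsub>P\<^esub> v) x = (\<Oplus>r\<in>?D. (if fst r \<otimes>\<^bsub>G\<^esub> snd r = x then u (fst r) \<otimes> v (snd r) else \<zero>)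
      \<oplus> (if fst r \<otimes>\<^bsub>G\<^esub> snd r = x then u' (fst r) \<otimes> v (snd r) else \<zero>))"
    unfolding mult_apply[OF add_P[OF u u'] v D s(1)]
    using c by (intro F.finsum_cong') (auto simp: P_simps F.l_distr)
  also have "\<dots> = (u \<otimes>\<^bsub>P\<^esub> v \<oplus>\<^bsub>P\<^esub> u' \<otimes>\<^bsub>P\<^esub> v) x"
    unfolding P_simps mult_apply[OF u v D s(2)] mult_apply[OF u' v D s(3)]
    using c by (intro F.finsum_addf) auto
  finally show "((u \<oplus>\<^bsub>P\<^esub> u') \<otimes>\<^bsub>P\<^esub> v) x = (u \<otimes>\<^bsub>P\<^esub> v \<oplus>\<^bsub>P\<^esub> u' \<otimes>\<^bsub>P\<^esub> v) x" .
qed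

lemma mult_add_right:
  assumes u: "u \<in> carrier P" and u': "u' \<in> carrier P" and v: "v \<in> carrier P"
  shows "v \<otimes>\<^bsub>P\<^esub> (u \<oplus>\<^bsub>P\<^esub> u') = v \<otimes>\<^bsub>P\<^esub> u \<oplus>\<^bsub>P\<^esub> v \<otimes>\<^bsub>P\<^esub> u'"
proof
  fix x
  let ?D = "supp v \<times> (supp u \<union> supp u')"
  have D: "finite ?D" using P_D(2) u u' v by auto
  have s: "supp v \<times> supp (u \<oplus>\<^bsub>P\<^esub> u') \<subseteq> ?D" "supp v \<times> supp u \<subseteq> ?D" "supp v \<times> supp u' \<subseteq> ?D"
    by (auto simp: P_simps)
  note c = P_D(1)[OF u] P_D(1)[OF u'] P_D(1)[OF v]
  have "(v \<otimes>\<^bsub>P\<^esub> (u \<oplus>\<^bsub>P\<^esub> u')) x = (\<Oplus>r\<in>?D. (if fst r \<otimes>\<^bsub>G\<^esub> snd r = x then v (fst r) \<otimes> u (snd r) else \<zero>)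
      \<oplus> (if fst r \<otimes>\<^bsub>G\<^esub> snd r = x then v (fst r) \<otimes> u' (snd r) else \<zero>))"
    unfolding mult_apply[OF v add_P[OF u u'] D s(1)]
    using c by (intro F.finsum_cong') (auto simp: P_simps F.r_distr)
  also have "\<dots> = (v \<otimes>\<^bsub>P\<^esub> u \<oplus>\<^bsub>P\<^esub> v \<otimes>\<^bsub>P\<^esub> u') x"
    unfolding P_simps mult_apply[OF v u D s(2)] mult_apply[OF v u' D s(3)]
    using c by (intro F.finsum_addf) auto
  finally show "(v \<otimes>\<^bsub>P\<^esub> (u \<oplus>\<^bsub>P\<^esub> u')) x = (v \<otimes>\<^bsub>P\<^esub> u \<oplus>\<^bsub>P\<^esub> v \<otimes>\<^bsub>P\<^esub> u') x" .
qed

lemma mult_smult: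
  assumes k: "k \<in> carrier F" and u: "u \<in> carrier P" and v: "v \<in> carrier P"
  shows "(k \<odot>\<^bsub>P\<^esub> u) \<otimes>\<^bsub>P\<^esub> v = k \<odot>\<^bsub>P\<^esub> (u \<otimes>\<^bsub>P\<^esub> v)" "u \<otimes>\<^bsub>P\<^esub> (k \<odot>\<^bsub>P\<^esub> v) = k \<odot>\<^bsub>P\<^esub> (u \<otimes>\<^bsub>P\<^esub> v)"
proof -
  let ?D = "supp u \<times> supp v"
  have D: "finite ?D" using P_D(2) u v by auto
  note c = P_D(1)[OF u] P_D(1)[OF v]
  have s: "supp (k \<odot>\<^bsub>P\<^esub> u) \<times> supp v \<subseteq> ?D" "supp u \<times> supp (k \<odot>\<^bsub>P\<^esub> v) \<subseteq> ?D"
    using k c by (auto simp: P_simps)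
  have r: "(k \<odot>\<^bsub>P\<^esub> (u \<otimes>\<^bsub>P\<^esub> v)) x =
      (\<Oplus>r\<in>?D. k \<otimes> (if fst r \<otimes>\<^bsub>G\<^esub> snd r = x then u (fst r) \<otimes> v (snd r) else \<zero>))" for x
    unfolding P_simps mult_apply[OF u v D subset_refl] using k c D
    by (intro F.finsum_rdistr) auto
  have "((k \<odot>\<^bsub>P\<^esub> u) \<otimes>\<^bsub>P\<^esub> v) x = (k \<odot>\<^bsub>P\<^esub> (u \<otimes>\<^bsub>P\<^esub> v)) x" for x
    unfolding r mult_apply[OF smult_P[OF k u] v D s(1)]
    using k c by (intro F.finsum_cong') (auto simp: P_simps F.m_assoc)
  then show "(k \<odot>\<^bsub>P\<^esub> u) \<otimes>\<^bsub>P\<^esub> v = k \<odot>\<^bsub>P\<^esub> (u \<otimes>\<^bsub>P\<^esub> v)" by blast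
  have "(u \<otimes>\<^bsub>P\<^esub> (k \<odot>\<^bsub>P\<^esub> v)) x = (k \<odot>\<^bsub>P\<^esub> (u \<otimes>\<^bsub>P\<^esub> v)) x" for x
    unfolding r mult_apply[OF u smult_P[OF k v] D s(2)]
    using k c by (intro F.finsum_cong') (auto simp: P_simps F.m_lcomm)
  then show "u \<otimes>\<^bsub>P\<^esub> (k \<odot>\<^bsub>P\<^esub> v) = k \<odot>\<^bsub>P\<^esub> (u \<otimes>\<^bsub>P\<^esub> v)" by blast
qed

lemma mult_e:
  assumes "g \<in> carrier G" "h \<in> carrier G"
  shows "e g \<otimes>\<^bsub>P\<^esub> e h = e (g \<otimes>\<^bsub>G\<^esub> h)"
proof
  fix x
  have s: "supp (e g) \<times> supp (e h) \<subseteq> {(g, h)}" by (auto simp: basis_elt_def)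
  show "(e g \<otimes>\<^bsub>P\<^esub> e h) x = e (g \<otimes>\<^bsub>G\<^esub> h) x"
    unfolding mult_apply[OF e_P[OF assms(1)] e_P[OF assms(2)] finite.insertI[OF finite.emptyI] s]
    by (simp add: F.finsum_insert Pi_def basis_elt_def) 
qed

lemma mult_zero_P:
  assumes "u \<in> carrier P"
  shows "u \<otimes>\<^bsub>P\<^esub> \<zero>\<^bsub>P\<^esub> = \<zero>\<^bsub>P\<^esub>" "\<zero>\<^bsub>P\<^esub> \<otimes>\<^bsub>P\<^esub> u = \<zero>\<^bsub>P\<^esub>"
  using mult_add_right[OF zero_P zero_P assms] mult_add_left[OF zero_P zero_P assms] mult_P[OF assms zero_P]
    mult_P[OF zero_P assms] by (simp_all add: P.M.add.r_cancel_one)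

lemmas P_rules = add_P smult_P mult_P e_P zero_P mult_add_left mult_add_right mult_smult mult_e mult_zero_P
  P.smult_r_distr

lemma mult_assoc_P:
  assumes u: "u \<in> carrier P" and v: "v \<in> carrier P" and w: "w \<in> carrier P"
  shows "u \<otimes>\<^bsub>P\<^esub> v \<otimes>\<^bsub>P\<^esub> w = u \<otimes>\<^bsub>P\<^esub> (v \<otimes>\<^bsub>P\<^esub> w)"
  using u
proof (induction u rule: basis_induct)
  case (basis g)
  show ?case using v
  proof (induction v rule: basis_induct)
    case (basis h)
    show ?case using w
    proof (induction w rule: basis_induct)
      case (basis k)
      then show ?case using \<open>g \<in> carrier G\<close> \<open>h \<in> carrier G\<close> by (simp add: P_rules G.m_assoc)
    qed (use \<open>g \<in> carrier G\<close> \<open>h \<in> carrier G\<close> in \<open>simp_all add: P_rules\<close>)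
  qed (use \<open>g \<in> carrier G\<close> w in \<open>simp_all add: P_rules\<close>)
qed (use v w in \<open>simp_all add: P_rules\<close>)

lemma one_P: "\<one>\<^bsub>P\<^esub> = e \<one>\<^bsub>G\<^esub>"
  by (simp add: monoid_algebra_def basis_elt_def)

lemma mult_one_P:
  assumes "u \<in> carrier P"
  shows "\<one>\<^bsub>P\<^esub> \<otimes>\<^bsub>P\<^esub> u = u \<and> u \<otimes>\<^bsub>P\<^esub> \<one>\<^bsub>P\<^esub> = u"
  using assms by (induction u rule: basis_induct) (simp_all add: one_P P_rules)

lemma ring_P: "Ring.ring P"
proof (rule ringI)
  show "abelian_group P" by (rule abelian_group_P)
  show "monoid P"
    by (rule monoidI) (simp_all add: P_rules mult_assoc_P mult_one_P, simp add: one_P P_rules)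
qed (simp_all add: P_rules)

sublocale P: Ring.ring P by (rule ring_P)

lemma submodule_zero: "submodule H F P \<Longrightarrow> \<zero>\<^bsub>P\<^esub> \<in> H"
  using subgroup.one_closed[OF submodule.axioms(1)] by fastforce

lemma span_submodule:
  assumes "S \<subseteq> carrier P"
  shows "submodule (module_span F P S) F P" "S \<subseteq> module_span F P S" "module_span F P S \<subseteq> carrier P"
proof -
  have c: "submodule (carrier P) F P" by (rule P.carrier_is_submodule)
  show S: "S \<subseteq> module_span F P S" by (auto simp: module_span_def)
  show sub: "module_span F P S \<subseteq> carrier P" using c assms by (auto simp: module_span_def)
  show "submodule (module_span F P S) F P"
  proof (rule P.submoduleI)
    show "\<zero>\<^bsub>P\<^esub> \<in> module_span F P S"
      using submodule_zero by (auto simp: module_span_def)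
    show "module_span F P S \<subseteq> carrier P" by (rule sub)
    show "\<ominus>\<^bsub>P\<^esub> u \<in> module_span F P S" if "u \<in> module_span F P S" for u
      using that P.submoduleE(3) by (auto simp: module_span_def)
    show "u \<oplus>\<^bsub>P\<^esub> v \<in> module_span F P S" if "u \<in> module_span F P S" "v \<in> module_span F P S" for u v
      using that P.submoduleE(5) by (auto simp: module_span_def)
    show "k \<odot>\<^bsub>P\<^esub> u \<in> module_span F P S" if "k \<in> carrier F" "u \<in> module_span F P S" for k u
      using that P.submoduleE(4) by (auto simp: module_span_def)
  qed
qed

lemma span_induct [consumes 2, case_names zero base add smult]:
  assumes S: "S \<subseteq> carrier P" and u: "u \<in> module_span F P S" and "Q \<zero>\<^bsub>P\<^esub>" "\<And>u. u \<in> S \<Longrightarrow> Q u"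
    and "\<And>u v. u \<in> carrier P \<Longrightarrow> v \<in> carrier P \<Longrightarrow> Q u \<Longrightarrow> Q v \<Longrightarrow> Q (u \<oplus>\<^bsub>P\<^esub> v)"
    and smult: "\<And>k u. k \<in> carrier F \<Longrightarrow> u \<in> carrier P \<Longrightarrow> Q u \<Longrightarrow> Q (k \<odot>\<^bsub>P\<^esub> u)"
  shows "Q u"
proof -
  have "submodule {u \<in> carrier P. Q u} F P"
  proof (rule P.submoduleI)
    fix u assume "u \<in> {u \<in> carrier P. Q u}"
    moreover have "\<ominus>\<^bsub>P\<^esub> u = (\<ominus> \<one>) \<odot>\<^bsub>P\<^esub> u" if "u \<in> carrier P" using that by (simp add: P.smult_l_minus)
    ultimately show "\<ominus>\<^bsub>P\<^esub> u \<in> {u \<in> carrier P. Q u}" using smult[of "\<ominus> \<one>" u] by auto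
  qed (use assms in auto)
  then show ?thesis using u S assms(4) by (auto simp: module_span_def)
qed

lemma ideal_span:
  assumes S: "S \<subseteq> carrier P"
    and mult: "\<And>u g. u \<in> S \<Longrightarrow> g \<in> carrier G \<Longrightarrow>
      u \<otimes>\<^bsub>P\<^esub> e g \<in> module_span F P S \<and> e g \<otimes>\<^bsub>P\<^esub> u \<in> module_span F P S"
  shows "ideal (module_span F P S) P"
proof (rule idealI)
  let ?N = "module_span F P S"
  note N = span_submodule[OF S]
  show "Ring.ring P" by (rule ring_P)
  show "subgroup ?N (add_monoid P)" using N(1) by (simp add: submodule_def)
  have N': "\<zero>\<^bsub>P\<^esub> \<in> ?N" "u \<in> ?N \<Longrightarrow> v \<in> ?N \<Longrightarrow> u \<oplus>\<^bsub>P\<^esub> v \<in> ?N" "k \<in> carrier F \<Longrightarrow> u \<in> ?N \<Longrightarrow> k \<odot>\<^bsub>P\<^esub> u \<in> ?N" for u v k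
    using P.submoduleE[OF N(1)] submodule_zero[OF N(1)] by auto
  have "u \<otimes>\<^bsub>P\<^esub> v \<in> ?N \<and> v \<otimes>\<^bsub>P\<^esub> u \<in> ?N" if u: "u \<in> ?N" and v: "v \<in> carrier P" for u v
    using S u
  proof (induction u rule: span_induct)
    case (base u)
    then have "u \<in> carrier P" using S by auto
    with v show ?case
      by (induction v rule: basis_induct) (use base mult N' in \<open>auto simp: P_rules\<close>)
  qed (use v N' in \<open>simp_all add: P_rules\<close>)
  then show "v \<otimes>\<^bsub>P\<^esub> u \<in> ?N" "u \<otimes>\<^bsub>P\<^esub> v \<in> ?N" if "u \<in> ?N" "v \<in> carrier P" for u v using that by blast+
qed

definition lin_ext :: "('f, 'b, 'k) module_scheme \<Rightarrow> ('g \<Rightarrow> 'b) \<Rightarrow> ('g \<Rightarrow> 'f) \<Rightarrow> 'b"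
  where "lin_ext B f u = (\<Oplus>\<^bsub>B\<^esub>g\<in>supp u. u g \<odot>\<^bsub>B\<^esub> f g)"

context
  fixes B :: "('f, 'b, 'k) module_scheme" and f :: "'g \<Rightarrow> 'b"
  assumes B: "module F B" and f: "f \<in> carrier G \<rightarrow> carrier B"
begin

interpretation B: module F B by (rule B)

lemma lin_ext_superset:
  assumes u: "u \<in> carrier P" and S: "finite S" "supp u \<subseteq> S" "S \<subseteq> carrier G"
  shows "lin_ext B f u = (\<Oplus>\<^bsub>B\<^esub>g\<in>S. u g \<odot>\<^bsub>B\<^esub> f g)"
  unfolding lin_ext_def
proof (rule B.M.add.finprod_mono_neutral_cong_left)
  show "u g \<odot>\<^bsub>B\<^esub> f g = \<zero>\<^bsub>B\<^esub>" if "g \<in> S - supp u" for g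
  proof -
    have "f g \<in> carrier B" using that S(3) f by blast
    then show ?thesis using that by simp
  qed
  show "(\<lambda>g. u g \<odot>\<^bsub>B\<^esub> f g) \<in> S \<rightarrow> carrier B"
    using S(3) f P_D(1)[OF u] by (intro funcsetI B.smult_closed) blast+
qed (use S in auto)

lemma lin_ext_closed: "u \<in> carrier P \<Longrightarrow> lin_ext B f u \<in> carrier B"
  unfolding lin_ext_def using f P_D[of u] by (intro B.M.finsum_closed) auto

lemma lin_ext_add:
  assumes u: "u \<in> carrier P" and v: "v \<in> carrier P"
  shows "lin_ext B f (u \<oplus>\<^bsub>P\<^esub> v) = lin_ext B f u \<oplus>\<^bsub>B\<^esub> lin_ext B f v"
proof -
  let ?S = "supp u \<union> supp v"
  have S: "finite ?S" "?S \<subseteq> carrier G" using P_D(2,3) u v by auto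
  have fS: "f g \<in> carrier B" if "g \<in> ?S" for g using f S that by auto
  have "lin_ext B f (u \<oplus>\<^bsub>P\<^esub> v) = (\<Oplus>\<^bsub>B\<^esub>g\<in>?S. (u \<oplus>\<^bsub>P\<^esub> v) g \<odot>\<^bsub>B\<^esub> f g)"
    using S by (intro lin_ext_superset add_P u v) (auto simp: P_simps)
  also have "\<dots> = (\<Oplus>\<^bsub>B\<^esub>g\<in>?S. u g \<odot>\<^bsub>B\<^esub> f g \<oplus>\<^bsub>B\<^esub> v g \<odot>\<^bsub>B\<^esub> f g)"
    using fS P_D(1)[OF u] P_D(1)[OF v] by (intro B.M.finsum_cong') (auto simp: P_simps B.smult_l_distr)
  also have "\<dots> = lin_ext B f u \<oplus>\<^bsub>B\<^esub> lin_ext B f v"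
    using fS P_D(1)[OF u] P_D(1)[OF v] S lin_ext_superset[OF u S(1)] lin_ext_superset[OF v S(1)]
    by (subst B.M.finsum_addf) auto
  finally show ?thesis .
qed

lemma lin_ext_smult:
  assumes k: "k \<in> carrier F" and u: "u \<in> carrier P"
  shows "lin_ext B f (k \<odot>\<^bsub>P\<^esub> u) = k \<odot>\<^bsub>B\<^esub> lin_ext B f u"
proof -
  have S: "finite (supp u)" "supp u \<subseteq> carrier G" using P_D(2,3) u by auto
  have fS: "f g \<in> carrier B" if "g \<in> supp u" for g using f S that by auto
  have "lin_ext B f (k \<odot>\<^bsub>P\<^esub> u) = (\<Oplus>\<^bsub>B\<^esub>g\<in>supp u. (k \<odot>\<^bsub>P\<^esub> u) g \<odot>\<^bsub>B\<^esub> f g)"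
    using S k by (intro lin_ext_superset smult_P u) (auto simp: P_simps)
  also have "\<dots> = (\<Oplus>\<^bsub>B\<^esub>g\<in>supp u. k \<odot>\<^bsub>B\<^esub> (u g \<odot>\<^bsub>B\<^esub> f g))"
    using fS P_D(1)[OF u] k by (intro B.M.finsum_cong') (auto simp: P_simps B.smult_assoc1)
  also have "\<dots> = k \<odot>\<^bsub>B\<^esub> lin_ext B f u"
    unfolding lin_ext_def using fS P_D(1)[OF u] k S
    by (intro B.finsum_smult_ldistr[symmetric]) auto
  finally show ?thesis .
qed

lemma lin_ext_e: "g \<in> carrier G \<Longrightarrow> lin_ext B f (e g) = f g"
proof -
  assume g: "g \<in> carrier G"
  then have fg: "f g \<in> carrier B" using f by blast
  have "supp (e g) \<subseteq> {g}" by (auto simp: basis_elt_def)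
  then have "lin_ext B f (e g) = (\<Oplus>\<^bsub>B\<^esub>h\<in>{g}. e g h \<odot>\<^bsub>B\<^esub> f h)"
    using g by (intro lin_ext_superset e_P) auto
  also have "\<dots> = f g" using fg by (simp add: basis_elt_def B.M.finsum_insert Pi_def)
  finally show ?thesis .
qed

lemma lin_ext_zero: "lin_ext B f \<zero>\<^bsub>P\<^esub> = \<zero>\<^bsub>B\<^esub>"
  by (simp add: lin_ext_def P_simps)

end

end

section \<open>The tensor product as a quotient, and maps out of it\<close>

locale tensor_setup = A: unital_assoc_algebra F A + C: algebra F C
  for F :: "('f, 'm) ring_scheme" (structure) and A :: "('f, 'a, 'n) module_scheme"
    and C :: "('f, 'c, 'k) module_scheme"
begin

sublocale monoid_algebra_setup F "A \<times>\<times> C"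
proof (intro monoid_algebra_setup.intro)
  show "field F" by (rule A.field_axioms)
  show "monoid (A \<times>\<times> C)"
    by (rule DirProd_monoid) (rule A.monoid_axioms, rule C.monoid_axioms)
qed

abbreviation "rels \<equiv> bilinear_relations F A C"
abbreviation "N \<equiv> module_span F P rels"

lemma rels_cases [consumes 1, case_names addA addC smultA smultC]:
  assumes "u \<in> rels"
  obtains a a' c where "a \<in> carrier A" "a' \<in> carrier A" "c \<in> carrier C"
      "u = e (a \<oplus>\<^bsub>A\<^esub> a', c) \<ominus>\<^bsub>P\<^esub> (e (a, c) \<oplus>\<^bsub>P\<^esub> e (a', c))"
  | a c c' where "a \<in> carrier A" "c \<in> carrier C" "c' \<in> carrier C"
      "u = e (a, c \<oplus>\<^bsub>C\<^esub> c') \<ominus>\<^bsub>P\<^esub> (e (a, c) \<oplus>\<^bsub>P\<^esub> e (a, c'))"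
  | k a c where "k \<in> carrier F" "a \<in> carrier A" "c \<in> carrier C"
      "u = e (k \<odot>\<^bsub>A\<^esub> a, c) \<ominus>\<^bsub>P\<^esub> k \<odot>\<^bsub>P\<^esub> e (a, c)"
  | k a c where "k \<in> carrier F" "a \<in> carrier A" "c \<in> carrier C"
      "u = e (a, k \<odot>\<^bsub>C\<^esub> c) \<ominus>\<^bsub>P\<^esub> k \<odot>\<^bsub>P\<^esub> e (a, c)"
  using assms unfolding bilinear_relations_def Let_def
  by (elim UnE CollectE exE conjE) (erule (3) that)+

lemma relsI:
  assumes "a \<in> carrier A" "c \<in> carrier C"
  shows "a' \<in> carrier A \<Longrightarrow> e (a \<oplus>\<^bsub>A\<^esub> a', c) \<ominus>\<^bsub>P\<^esub> (e (a, c) \<oplus>\<^bsub>P\<^esub> e (a', c)) \<in> rels"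
    "c' \<in> carrier C \<Longrightarrow> e (a, c \<oplus>\<^bsub>C\<^esub> c') \<ominus>\<^bsub>P\<^esub> (e (a, c) \<oplus>\<^bsub>P\<^esub> e (a, c')) \<in> rels"
    "k \<in> carrier F \<Longrightarrow> e (k \<odot>\<^bsub>A\<^esub> a, c) \<ominus>\<^bsub>P\<^esub> k \<odot>\<^bsub>P\<^esub> e (a, c) \<in> rels"
    "k \<in> carrier F \<Longrightarrow> e (a, k \<odot>\<^bsub>C\<^esub> c) \<ominus>\<^bsub>P\<^esub> k \<odot>\<^bsub>P\<^esub> e (a, c) \<in> rels"
proof -
  show "e (a \<oplus>\<^bsub>A\<^esub> a', c) \<ominus>\<^bsub>P\<^esub> (e (a, c) \<oplus>\<^bsub>P\<^esub> e (a', c)) \<in> rels" if "a' \<in> carrier A"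
    unfolding bilinear_relations_def Let_def
    by (rule UnI1, rule UnI1, rule UnI1, rule CollectI, intro exI conjI, rule refl) (use assms that in simp_all)
  show "e (a, c \<oplus>\<^bsub>C\<^esub> c') \<ominus>\<^bsub>P\<^esub> (e (a, c) \<oplus>\<^bsub>P\<^esub> e (a, c')) \<in> rels" if "c' \<in> carrier C"
    unfolding bilinear_relations_def Let_def
    by (rule UnI1, rule UnI1, rule UnI2, rule CollectI, intro exI conjI, rule refl) (use assms that in simp_all)
  show "e (k \<odot>\<^bsub>A\<^esub> a, c) \<ominus>\<^bsub>P\<^esub> k \<odot>\<^bsub>P\<^esub> e (a, c) \<in> rels" if "k \<in> carrier F"
    unfolding bilinear_relations_def Let_def
    by (rule UnI1, rule UnI2, rule CollectI, intro exI conjI, rule refl) (use assms that in simp_all)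
  show "e (a, k \<odot>\<^bsub>C\<^esub> c) \<ominus>\<^bsub>P\<^esub> k \<odot>\<^bsub>P\<^esub> e (a, c) \<in> rels" if "k \<in> carrier F"
    unfolding bilinear_relations_def Let_def
    by (rule UnI2, rule CollectI, intro exI conjI, rule refl) (use assms that in simp_all)
qed

lemma eP: "a \<in> carrier A \<Longrightarrow> c \<in> carrier C \<Longrightarrow> e (a, c) \<in> carrier P"
  by (simp add: e_P)

lemma rels_subset: "rels \<subseteq> carrier P"
proof
  fix u assume "u \<in> rels"
  then show "u \<in> carrier P" by (cases rule: rels_cases) (auto simp: eP add_P smult_P)
qed

lemma mult_e_pair:
  assumes "a \<in> carrier A" "c \<in> carrier C" "b \<in> carrier A" "d \<in> carrier C"
  shows "e (a, c) \<otimes>\<^bsub>P\<^esub> e (b, d) = e (a \<otimes>\<^bsub>A\<^esub> b, c \<otimes>\<^bsub>C\<^esub> d)"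
  using assms by (simp add: mult_e)

lemma mult_minus_P:
  assumes "u \<in> carrier P" "v \<in> carrier P" "w \<in> carrier P"
  shows "(u \<ominus>\<^bsub>P\<^esub> v) \<otimes>\<^bsub>P\<^esub> w = u \<otimes>\<^bsub>P\<^esub> w \<ominus>\<^bsub>P\<^esub> v \<otimes>\<^bsub>P\<^esub> w" "w \<otimes>\<^bsub>P\<^esub> (u \<ominus>\<^bsub>P\<^esub> v) = w \<otimes>\<^bsub>P\<^esub> u \<ominus>\<^bsub>P\<^esub> w \<otimes>\<^bsub>P\<^esub> v"
  using assms by (simp_all add: a_minus_def P.l_distr P.r_distr P.l_minus P.r_minus)

lemma ideal_N: "ideal N P"
proof (rule ideal_span[OF rels_subset])
  fix u g assume u: "u \<in> rels" and "g \<in> carrier (A \<times>\<times> C)"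
  then obtain b d where g: "g = (b, d)" "b \<in> carrier A" "d \<in> carrier C" by auto
  note r = mult_e_pair mult_minus_P P_rules(6-9) eP smult_P add_P A.mult_rules C.l_distr C.r_distr C.smult_assoc2
  have c: "d \<otimes>\<^bsub>C\<^esub> (k \<odot>\<^bsub>C\<^esub> c) = k \<odot>\<^bsub>C\<^esub> (d \<otimes>\<^bsub>C\<^esub> c)" if "k \<in> carrier F" "c \<in> carrier C" for k c
    using that g C.smult_assoc2[of k c d] C.m_comm[of d "k \<odot>\<^bsub>C\<^esub> c"] C.m_comm[of c d] by simp
  have "u \<otimes>\<^bsub>P\<^esub> e (b, d) \<in> rels \<and> e (b, d) \<otimes>\<^bsub>P\<^esub> u \<in> rels"
    using u
  proof (cases rule: rels_cases)
    case (addA a a' c)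
    then show ?thesis using g by (simp add: r relsI)
  next
    case (addC a c c')
    then show ?thesis using g by (simp add: r relsI)
  next
    case (smultA k a c)
    then show ?thesis using g by (simp add: r relsI)
  next
    case (smultC k a c)
    then show ?thesis using g by (simp add: r c relsI)
  qed
  then show "u \<otimes>\<^bsub>P\<^esub> e g \<in> N \<and> e g \<otimes>\<^bsub>P\<^esub> u \<in> N"
    using span_submodule(2)[OF rels_subset] g by auto
qed

sublocale N: ideal N P by (rule ideal_N)

abbreviation "T \<equiv> tensor_algebra F A C"
abbreviation "cl u \<equiv> N +>\<^bsub>P\<^esub> u"

lemma ring_reduct_T: "ring_reduct T = P Quot N"
  by (simp add: ring_reduct_def tensor_algebra_def Let_def FactRing_def)

lemma ring_T: "Ring.ring (ring_reduct T)"
  unfolding ring_reduct_T by (rule N.quotient_is_ring)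

lemma carrier_T: "carrier T = cl ` carrier P"
  by (auto simp: tensor_algebra_def Let_def FactRing_def A_RCOSETS_def' )

lemma T_ops:
  assumes "u \<in> carrier P" "v \<in> carrier P"
  shows "cl u \<otimes>\<^bsub>T\<^esub> cl v = cl (u \<otimes>\<^bsub>P\<^esub> v)" "cl u \<oplus>\<^bsub>T\<^esub> cl v = cl (u \<oplus>\<^bsub>P\<^esub> v)"
  using assms by (simp_all add: tensor_algebra_def Let_def FactRing_def N.rcoset_mult_add N.a_rcos_sum)

lemma one_T: "\<one>\<^bsub>T\<^esub> = cl (e (\<one>\<^bsub>A\<^esub>, \<one>\<^bsub>C\<^esub>))"
  by (simp add: tensor_algebra_def Let_def FactRing_def one_P)

lemma cl_eqI:
  assumes "u \<in> carrier P" "v \<in> carrier P" "u \<ominus>\<^bsub>P\<^esub> v \<in> N"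
  shows "cl u = cl v"
  using assms by (simp add: P.quotient_eq_iff_same_a_r_cos[OF ideal_N])

lemma cl_eqD:
  assumes "u \<in> carrier P" "v \<in> carrier P" "cl u = cl v"
  shows "u \<ominus>\<^bsub>P\<^esub> v \<in> N"
  using assms by (simp add: P.quotient_eq_iff_same_a_r_cos[OF ideal_N])

text \<open>The union in the definition runs over all representatives of the coset. Since
  \<open>N\<close> is a submodule they all yield the same coset, and the union collapses.\<close>

lemma smult_T:
  assumes k: "k \<in> carrier F" and u: "u \<in> carrier P"
  shows "k \<odot>\<^bsub>T\<^esub> cl u = cl (k \<odot>\<^bsub>P\<^esub> u)"
proof -
  have "cl (k \<odot>\<^bsub>P\<^esub> v) = cl (k \<odot>\<^bsub>P\<^esub> u)" if "v \<in> cl u" for v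
  proof -
    have v: "v \<in> carrier P" using that u P.a_r_coset_subset_G[OF N.a_subset u] by auto
    have "cl v = cl u" using N.a_repr_independence'[OF that u] by simp
    then have "v \<ominus>\<^bsub>P\<^esub> u \<in> N" using cl_eqD u v by blast
    then have "k \<odot>\<^bsub>P\<^esub> (v \<ominus>\<^bsub>P\<^esub> u) \<in> N"
      using P.submoduleE(4)[OF span_submodule(1)[OF rels_subset]] k by blast
    moreover have "k \<odot>\<^bsub>P\<^esub> (v \<ominus>\<^bsub>P\<^esub> u) = k \<odot>\<^bsub>P\<^esub> v \<ominus>\<^bsub>P\<^esub> k \<odot>\<^bsub>P\<^esub> u"
      using k u v by (simp add: a_minus_def P.smult_r_distr P.smult_r_minus)
    ultimately show ?thesis using k u v by (intro cl_eqI smult_P) simp_all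
  qed
  then have "(\<Union>v\<in>cl u. cl (k \<odot>\<^bsub>P\<^esub> v)) = (\<Union>v\<in>cl u. cl (k \<odot>\<^bsub>P\<^esub> u))"
    by (rule SUP_cong[OF refl])
  also have "\<dots> = cl (k \<odot>\<^bsub>P\<^esub> u)" using N.a_rcos_self[OF u] by (intro SUP_eq_const) auto
  finally show ?thesis by (simp add: tensor_algebra_def Let_def)
qed

lemma ring_A: "Ring.ring A"
  by (rule ringI) (simp_all add: A.abelian_group_axioms A.monoid_axioms A.mult_rules)

lemma cl_rel: "u \<in> carrier P \<Longrightarrow> v \<in> carrier P \<Longrightarrow> u \<ominus>\<^bsub>P\<^esub> v \<in> rels \<Longrightarrow> cl u = cl v"
  by (rule cl_eqI) (assumption, assumption, rule subsetD[OF span_submodule(2)[OF rels_subset]])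

lemma reduct_T:
  "carrier (ring_reduct T) = carrier T" "x \<otimes>\<^bsub>ring_reduct T\<^esub> y = x \<otimes>\<^bsub>T\<^esub> y"
  "x \<oplus>\<^bsub>ring_reduct T\<^esub> y = x \<oplus>\<^bsub>T\<^esub> y" "\<one>\<^bsub>ring_reduct T\<^esub> = \<one>\<^bsub>T\<^esub>"
  by (simp_all add: ring_reduct_def)

lemma ring_hom_A: "ring_hom_ring A (ring_reduct T) (\<lambda>a. cl (e (a, \<one>\<^bsub>C\<^esub>)))"
proof (rule ring_hom_ringI)
  show "Ring.ring A" by (rule ring_A)
  show "Ring.ring (ring_reduct T)" by (rule ring_T)
  show "cl (e (a, \<one>\<^bsub>C\<^esub>)) \<in> carrier (ring_reduct T)" if "a \<in> carrier A" for a
    unfolding reduct_T carrier_T by (rule imageI) (rule eP[OF that C.one_closed])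
  show "cl (e (a \<otimes>\<^bsub>A\<^esub> b, \<one>\<^bsub>C\<^esub>)) = cl (e (a, \<one>\<^bsub>C\<^esub>)) \<otimes>\<^bsub>ring_reduct T\<^esub> cl (e (b, \<one>\<^bsub>C\<^esub>))"
    if ab: "a \<in> carrier A" "b \<in> carrier A" for a b
    unfolding reduct_T T_ops(1)[OF eP[OF ab(1) C.one_closed] eP[OF ab(2) C.one_closed]]
      mult_e_pair[OF ab(1) C.one_closed ab(2) C.one_closed] by simp
  show "cl (e (a \<oplus>\<^bsub>A\<^esub> b, \<one>\<^bsub>C\<^esub>)) = cl (e (a, \<one>\<^bsub>C\<^esub>)) \<oplus>\<^bsub>ring_reduct T\<^esub> cl (e (b, \<one>\<^bsub>C\<^esub>))"
    if ab: "a \<in> carrier A" "b \<in> carrier A" for a b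
    unfolding reduct_T T_ops(2)[OF eP[OF ab(1) C.one_closed] eP[OF ab(2) C.one_closed]]
    by (rule cl_rel[OF _ _ relsI(1)]) (use ab in \<open>simp_all add: eP add_P\<close>)
  show "cl (e (\<one>\<^bsub>A\<^esub>, \<one>\<^bsub>C\<^esub>)) = \<one>\<^bsub>ring_reduct T\<^esub>"
    unfolding reduct_T by (rule one_T[symmetric])
qed

lemma one_mem_ideal_T:
  assumes A: "carrier A = commutator_ideal A"
    and I: "ideal I (ring_reduct T)"
    and comm: "\<And>x y. x \<in> carrier T \<Longrightarrow> y \<in> carrier T \<Longrightarrow> x \<otimes>\<^bsub>T\<^esub> y \<ominus>\<^bsub>ring_reduct T\<^esub> y \<otimes>\<^bsub>T\<^esub> x \<in> I"
  shows "\<one>\<^bsub>T\<^esub> \<in> I"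
proof -
  define h where "h a = cl (e (a, \<one>\<^bsub>C\<^esub>))" for a
  interpret h: ring_hom_ring A "ring_reduct T" h
    unfolding h_def by (rule ring_hom_A)
  let ?I = "{a \<in> carrier A. h a \<in> I}"
  have "commutator_ideal A \<subseteq> ?I"
    unfolding commutator_ideal_def
  proof (rule h.R.genideal_minimal)
    show "ideal ?I A" by (rule h.ideal_vimage) (rule I)
    have "h (a \<otimes>\<^bsub>A\<^esub> b \<ominus>\<^bsub>A\<^esub> b \<otimes>\<^bsub>A\<^esub> a) \<in> I" if ab: "a \<in> carrier A" "b \<in> carrier A" for a b
    proof -
      have "h (a \<otimes>\<^bsub>A\<^esub> b \<ominus>\<^bsub>A\<^esub> b \<otimes>\<^bsub>A\<^esub> a) = h a \<otimes>\<^bsub>T\<^esub> h b \<ominus>\<^bsub>ring_reduct T\<^esub> h b \<otimes>\<^bsub>T\<^esub> h a"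
        using ab by (simp add: a_minus_def h.hom_a_inv flip: reduct_T(2))
      moreover have "h x \<in> carrier T" if "x \<in> carrier A" for x
        using h.hom_closed[OF that] by (simp only: reduct_T)
      ultimately show ?thesis using comm ab by simp
    qed
    then show "{x \<otimes>\<^bsub>A\<^esub> y \<ominus>\<^bsub>A\<^esub> y \<otimes>\<^bsub>A\<^esub> x |x y. x \<in> carrier A \<and> y \<in> carrier A} \<subseteq> ?I"
      using A.mult_closed by auto
  qed
  moreover have "\<one>\<^bsub>A\<^esub> \<in> commutator_ideal A" using A.one_closed unfolding A .
  ultimately have "h \<one>\<^bsub>A\<^esub> \<in> I" by blast
  then show ?thesis unfolding h_def one_T .
qed

theorem jordan_hom_T_standard:
  fixes B :: "('f, 'b) module"
  assumes "carrier A = commutator_ideal A" "\<one> \<oplus> \<one> \<noteq> \<zero>" "assoc_algebra F B" "jordan_hom F T B \<phi>"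
  shows "standard_map F T B \<phi>"
proof (rule jordan_hom_standard[OF assms(3,2) ring_T _ assms(4)])
  show "\<one>\<^bsub>T\<^esub> \<in> I" if "ideal I (ring_reduct T)"
    "\<And>x y. x \<in> carrier T \<Longrightarrow> y \<in> carrier T \<Longrightarrow> x \<otimes>\<^bsub>T\<^esub> y \<ominus>\<^bsub>ring_reduct T\<^esub> y \<otimes>\<^bsub>T\<^esub> x \<in> I" for I
    using assms(1) that by (rule one_mem_ideal_T)
qed

lemma mult_T_closed: "x \<in> carrier T \<Longrightarrow> y \<in> carrier T \<Longrightarrow> x \<otimes>\<^bsub>T\<^esub> y \<in> carrier T"
  by (auto simp: carrier_T T_ops mult_P)

text \<open>Evaluates at a chosen representative; the choice is harmless once
  \<open>lin_ext B f\<close> vanishes on \<open>N\<close>, see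
  \<open>tensor_lift_cl\<close>.\<close>

definition tensor_lift :: "('f, 'b, 'l) module_scheme \<Rightarrow> ('a \<times> 'c \<Rightarrow> 'b) \<Rightarrow> ('a \<times> 'c \<Rightarrow> 'f) set \<Rightarrow> 'b"
  where "tensor_lift B f S = lin_ext B f (SOME u. u \<in> carrier P \<and> S = cl u)"

context
  fixes B :: "('f, 'b, 'l) module_scheme" and f :: "'a \<times> 'c \<Rightarrow> 'b"
  assumes B: "module F B"
    and f: "\<And>a c. a \<in> carrier A \<Longrightarrow> c \<in> carrier C \<Longrightarrow> f (a, c) \<in> carrier B"
    and f_addA: "\<And>a a' c. a \<in> carrier A \<Longrightarrow> a' \<in> carrier A \<Longrightarrow> c \<in> carrier C \<Longrightarrow>
      f (a \<oplus>\<^bsub>A\<^esub> a', c) = f (a, c) \<oplus>\<^bsub>B\<^esub> f (a', c)"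
    and f_addC: "\<And>a c c'. a \<in> carrier A \<Longrightarrow> c \<in> carrier C \<Longrightarrow> c' \<in> carrier C \<Longrightarrow>
      f (a, c \<oplus>\<^bsub>C\<^esub> c') = f (a, c) \<oplus>\<^bsub>B\<^esub> f (a, c')"
    and f_smultA: "\<And>k a c. k \<in> carrier F \<Longrightarrow> a \<in> carrier A \<Longrightarrow> c \<in> carrier C \<Longrightarrow>
      f (k \<odot>\<^bsub>A\<^esub> a, c) = k \<odot>\<^bsub>B\<^esub> f (a, c)"
    and f_smultC: "\<And>k a c. k \<in> carrier F \<Longrightarrow> a \<in> carrier A \<Longrightarrow> c \<in> carrier C \<Longrightarrow>
      f (a, k \<odot>\<^bsub>C\<^esub> c) = k \<odot>\<^bsub>B\<^esub> f (a, c)"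
begin

interpretation B: module F B by (rule B)

lemma f_funcset: "f \<in> carrier (A \<times>\<times> C) \<rightarrow> carrier B"
  using f by auto

lemmas lin_ext_rules = lin_ext_add[OF B f_funcset] lin_ext_smult[OF B f_funcset] lin_ext_e[OF B f_funcset]
  lin_ext_zero[OF B f_funcset] lin_ext_closed[OF B f_funcset]

lemma lin_ext_minus:
  assumes "u \<in> carrier P" "v \<in> carrier P"
  shows "lin_ext B f (u \<ominus>\<^bsub>P\<^esub> v) = lin_ext B f u \<ominus>\<^bsub>B\<^esub> lin_ext B f v"
proof -
  have "\<ominus>\<^bsub>P\<^esub> v = (\<ominus> \<one>) \<odot>\<^bsub>P\<^esub> v" using assms by (simp add: P.smult_l_minus)
  then show ?thesis
    using assms by (simp add: a_minus_def lin_ext_rules smult_P B.smult_l_minus)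
qed

lemma lin_ext_N:
  assumes "u \<in> N"
  shows "lin_ext B f u = \<zero>\<^bsub>B\<^esub>"
  using rels_subset assms
proof (induction u rule: span_induct)
  case (base u)
  then show ?case
    by (cases rule: rels_cases)
      (simp_all add: lin_ext_minus lin_ext_rules eP add_P smult_P f f_addA f_addC f_smultA f_smultC,
       simp_all add: a_minus_def B.M.r_neg f)
qed (simp_all add: lin_ext_rules)

lemma tensor_lift_cl:
  assumes u: "u \<in> carrier P"
  shows "tensor_lift B f (cl u) = lin_ext B f u"
proof -
  define v where "v = (SOME v. v \<in> carrier P \<and> cl u = cl v)"
  have v: "v \<in> carrier P" "cl u = cl v"
    using someI[of "\<lambda>v. v \<in> carrier P \<and> cl u = cl v" u] u by (auto simp: v_def)
  then have "lin_ext B f u \<ominus>\<^bsub>B\<^esub> lin_ext B f v = \<zero>\<^bsub>B\<^esub>"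
    using lin_ext_N[OF cl_eqD[OF u v]] by (simp add: lin_ext_minus u)
  then have "lin_ext B f u = lin_ext B f v"
    using u v by (simp add: lin_ext_rules B.M.add.inv_solve_right' a_minus_def)
  then show ?thesis by (simp add: tensor_lift_def v_def)
qed

lemma linear_map_tensor_lift: "linear_map F T B (tensor_lift B f)"
  unfolding linear_map_def carrier_T
  by (auto simp: T_ops smult_T tensor_lift_cl lin_ext_rules add_P smult_P)

text \<open>The identity is bilinear in \<open>u\<close> and \<open>v\<close>, so pure tensors
  suffice; \<open>ac\<close> regroups sums into the pairs that occur in the induction
  hypotheses.\<close>

lemma jordan_hom_tensor_lift:
  assumes assoc: "assoc_algebra F B"
    and jordan: "\<And>a b c d. a \<in> carrier A \<Longrightarrow> b \<in> carrier A \<Longrightarrow> c \<in> carrier C \<Longrightarrow> d \<in> carrier C \<Longrightarrow>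
      f (a \<otimes>\<^bsub>A\<^esub> b, c \<otimes>\<^bsub>C\<^esub> d) \<oplus>\<^bsub>B\<^esub> f (b \<otimes>\<^bsub>A\<^esub> a, d \<otimes>\<^bsub>C\<^esub> c) =
      f (a, c) \<otimes>\<^bsub>B\<^esub> f (b, d) \<oplus>\<^bsub>B\<^esub> f (b, d) \<otimes>\<^bsub>B\<^esub> f (a, c)"
  shows "jordan_hom F T B (tensor_lift B f)"
proof -
  interpret B': assoc_algebra F B by (rule assoc)
  let ?L = "lin_ext B f"
  note r = lin_ext_rules P_rules B'.mult_rules B'.mult_zero f B.smult_r_distr
  have ac: "(p \<oplus>\<^bsub>B\<^esub> q) \<oplus>\<^bsub>B\<^esub> (p' \<oplus>\<^bsub>B\<^esub> q') = (p \<oplus>\<^bsub>B\<^esub> p') \<oplus>\<^bsub>B\<^esub> (q \<oplus>\<^bsub>B\<^esub> q')"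
    if "p \<in> carrier B" "q \<in> carrier B" "p' \<in> carrier B" "q' \<in> carrier B" for p q p' q'
    using that by (simp add: B.M.a_ac)
  have "?L (u \<otimes>\<^bsub>P\<^esub> v) \<oplus>\<^bsub>B\<^esub> ?L (v \<otimes>\<^bsub>P\<^esub> u) = ?L u \<otimes>\<^bsub>B\<^esub> ?L v \<oplus>\<^bsub>B\<^esub> ?L v \<otimes>\<^bsub>B\<^esub> ?L u"
    if u: "u \<in> carrier P" and v: "v \<in> carrier P" for u v
    using u
  proof (induction u rule: basis_induct)
    case (basis g)
    then obtain a c where g: "g = (a, c)" "a \<in> carrier A" "c \<in> carrier C" by auto
    note gP = eP[OF g(2,3)]
    show ?case using v
    proof (induction v rule: basis_induct)
      case (basis h)
      then obtain b d where "h = (b, d)" "b \<in> carrier A" "d \<in> carrier C" by auto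
      then show ?case using g gP eP jordan by (simp add: mult_e_pair lin_ext_rules)
    next
      case (add v w)
      have "?L (e g \<otimes>\<^bsub>P\<^esub> (v \<oplus>\<^bsub>P\<^esub> w)) \<oplus>\<^bsub>B\<^esub> ?L ((v \<oplus>\<^bsub>P\<^esub> w) \<otimes>\<^bsub>P\<^esub> e g) =
          (?L (e g \<otimes>\<^bsub>P\<^esub> v) \<oplus>\<^bsub>B\<^esub> ?L (v \<otimes>\<^bsub>P\<^esub> e g)) \<oplus>\<^bsub>B\<^esub> (?L (e g \<otimes>\<^bsub>P\<^esub> w) \<oplus>\<^bsub>B\<^esub> ?L (w \<otimes>\<^bsub>P\<^esub> e g))"
        using add(1,2) gP g by (subst ac) (simp_all add: r)
      also have "\<dots> = ?L (e g) \<otimes>\<^bsub>B\<^esub> ?L (v \<oplus>\<^bsub>P\<^esub> w) \<oplus>\<^bsub>B\<^esub> ?L (v \<oplus>\<^bsub>P\<^esub> w) \<otimes>\<^bsub>B\<^esub> ?L (e g)"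
        unfolding add.IH using add(1,2) gP g by (subst ac) (simp_all add: r)
      finally show ?case .
    next
      case (smult k v)
      have "?L (e g \<otimes>\<^bsub>P\<^esub> (k \<odot>\<^bsub>P\<^esub> v)) \<oplus>\<^bsub>B\<^esub> ?L ((k \<odot>\<^bsub>P\<^esub> v) \<otimes>\<^bsub>P\<^esub> e g) =
          k \<odot>\<^bsub>B\<^esub> (?L (e g \<otimes>\<^bsub>P\<^esub> v) \<oplus>\<^bsub>B\<^esub> ?L (v \<otimes>\<^bsub>P\<^esub> e g))"
        using smult(1,2) gP g by (simp add: r)
      also have "\<dots> = ?L (e g) \<otimes>\<^bsub>B\<^esub> ?L (k \<odot>\<^bsub>P\<^esub> v) \<oplus>\<^bsub>B\<^esub> ?L (k \<odot>\<^bsub>P\<^esub> v) \<otimes>\<^bsub>B\<^esub> ?L (e g)"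
        unfolding smult.IH using smult(1,2) gP g by (simp add: r)
      finally show ?case .
    qed (use g gP in \<open>simp_all add: r\<close>)
  next
    case (add u w)
    have "?L ((u \<oplus>\<^bsub>P\<^esub> w) \<otimes>\<^bsub>P\<^esub> v) \<oplus>\<^bsub>B\<^esub> ?L (v \<otimes>\<^bsub>P\<^esub> (u \<oplus>\<^bsub>P\<^esub> w)) =
        (?L (u \<otimes>\<^bsub>P\<^esub> v) \<oplus>\<^bsub>B\<^esub> ?L (v \<otimes>\<^bsub>P\<^esub> u)) \<oplus>\<^bsub>B\<^esub> (?L (w \<otimes>\<^bsub>P\<^esub> v) \<oplus>\<^bsub>B\<^esub> ?L (v \<otimes>\<^bsub>P\<^esub> w))"
      using add(1,2) v by (subst ac) (simp_all add: r)
    also have "\<dots> = ?L (u \<oplus>\<^bsub>P\<^esub> w) \<otimes>\<^bsub>B\<^esub> ?L v \<oplus>\<^bsub>B\<^esub> ?L v \<otimes>\<^bsub>B\<^esub> ?L (u \<oplus>\<^bsub>P\<^esub> w)"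
      unfolding add.IH using add(1,2) v by (subst ac) (simp_all add: r)
    finally show ?case .
  next
    case (smult k u)
    have "?L ((k \<odot>\<^bsub>P\<^esub> u) \<otimes>\<^bsub>P\<^esub> v) \<oplus>\<^bsub>B\<^esub> ?L (v \<otimes>\<^bsub>P\<^esub> (k \<odot>\<^bsub>P\<^esub> u)) =
        k \<odot>\<^bsub>B\<^esub> (?L (u \<otimes>\<^bsub>P\<^esub> v) \<oplus>\<^bsub>B\<^esub> ?L (v \<otimes>\<^bsub>P\<^esub> u))"
      using smult(1,2) v by (simp add: r)
    also have "\<dots> = ?L (k \<odot>\<^bsub>P\<^esub> u) \<otimes>\<^bsub>B\<^esub> ?L v \<oplus>\<^bsub>B\<^esub> ?L v \<otimes>\<^bsub>B\<^esub> ?L (k \<odot>\<^bsub>P\<^esub> u)"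
      unfolding smult.IH using smult(1,2) v by (simp add: r)
    finally show ?case .
  qed (use v in \<open>simp_all add: r\<close>)
  then show ?thesis
    unfolding jordan_hom_def carrier_T jordan_product_def
    using linear_map_tensor_lift
    by (auto simp: T_ops tensor_lift_cl lin_ext_rules add_P mult_P)
qed

end

end

lemma assoc_algebra_image:
  fixes E :: "('f, 'e, 'm) module_scheme" and B :: "('f, 'b, 'n) module_scheme"
  assumes E: "assoc_algebra F E"
    and surj: "carrier B = h ` carrier E"
    and add: "\<And>x y. x \<in> carrier E \<Longrightarrow> y \<in> carrier E \<Longrightarrow> h x \<oplus>\<^bsub>B\<^esub> h y = h (x \<oplus>\<^bsub>E\<^esub> y)"
    and mult: "\<And>x y. x \<in> carrier E \<Longrightarrow> y \<in> carrier E \<Longrightarrow> h x \<otimes>\<^bsub>B\<^esub> h y = h (x \<otimes>\<^bsub>E\<^esub> y)"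
    and zero: "\<zero>\<^bsub>B\<^esub> = h \<zero>\<^bsub>E\<^esub>"
    and smult: "\<And>k x. k \<in> carrier F \<Longrightarrow> x \<in> carrier E \<Longrightarrow> k \<odot>\<^bsub>B\<^esub> h x = h (k \<odot>\<^bsub>E\<^esub> x)"
  shows "assoc_algebra F B"
proof -
  interpret E: assoc_algebra F E by (rule E)
  have "abelian_group B"
  proof (rule abelian_groupI)
    show "\<exists>y\<in>carrier B. y \<oplus>\<^bsub>B\<^esub> x = \<zero>\<^bsub>B\<^esub>" if x: "x \<in> carrier B" for x
    proof -
      obtain u where u: "u \<in> carrier E" "x = h u" using x surj by auto
      have "h (\<ominus>\<^bsub>E\<^esub> u) \<oplus>\<^bsub>B\<^esub> x = \<zero>\<^bsub>B\<^esub>" using u by (simp add: add zero E.M.l_neg)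
      then show ?thesis using u surj by (intro bexI[of _ "h (\<ominus>\<^bsub>E\<^esub> u)"]) auto
    qed
  qed (auto simp: surj add zero E.M.a_ac)
  then have "module F B"
    by (intro moduleI) (auto simp: surj add zero smult E.is_cring E.smult_l_distr E.smult_r_distr E.smult_assoc1)
  then show ?thesis
    unfolding assoc_algebra_def
    by (intro conjI assoc_algebra_axioms.intro)
      (auto simp: E.field_axioms surj add mult smult E.mult_rules)
qed

subsection \<open>A nonstandard Jordan homomorphism\<close>

text \<open>
  The trivial extension of \<open>F\<close> by a square-zero ideal. Only the coordinates \<open>0\<close>, \<open>1\<close>, \<open>2\<close>, that is, the
  algebra with basis \<open>1\<close>, \<open>x\<close>, \<open>y\<close> and \<open>x\<^sup>2 = y\<^sup>2 = xy = 0\<close>, matter.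
\<close>

definition trivial_extension :: "('f, 'm) ring_scheme \<Rightarrow> ('f, nat \<Rightarrow> 'f) module"
  where "trivial_extension F =
    \<lparr>carrier = {c. \<forall>i. c i \<in> carrier F},
     monoid.mult = (\<lambda>c d i. if i = 0 then c 0 \<otimes>\<^bsub>F\<^esub> d 0 else c 0 \<otimes>\<^bsub>F\<^esub> d i \<oplus>\<^bsub>F\<^esub> c i \<otimes>\<^bsub>F\<^esub> d 0),
     one = (\<lambda>i. if i = 0 then \<one>\<^bsub>F\<^esub> else \<zero>\<^bsub>F\<^esub>),
     ring.zero = (\<lambda>i. \<zero>\<^bsub>F\<^esub>),
     ring.add = (\<lambda>c d i. c i \<oplus>\<^bsub>F\<^esub> d i),
     smult = (\<lambda>k c i. k \<otimes>\<^bsub>F\<^esub> c i)\<rparr>"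

lemma (in field) algebra_trivial_extension: "algebra R (trivial_extension R)"
proof (rule algebraI)
  show "cring (trivial_extension R)"
  proof (rule cringI)
    show "abelian_group (trivial_extension R)"
    proof (rule abelian_groupI)
      show "\<exists>y\<in>carrier (trivial_extension R). y \<oplus>\<^bsub>trivial_extension R\<^esub> x = \<zero>\<^bsub>trivial_extension R\<^esub>"
        if "x \<in> carrier (trivial_extension R)" for x
        using that by (intro bexI[of _ "\<lambda>i. \<ominus> x i"]) (auto simp: trivial_extension_def l_neg)
    qed (auto simp: trivial_extension_def a_ac)
    show "comm_monoid (trivial_extension R)"
      by (rule comm_monoidI) (auto simp: trivial_extension_def fun_eq_iff l_distr r_distr m_ac a_ac)
  qed (auto simp: trivial_extension_def fun_eq_iff l_distr r_distr m_ac a_ac)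
qed (auto simp: trivial_extension_def fun_eq_iff l_distr r_distr m_ac a_ac is_cring)

context unital_assoc_algebra
begin

lemma ring_A: "Ring.ring A"
  by (rule ringI) (simp_all add: abelian_group_axioms monoid_axioms mult_rules)

interpretation A: Ring.ring A by (rule ring_A)

abbreviation "K \<equiv> commutator_ideal A"

lemma ideal_K: "ideal K A"
  unfolding commutator_ideal_def by (rule A.genideal_ideal) (auto simp: mult_closed)

interpretation K: ideal K A by (rule ideal_K)

lemma commutator_mem_K: "a \<in> carrier A \<Longrightarrow> b \<in> carrier A \<Longrightarrow> a \<otimes>\<^bsub>A\<^esub> b \<ominus>\<^bsub>A\<^esub> b \<otimes>\<^bsub>A\<^esub> a \<in> K"
  unfolding commutator_ideal_def by (rule subsetD[OF A.genideal_self]) (auto simp: mult_closed)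

text \<open>
  The exterior algebra over \<open>A\<close> on two generators; \<open>p 0, \<dots>, p 3\<close> are the coefficients of \<open>1\<close>,
  \<open>e\<^sub>1\<close>, \<open>e\<^sub>2\<close>, \<open>e\<^sub>1e\<^sub>2\<close>. The further coordinates are idle.
\<close>

definition grassmann :: "('a, nat \<Rightarrow> 'c) module"
  where "grassmann =
    \<lparr>carrier = {p. \<forall>i. p i \<in> carrier A},
     monoid.mult = (\<lambda>p q i. if i = 0 then p 0 \<otimes>\<^bsub>A\<^esub> q 0
       else if i = 3 then p 0 \<otimes>\<^bsub>A\<^esub> q 3 \<oplus>\<^bsub>A\<^esub> p 3 \<otimes>\<^bsub>A\<^esub> q 0 \<oplus>\<^bsub>A\<^esub> (p 1 \<otimes>\<^bsub>A\<^esub> q 2 \<ominus>\<^bsub>A\<^esub> p 2 \<otimes>\<^bsub>A\<^esub> q 1)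
       else p 0 \<otimes>\<^bsub>A\<^esub> q i \<oplus>\<^bsub>A\<^esub> p i \<otimes>\<^bsub>A\<^esub> q 0),
     one = undefined,
     ring.zero = (\<lambda>i. \<zero>\<^bsub>A\<^esub>),
     ring.add = (\<lambda>p q i. p i \<oplus>\<^bsub>A\<^esub> q i),
     smult = (\<lambda>k p i. k \<odot>\<^bsub>A\<^esub> p i)\<rparr>"

abbreviation "E \<equiv> grassmann"

lemma mem_E: "p \<in> carrier E \<longleftrightarrow> (\<forall>i. p i \<in> carrier A)"
  by (simp add: grassmann_def)

lemma E_ops:
  "(p \<oplus>\<^bsub>E\<^esub> q) i = p i \<oplus>\<^bsub>A\<^esub> q i" "(k \<odot>\<^bsub>E\<^esub> p) i = k \<odot>\<^bsub>A\<^esub> p i" "\<zero>\<^bsub>E\<^esub> i = \<zero>\<^bsub>A\<^esub>"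
  "(p \<otimes>\<^bsub>E\<^esub> q) 0 = p 0 \<otimes>\<^bsub>A\<^esub> q 0"
  "(p \<otimes>\<^bsub>E\<^esub> q) 3 = p 0 \<otimes>\<^bsub>A\<^esub> q 3 \<oplus>\<^bsub>A\<^esub> p 3 \<otimes>\<^bsub>A\<^esub> q 0 \<oplus>\<^bsub>A\<^esub> (p 1 \<otimes>\<^bsub>A\<^esub> q 2 \<ominus>\<^bsub>A\<^esub> p 2 \<otimes>\<^bsub>A\<^esub> q 1)"
  "i \<noteq> 0 \<Longrightarrow> i \<noteq> 3 \<Longrightarrow> (p \<otimes>\<^bsub>E\<^esub> q) i = p 0 \<otimes>\<^bsub>A\<^esub> q i \<oplus>\<^bsub>A\<^esub> p i \<otimes>\<^bsub>A\<^esub> q 0"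
  by (simp_all add: grassmann_def)

lemma E_eqI:
  assumes "p 0 = q 0" "p 3 = q 3" "\<And>i. i \<noteq> 0 \<Longrightarrow> i \<noteq> 3 \<Longrightarrow> p i = q i"
  shows "p = (q :: nat \<Rightarrow> 'c)"
  using assms by (metis ext)

lemma mult_closed_E: "p \<in> carrier E \<Longrightarrow> q \<in> carrier E \<Longrightarrow> p \<otimes>\<^bsub>E\<^esub> q \<in> carrier E"
  unfolding mem_E by (simp add: grassmann_def mult_closed)

lemma smult_minus: "k \<in> carrier F \<Longrightarrow> x \<in> carrier A \<Longrightarrow> y \<in> carrier A \<Longrightarrow>
    k \<odot>\<^bsub>A\<^esub> (x \<ominus>\<^bsub>A\<^esub> y) = k \<odot>\<^bsub>A\<^esub> x \<ominus>\<^bsub>A\<^esub> k \<odot>\<^bsub>A\<^esub> y"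
  by (simp add: a_minus_def smult_r_distr smult_r_minus)

lemma assoc_algebra_E: "assoc_algebra F E"
proof -
  have "abelian_group E"
  proof (rule abelian_groupI)
    show "\<exists>q\<in>carrier E. q \<oplus>\<^bsub>E\<^esub> p = \<zero>\<^bsub>E\<^esub>" if "p \<in> carrier E" for p
      using that by (intro bexI[of _ "\<lambda>i. \<ominus>\<^bsub>A\<^esub> p i"]) (auto simp: fun_eq_iff mem_E E_ops M.l_neg)
  qed (auto simp: fun_eq_iff mem_E E_ops M.a_ac)
  then have m: "module F E"
    by (intro moduleI)
      (auto simp: fun_eq_iff mem_E E_ops is_cring smult_l_distr smult_r_distr smult_assoc1)
  note r = mem_E E_ops mult_closed mult_assoc A.l_distr A.r_distr a_minus_def M.minus_add A.l_minus A.r_minus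
    M.a_ac smult_mult_l smult_mult_r smult_r_distr smult_r_minus
  have "assoc_algebra_axioms F E"
  proof
    fix p q s assume pqs: "p \<in> carrier E" "q \<in> carrier E" "s \<in> carrier E"
    show "p \<otimes>\<^bsub>E\<^esub> q \<in> carrier E" by (rule mult_closed_E) fact+
    show "p \<otimes>\<^bsub>E\<^esub> q \<otimes>\<^bsub>E\<^esub> s = p \<otimes>\<^bsub>E\<^esub> (q \<otimes>\<^bsub>E\<^esub> s)"
      by (rule E_eqI) (use pqs in \<open>simp_all add: r\<close>)
    show "(p \<oplus>\<^bsub>E\<^esub> q) \<otimes>\<^bsub>E\<^esub> s = p \<otimes>\<^bsub>E\<^esub> s \<oplus>\<^bsub>E\<^esub> q \<otimes>\<^bsub>E\<^esub> s"
      by (rule E_eqI) (use pqs in \<open>simp_all add: r\<close>)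
    show "s \<otimes>\<^bsub>E\<^esub> (p \<oplus>\<^bsub>E\<^esub> q) = s \<otimes>\<^bsub>E\<^esub> p \<oplus>\<^bsub>E\<^esub> s \<otimes>\<^bsub>E\<^esub> q"
      by (rule E_eqI) (use pqs in \<open>simp_all add: r\<close>)
    fix k assume k: "k \<in> carrier F"
    show "k \<odot>\<^bsub>E\<^esub> p \<otimes>\<^bsub>E\<^esub> q = k \<odot>\<^bsub>E\<^esub> (p \<otimes>\<^bsub>E\<^esub> q)"
      by (rule E_eqI) (use pqs k in \<open>simp_all add: r\<close>)
    show "p \<otimes>\<^bsub>E\<^esub> (k \<odot>\<^bsub>E\<^esub> q) = k \<odot>\<^bsub>E\<^esub> (p \<otimes>\<^bsub>E\<^esub> q)"
      by (rule E_eqI) (use pqs k in \<open>simp_all add: r\<close>)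
  qed
  then show ?thesis by (intro assoc_algebra.intro field_axioms m)
qed

text \<open>
  The coefficient of \<open>e\<^sub>1e\<^sub>2\<close> is taken modulo \<open>K\<close>; the other coefficients become singletons, so
  that elements of the quotient are sequences of cosets.
\<close>

definition enc :: "(nat \<Rightarrow> 'c) \<Rightarrow> nat \<Rightarrow> 'c set"
  where "enc p i = (if i = 3 then K +>\<^bsub>A\<^esub> p 3 else {p i})"

text \<open>Only coordinate 3 involves a real choice; \<open>enc_cong\<close> shows that the
  operations of \<open>twisted\<close> do not depend on it.\<close>

definition dec :: "(nat \<Rightarrow> 'c set) \<Rightarrow> nat \<Rightarrow> 'c"
  where "dec S i = (SOME a. a \<in> S i)"

definition twisted :: "('a, nat \<Rightarrow> 'c set) module"
  where "twisted =
    \<lparr>carrier = enc ` carrier E,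
     monoid.mult = (\<lambda>S S'. enc (dec S \<otimes>\<^bsub>E\<^esub> dec S')),
     one = undefined,
     ring.zero = enc \<zero>\<^bsub>E\<^esub>,
     ring.add = (\<lambda>S S'. enc (dec S \<oplus>\<^bsub>E\<^esub> dec S')),
     smult = (\<lambda>k S. enc (k \<odot>\<^bsub>E\<^esub> dec S))\<rparr>"

abbreviation "B \<equiv> twisted"

lemma enc_eq_iff:
  assumes "p \<in> carrier E" "q \<in> carrier E"
  shows "enc p = enc q \<longleftrightarrow> (\<forall>i. i \<noteq> 3 \<longrightarrow> p i = q i) \<and> p 3 \<ominus>\<^bsub>A\<^esub> q 3 \<in> K"
proof -
  have "enc p = enc q \<longleftrightarrow> (\<forall>i. enc p i = enc q i)" by (simp add: fun_eq_iff)
  also have "\<dots> \<longleftrightarrow> (\<forall>i. i \<noteq> 3 \<longrightarrow> p i = q i) \<and> K +>\<^bsub>A\<^esub> p 3 = K +>\<^bsub>A\<^esub> q 3"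
    by (auto simp: enc_def)
  finally show ?thesis
    using assms by (simp add: A.quotient_eq_iff_same_a_r_cos[OF ideal_K] mem_E)
qed

lemma dec_enc:
  assumes p: "p \<in> carrier E"
  shows "dec (enc p) \<in> carrier E" "enc (dec (enc p)) = enc p"
proof -
  have 3: "dec (enc p) 3 \<in> K +>\<^bsub>A\<^esub> p 3"
    using K.a_rcos_self[of "p 3"] p by (auto simp: dec_def enc_def mem_E intro: someI)
  have o: "dec (enc p) i = p i" if "i \<noteq> 3" for i
    using that by (simp add: dec_def enc_def)
  have c: "dec (enc p) 3 \<in> carrier A"
    using 3 p M.a_r_coset_subset_G[OF K.a_subset] by (auto simp: mem_E)
  then show "dec (enc p) \<in> carrier E" using o p unfolding mem_E by metis
  have "K +>\<^bsub>A\<^esub> p 3 = K +>\<^bsub>A\<^esub> dec (enc p) 3"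
    using K.a_repr_independence'[OF 3] p by (simp add: mem_E)
  then show "enc (dec (enc p)) = enc p" by (auto simp: fun_eq_iff enc_def o)
qed

lemma smult_K:
  assumes k: "k \<in> carrier F" and x: "x \<in> K"
  shows "k \<odot>\<^bsub>A\<^esub> x \<in> K"
proof -
  have xA: "x \<in> carrier A" using x K.a_subset by blast
  have "k \<odot>\<^bsub>A\<^esub> x = (k \<odot>\<^bsub>A\<^esub> \<one>\<^bsub>A\<^esub>) \<otimes>\<^bsub>A\<^esub> x" using k xA by (simp add: smult_mult_l)
  also have "\<dots> \<in> K" using k x by (intro K.I_l_closed) auto
  finally show ?thesis .
qed

lemma enc_cong:
  assumes p: "p \<in> carrier E" "p' \<in> carrier E" "enc p = enc p'"
    and q: "q \<in> carrier E" "q' \<in> carrier E" "enc q = enc q'"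
  shows "enc (p \<oplus>\<^bsub>E\<^esub> q) = enc (p' \<oplus>\<^bsub>E\<^esub> q')" "enc (p \<otimes>\<^bsub>E\<^esub> q) = enc (p' \<otimes>\<^bsub>E\<^esub> q')"
    "k \<in> carrier F \<Longrightarrow> enc (k \<odot>\<^bsub>E\<^esub> p) = enc (k \<odot>\<^bsub>E\<^esub> p')"
proof -
  interpret E: assoc_algebra F E by (rule assoc_algebra_E)
  have c: "p i \<in> carrier A" "p' i \<in> carrier A" "q i \<in> carrier A" "q' i \<in> carrier A" for i
    using p q by (simp_all add: mem_E)
  have pp: "p i = p' i" "q i = q' i" if "i \<noteq> 3" for i
    using p q that by (simp_all add: enc_eq_iff)
  have K: "p 3 \<ominus>\<^bsub>A\<^esub> p' 3 \<in> K" "q 3 \<ominus>\<^bsub>A\<^esub> q' 3 \<in> K"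
    using p q by (simp_all add: enc_eq_iff)
  have "(p 3 \<oplus>\<^bsub>A\<^esub> q 3) \<ominus>\<^bsub>A\<^esub> (p' 3 \<oplus>\<^bsub>A\<^esub> q' 3) = (p 3 \<ominus>\<^bsub>A\<^esub> p' 3) \<oplus>\<^bsub>A\<^esub> (q 3 \<ominus>\<^bsub>A\<^esub> q' 3)"
    using c by (simp add: a_minus_def M.minus_add M.a_ac)
  then have "(p 3 \<oplus>\<^bsub>A\<^esub> q 3) \<ominus>\<^bsub>A\<^esub> (p' 3 \<oplus>\<^bsub>A\<^esub> q' 3) \<in> K" using K by (simp add: K.a_closed)
  then show "enc (p \<oplus>\<^bsub>E\<^esub> q) = enc (p' \<oplus>\<^bsub>E\<^esub> q')"
    using p q pp by (subst enc_eq_iff) (simp_all add: E.M.a_closed E_ops)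
  let ?r = "p' 1 \<otimes>\<^bsub>A\<^esub> q' 2 \<ominus>\<^bsub>A\<^esub> p' 2 \<otimes>\<^bsub>A\<^esub> q' 1"
  have r: "?r \<in> carrier A" using c by (simp add: mult_closed)
  have "(p' 0 \<otimes>\<^bsub>A\<^esub> q 3 \<oplus>\<^bsub>A\<^esub> p 3 \<otimes>\<^bsub>A\<^esub> q' 0 \<oplus>\<^bsub>A\<^esub> ?r) \<ominus>\<^bsub>A\<^esub> (p' 0 \<otimes>\<^bsub>A\<^esub> q' 3 \<oplus>\<^bsub>A\<^esub> p' 3 \<otimes>\<^bsub>A\<^esub> q' 0 \<oplus>\<^bsub>A\<^esub> ?r) =
      p' 0 \<otimes>\<^bsub>A\<^esub> (q 3 \<ominus>\<^bsub>A\<^esub> q' 3) \<oplus>\<^bsub>A\<^esub> (p 3 \<ominus>\<^bsub>A\<^esub> p' 3) \<otimes>\<^bsub>A\<^esub> q' 0 \<oplus>\<^bsub>A\<^esub> (?r \<ominus>\<^bsub>A\<^esub> ?r)"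
    using c r unfolding a_minus_def
    by (simp add: M.minus_add M.a_ac A.l_distr A.r_distr A.l_minus A.r_minus mult_closed)
  also have "\<dots> \<in> K"
    using K c r by (simp add: K.a_closed K.I_l_closed K.I_r_closed a_minus_def M.r_neg)
  finally have "(p \<otimes>\<^bsub>E\<^esub> q) 3 \<ominus>\<^bsub>A\<^esub> (p' \<otimes>\<^bsub>E\<^esub> q') 3 \<in> K" by (simp add: E_ops pp)
  moreover have "(p \<otimes>\<^bsub>E\<^esub> q) i = (p' \<otimes>\<^bsub>E\<^esub> q') i" if "i \<noteq> 3" for i
    using that by (cases "i = 0") (simp_all add: E_ops pp)
  ultimately show "enc (p \<otimes>\<^bsub>E\<^esub> q) = enc (p' \<otimes>\<^bsub>E\<^esub> q')"
    using p q by (simp add: enc_eq_iff mult_closed_E)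
  assume k: "k \<in> carrier F"
  have "k \<odot>\<^bsub>A\<^esub> (p 3 \<ominus>\<^bsub>A\<^esub> p' 3) \<in> K" by (rule smult_K) (fact k K)+
  then have "k \<odot>\<^bsub>A\<^esub> p 3 \<ominus>\<^bsub>A\<^esub> k \<odot>\<^bsub>A\<^esub> p' 3 \<in> K" using smult_minus[OF k c(1) c(2)] by simp
  then show "enc (k \<odot>\<^bsub>E\<^esub> p) = enc (k \<odot>\<^bsub>E\<^esub> p')"
    using p pp k by (subst enc_eq_iff) (simp_all add: E_ops E.smult_closed)
qed

lemma B_ops:
  assumes "p \<in> carrier E" "q \<in> carrier E"
  shows "enc p \<oplus>\<^bsub>B\<^esub> enc q = enc (p \<oplus>\<^bsub>E\<^esub> q)" "enc p \<otimes>\<^bsub>B\<^esub> enc q = enc (p \<otimes>\<^bsub>E\<^esub> q)"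
    "k \<in> carrier F \<Longrightarrow> k \<odot>\<^bsub>B\<^esub> enc p = enc (k \<odot>\<^bsub>E\<^esub> p)"
  using enc_cong[OF dec_enc(1)[OF assms(1)] assms(1) dec_enc(2)[OF assms(1)]
      dec_enc(1)[OF assms(2)] assms(2) dec_enc(2)[OF assms(2)]]
  by (simp_all add: twisted_def)

lemma carrier_B: "carrier B = enc ` carrier E" "\<zero>\<^bsub>B\<^esub> = enc \<zero>\<^bsub>E\<^esub>"
  by (simp_all add: twisted_def)

lemma assoc_algebra_B: "assoc_algebra F B"
  by (rule assoc_algebra_image[OF assoc_algebra_E carrier_B(1)]) (simp_all add: B_ops carrier_B)

abbreviation "C \<equiv> trivial_extension F"

text \<open>Coordinate 3 stays zero: as \<open>xy = 0\<close>, nothing in \<open>C\<close>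
  corresponds to \<open>e\<^sub>1e\<^sub>2\<close>.\<close>

definition emb :: "'c \<Rightarrow> (nat \<Rightarrow> 'a) \<Rightarrow> nat \<Rightarrow> 'c"
  where "emb a c = (\<lambda>i. if i < 3 then c i \<odot>\<^bsub>A\<^esub> a else \<zero>\<^bsub>A\<^esub>)"

lemma mem_C: "c \<in> carrier C \<longleftrightarrow> (\<forall>i. c i \<in> carrier F)"
  by (simp add: trivial_extension_def)

lemma emb_closed: "a \<in> carrier A \<Longrightarrow> c \<in> carrier C \<Longrightarrow> emb a c \<in> carrier E"
  by (simp add: emb_def mem_C mem_E)

lemma emb_linear:
  assumes "a \<in> carrier A" "c \<in> carrier C"
  shows "a' \<in> carrier A \<Longrightarrow> emb (a \<oplus>\<^bsub>A\<^esub> a') c = emb a c \<oplus>\<^bsub>E\<^esub> emb a' c"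
    "c' \<in> carrier C \<Longrightarrow> emb a (c \<oplus>\<^bsub>C\<^esub> c') = emb a c \<oplus>\<^bsub>E\<^esub> emb a c'"
    "k \<in> carrier F \<Longrightarrow> emb (k \<odot>\<^bsub>A\<^esub> a) c = k \<odot>\<^bsub>E\<^esub> emb a c"
    "k \<in> carrier F \<Longrightarrow> emb a (k \<odot>\<^bsub>C\<^esub> c) = k \<odot>\<^bsub>E\<^esub> emb a c"
  using assms by (auto simp: fun_eq_iff E_ops emb_def mem_C trivial_extension_def smult_r_distr smult_l_distr m_comm
      simp flip: smult_assoc1)

text \<open>Away from coordinate 3 both sides agree before encoding. At coordinate 3 the left side
  is zero and the right side is \<open>(c 1 d 2 - c 2 d 1) [a, b]\<close>, an element of
  \<open>K\<close>.\<close>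

lemma emb_jordan:
  assumes a: "a \<in> carrier A" "b \<in> carrier A" and c: "c \<in> carrier C" "d \<in> carrier C"
  shows "enc (emb (a \<otimes>\<^bsub>A\<^esub> b) (c \<otimes>\<^bsub>C\<^esub> d) \<oplus>\<^bsub>E\<^esub> emb (b \<otimes>\<^bsub>A\<^esub> a) (d \<otimes>\<^bsub>C\<^esub> c)) =
    enc (emb a c \<otimes>\<^bsub>E\<^esub> emb b d \<oplus>\<^bsub>E\<^esub> emb b d \<otimes>\<^bsub>E\<^esub> emb a c)"
proof -
  interpret E: assoc_algebra F E by (rule assoc_algebra_E)
  interpret C: algebra F C by (rule algebra_trivial_extension)
  have cd: "c i \<in> carrier F" "d i \<in> carrier F" for i using c by (simp_all add: mem_C)
  have ab: "a \<otimes>\<^bsub>A\<^esub> b \<in> carrier A" "b \<otimes>\<^bsub>A\<^esub> a \<in> carrier A" using a by (simp_all add: mult_closed)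
  have mult: "(k \<odot>\<^bsub>A\<^esub> x) \<otimes>\<^bsub>A\<^esub> (l \<odot>\<^bsub>A\<^esub> y) = (k \<otimes> l) \<odot>\<^bsub>A\<^esub> (x \<otimes>\<^bsub>A\<^esub> y)"
    if "k \<in> carrier F" "l \<in> carrier F" "x \<in> carrier A" "y \<in> carrier A" for k l x y
    using that by (simp add: smult_mult_l smult_mult_r mult_closed m_comm flip: smult_assoc1)
  let ?l = "emb (a \<otimes>\<^bsub>A\<^esub> b) (c \<otimes>\<^bsub>C\<^esub> d) \<oplus>\<^bsub>E\<^esub> emb (b \<otimes>\<^bsub>A\<^esub> a) (d \<otimes>\<^bsub>C\<^esub> c)"
    and ?r = "emb a c \<otimes>\<^bsub>E\<^esub> emb b d \<oplus>\<^bsub>E\<^esub> emb b d \<otimes>\<^bsub>E\<^esub> emb a c"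
  have lr: "?l \<in> carrier E" "?r \<in> carrier E"
    using a c ab by (auto intro!: E.M.a_closed mult_closed_E emb_closed)
  have "?l i = ?r i" if i: "i \<noteq> 3" for i
  proof (cases "i < 3")
    case True
    then show ?thesis
      using a ab cd i
      by (cases "i = 0")
        (simp_all add: E_ops emb_def trivial_extension_def mult smult_l_distr M.a_ac m_comm)
  next
    case False
    then show ?thesis using a cd i by (simp add: E_ops emb_def A.r_null A.l_null)
  qed
  moreover have "?l 3 \<ominus>\<^bsub>A\<^esub> ?r 3 \<in> K"
  proof -
    let ?k = "c 1 \<otimes> d 2" and ?k' = "c 2 \<otimes> d 1" and ?x = "a \<otimes>\<^bsub>A\<^esub> b" and ?y = "b \<otimes>\<^bsub>A\<^esub> a"
    have k: "?k \<in> carrier F" "?k' \<in> carrier F" using cd by auto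
    have l3: "?l 3 = \<zero>\<^bsub>A\<^esub>" by (simp add: E_ops emb_def)
    have r3: "?r 3 = (?k \<odot>\<^bsub>A\<^esub> ?x \<ominus>\<^bsub>A\<^esub> ?k' \<odot>\<^bsub>A\<^esub> ?x) \<oplus>\<^bsub>A\<^esub> (?k' \<odot>\<^bsub>A\<^esub> ?y \<ominus>\<^bsub>A\<^esub> ?k \<odot>\<^bsub>A\<^esub> ?y)"
      using a cd ab k by (simp add: E_ops emb_def mult A.l_null A.r_null m_comm[of "d (Suc 0)"] m_comm[of "d 2"])
    also have "\<dots> = ?k \<odot>\<^bsub>A\<^esub> (?x \<ominus>\<^bsub>A\<^esub> ?y) \<oplus>\<^bsub>A\<^esub> ?k' \<odot>\<^bsub>A\<^esub> (?y \<ominus>\<^bsub>A\<^esub> ?x)"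
      using ab k by (simp add: smult_minus) (simp add: a_minus_def M.a_ac)
    also have "\<dots> \<in> K"
      using a k by (intro K.a_closed smult_K commutator_mem_K)
    finally have "?r 3 \<in> K" .
    then show ?thesis
      unfolding l3 a_minus_def using K.a_inv_closed K.a_subset by (simp add: subset_iff)
  qed
  ultimately show ?thesis using enc_eq_iff[OF lr] by blast
qed

interpretation T: tensor_setup F A C
  by (intro tensor_setup.intro unital_assoc_algebra_axioms algebra_trivial_extension)

definition twist :: "('c \<times> (nat \<Rightarrow> 'a) \<Rightarrow> 'a) set \<Rightarrow> nat \<Rightarrow> 'c set"
  where "twist = T.tensor_lift B (\<lambda>(a, c). enc (emb a c))"

lemma
  shows jordan_hom_twist: "jordan_hom F (tensor_algebra F A C) B twist"
    and twist_cl: "a \<in> carrier A \<Longrightarrow> c \<in> carrier C \<Longrightarrow> twist (T.cl (T.e (a, c))) = enc (emb a c)"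
proof -
  interpret B: assoc_algebra F B by (rule assoc_algebra_B)
  interpret C: algebra F C by (rule algebra_trivial_extension)
  let ?f = "\<lambda>(a, c). enc (emb a c)"
  have m: "module F B" by (rule B.module_axioms)
  have f: "?f (a, c) \<in> carrier B" if "a \<in> carrier A" "c \<in> carrier C" for a c
    using that by (simp add: carrier_B emb_closed)
  have f1: "?f (a \<oplus>\<^bsub>A\<^esub> a', c) = ?f (a, c) \<oplus>\<^bsub>B\<^esub> ?f (a', c)"
    if "a \<in> carrier A" "a' \<in> carrier A" "c \<in> carrier C" for a a' c
    using that by (simp add: B_ops emb_closed emb_linear)
  have f2: "?f (a, c \<oplus>\<^bsub>C\<^esub> c') = ?f (a, c) \<oplus>\<^bsub>B\<^esub> ?f (a, c')"
    if "a \<in> carrier A" "c \<in> carrier C" "c' \<in> carrier C" for a c c'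
    using that by (simp add: B_ops emb_closed emb_linear)
  have f3: "?f (k \<odot>\<^bsub>A\<^esub> a, c) = k \<odot>\<^bsub>B\<^esub> ?f (a, c)"
    if "k \<in> carrier F" "a \<in> carrier A" "c \<in> carrier C" for k a c
    using that B_ops(3)[OF emb_closed emb_closed] by (simp add: emb_linear)
  have f4: "?f (a, k \<odot>\<^bsub>C\<^esub> c) = k \<odot>\<^bsub>B\<^esub> ?f (a, c)"
    if "k \<in> carrier F" "a \<in> carrier A" "c \<in> carrier C" for k a c
    using that B_ops(3)[OF emb_closed emb_closed] by (simp add: emb_linear)
  note f = f f1 f2 f3 f4
  show "jordan_hom F (tensor_algebra F A C) B twist"
    unfolding twist_def
  proof (rule T.jordan_hom_tensor_lift[OF m f assoc_algebra_B])
    fix a b c d assume "a \<in> carrier A" "b \<in> carrier A" "c \<in> carrier C" "d \<in> carrier C"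
    then show "?f (a \<otimes>\<^bsub>A\<^esub> b, c \<otimes>\<^bsub>C\<^esub> d) \<oplus>\<^bsub>B\<^esub> ?f (b \<otimes>\<^bsub>A\<^esub> a, d \<otimes>\<^bsub>C\<^esub> c) =
        ?f (a, c) \<otimes>\<^bsub>B\<^esub> ?f (b, d) \<oplus>\<^bsub>B\<^esub> ?f (b, d) \<otimes>\<^bsub>B\<^esub> ?f (a, c)"
      using emb_jordan[of a b c d] by (simp add: B_ops emb_closed mult_closed mult_closed_E)
  qed
  show "twist (T.cl (T.e (a, c))) = enc (emb a c)" if "a \<in> carrier A" "c \<in> carrier C"
  proof -
    have "twist (T.cl (T.e (a, c))) = T.lin_ext B ?f (T.e (a, c))"
      unfolding twist_def using that by (intro T.tensor_lift_cl[OF m f] T.eP)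
    also have "\<dots> = ?f (a, c)"
      using that by (intro T.lin_ext_e[OF m]) (auto simp: f(1)[simplified])
    finally show ?thesis by simp
  qed
qed

definition unit_vec :: "nat \<Rightarrow> nat \<Rightarrow> 'a"
  where "unit_vec j i = (if i = j then \<one> else \<zero>)"

lemma unit_vec:
  "unit_vec j \<in> carrier C" "unit_vec 0 = \<one>\<^bsub>C\<^esub>" "unit_vec 2 \<otimes>\<^bsub>C\<^esub> unit_vec 1 = \<zero>\<^bsub>C\<^esub>"
  by (auto simp: mem_C unit_vec_def trivial_extension_def fun_eq_iff)

lemma emb_unit_vec: "a \<in> carrier A \<Longrightarrow> emb a (unit_vec j) i = (if i = j \<and> j < 3 then a else \<zero>\<^bsub>A\<^esub>)"
  by (simp add: emb_def unit_vec_def)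

abbreviation gen :: "'c \<Rightarrow> nat \<Rightarrow> ('c \<times> (nat \<Rightarrow> 'a) \<Rightarrow> 'a) set"
  where "gen a j \<equiv> T.cl (T.e (a, unit_vec j))"

lemma gen_closed: "a \<in> carrier A \<Longrightarrow> gen a j \<in> carrier (tensor_algebra F A C)"
  unfolding T.carrier_T by (intro imageI T.eP unit_vec)

lemma twist_gen: "a \<in> carrier A \<Longrightarrow> twist (gen a j) = enc (emb a (unit_vec j))"
  by (intro twist_cl unit_vec)

text \<open>Only the two defining formulas of a nearly standard map are assumed, so
  \<open>twist_standard\<close> can use this as well, through \<open>standard_mult\<close>; the
  relation at coordinate 0 is recorded for that use.\<close>

lemma twist_decomposition:
  assumes f: "f \<in> carrier (tensor_algebra F A C) \<rightarrow> carrier B" "g \<in> carrier (tensor_algebra F A C) \<rightarrow> carrier B"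
    and sum: "\<And>x. x \<in> carrier (tensor_algebra F A C) \<Longrightarrow> twist x = f x \<oplus>\<^bsub>B\<^esub> g x"
    and mult: "\<And>x y. x \<in> carrier (tensor_algebra F A C) \<Longrightarrow> y \<in> carrier (tensor_algebra F A C) \<Longrightarrow>
      twist (x \<otimes>\<^bsub>tensor_algebra F A C\<^esub> y) = twist x \<otimes>\<^bsub>B\<^esub> f y \<oplus>\<^bsub>B\<^esub> g y \<otimes>\<^bsub>B\<^esub> twist x"
    and b: "b \<in> carrier A"
  obtains p q where "p \<in> carrier E" "q \<in> carrier E" "f (gen b 1) = enc p" "g (gen b 1) = enc q"
    "p 0 \<oplus>\<^bsub>A\<^esub> q 0 = \<zero>\<^bsub>A\<^esub>" "p 1 \<oplus>\<^bsub>A\<^esub> q 1 = b" "q 1 \<in> algebra_center A" "p 1 \<ominus>\<^bsub>A\<^esub> q 1 \<in> K"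
proof -
  interpret E: assoc_algebra F E by (rule assoc_algebra_E)
  interpret C: algebra F C by (rule algebra_trivial_extension)
  note y = gen_closed[OF b, of 1]
  obtain p q where pq: "p \<in> carrier E" "q \<in> carrier E" "f (gen b 1) = enc p" "g (gen b 1) = enc q"
    using funcset_mem[OF f(1) y] funcset_mem[OF f(2) y] by (auto simp: carrier_B)
  have c: "p i \<in> carrier A" "q i \<in> carrier A" for i using pq by (simp_all add: mem_E)
  have emb: "emb a (unit_vec j) \<in> carrier E" if "a \<in> carrier A" for a j
    using that by (intro emb_closed unit_vec)
  have "enc (emb b (unit_vec 1)) = enc (p \<oplus>\<^bsub>E\<^esub> q)"
    using sum[OF y] pq b by (simp add: twist_gen B_ops)
  then have "\<forall>i. i \<noteq> 3 \<longrightarrow> emb b (unit_vec 1) i = p i \<oplus>\<^bsub>A\<^esub> q i"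
    using enc_eq_iff[OF emb[OF b] E.M.a_closed[OF pq(1,2)]] by (simp add: E_ops)
  then have "emb b (unit_vec 1) 0 = p 0 \<oplus>\<^bsub>A\<^esub> q 0" "emb b (unit_vec 1) 1 = p 1 \<oplus>\<^bsub>A\<^esub> q 1"
    by auto
  then have s: "p 0 \<oplus>\<^bsub>A\<^esub> q 0 = \<zero>\<^bsub>A\<^esub>" "p 1 \<oplus>\<^bsub>A\<^esub> q 1 = b"
    using b by (simp_all add: emb_unit_vec)
  have m: "enc (emb (a \<otimes>\<^bsub>A\<^esub> b) (unit_vec j \<otimes>\<^bsub>C\<^esub> unit_vec 1)) =
      enc (emb a (unit_vec j) \<otimes>\<^bsub>E\<^esub> p \<oplus>\<^bsub>E\<^esub> q \<otimes>\<^bsub>E\<^esub> emb a (unit_vec j))" if a: "a \<in> carrier A" for a j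
  proof -
    have "gen a j \<otimes>\<^bsub>tensor_algebra F A C\<^esub> gen b 1 = T.cl (T.e (a \<otimes>\<^bsub>A\<^esub> b, unit_vec j \<otimes>\<^bsub>C\<^esub> unit_vec 1))"
      using a b by (simp add: T.T_ops T.eP unit_vec T.mult_e_pair)
    then have "twist (gen a j \<otimes>\<^bsub>tensor_algebra F A C\<^esub> gen b 1) = enc (emb (a \<otimes>\<^bsub>A\<^esub> b) (unit_vec j \<otimes>\<^bsub>C\<^esub> unit_vec 1))"
      using a b by (simp add: twist_cl mult_closed unit_vec)
    then show ?thesis
      using mult[OF gen_closed[OF a] y] a pq emb[OF a] by (simp add: twist_gen B_ops mult_closed_E)
  qed
  \<comment> \<open>Compare the \<open>e\<^sub>1\<close>-coefficients for \<open>gen a 0\<close>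
    times \<open>gen b 1\<close>: \<open>ab = a p 1 + q 1 a\<close>, and
    \<open>b = p 1 + q 1\<close> leaves \<open>a q 1 = q 1 a\<close>.\<close>
  have ct: "q 1 \<otimes>\<^bsub>A\<^esub> a = a \<otimes>\<^bsub>A\<^esub> q 1" if a: "a \<in> carrier A" for a
  proof -
    have "enc (emb (a \<otimes>\<^bsub>A\<^esub> b) (unit_vec 1)) =
        enc (emb a (unit_vec 0) \<otimes>\<^bsub>E\<^esub> p \<oplus>\<^bsub>E\<^esub> q \<otimes>\<^bsub>E\<^esub> emb a (unit_vec 0))"
      using m[OF a, of 0] by (simp add: unit_vec(1,2))
    then have "\<forall>i. i \<noteq> 3 \<longrightarrow> emb (a \<otimes>\<^bsub>A\<^esub> b) (unit_vec 1) i =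
        (emb a (unit_vec 0) \<otimes>\<^bsub>E\<^esub> p \<oplus>\<^bsub>E\<^esub> q \<otimes>\<^bsub>E\<^esub> emb a (unit_vec 0)) i"
      using enc_eq_iff[OF emb E.M.a_closed[OF mult_closed_E[OF emb pq(1)] mult_closed_E[OF pq(2) emb]]] a b
      by (simp add: mult_closed)
    then have "emb (a \<otimes>\<^bsub>A\<^esub> b) (unit_vec 1) 1 =
        (emb a (unit_vec 0) \<otimes>\<^bsub>E\<^esub> p \<oplus>\<^bsub>E\<^esub> q \<otimes>\<^bsub>E\<^esub> emb a (unit_vec 0)) 1"
      by (metis one_eq_numeral_iff num.distinct(3))
    then have "a \<otimes>\<^bsub>A\<^esub> b = a \<otimes>\<^bsub>A\<^esub> p 1 \<oplus>\<^bsub>A\<^esub> q 1 \<otimes>\<^bsub>A\<^esub> a"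
      using a b c by (simp add: emb_unit_vec E_ops mult_closed A.l_null A.r_null)
    then have "a \<otimes>\<^bsub>A\<^esub> p 1 \<oplus>\<^bsub>A\<^esub> a \<otimes>\<^bsub>A\<^esub> q 1 = a \<otimes>\<^bsub>A\<^esub> p 1 \<oplus>\<^bsub>A\<^esub> q 1 \<otimes>\<^bsub>A\<^esub> a"
      using a c s(2) by (simp add: A.r_distr flip: s(2))
    then show ?thesis using a c by (simp add: mult_closed)
  qed
  have "enc (emb b \<zero>\<^bsub>C\<^esub>) = enc (emb \<one>\<^bsub>A\<^esub> (unit_vec 2) \<otimes>\<^bsub>E\<^esub> p \<oplus>\<^bsub>E\<^esub> q \<otimes>\<^bsub>E\<^esub> emb \<one>\<^bsub>A\<^esub> (unit_vec 2))"
    using m[OF one_closed, of 2] b by (simp add: unit_vec(3)[unfolded One_nat_def])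
  then have "emb b \<zero>\<^bsub>C\<^esub> 3 \<ominus>\<^bsub>A\<^esub> (emb \<one>\<^bsub>A\<^esub> (unit_vec 2) \<otimes>\<^bsub>E\<^esub> p \<oplus>\<^bsub>E\<^esub> q \<otimes>\<^bsub>E\<^esub> emb \<one>\<^bsub>A\<^esub> (unit_vec 2)) 3 \<in> K"
    using enc_eq_iff[OF emb_closed E.M.a_closed[OF mult_closed_E[OF emb pq(1)] mult_closed_E[OF pq(2) emb]]] b
    by simp
  moreover have "(emb \<one>\<^bsub>A\<^esub> (unit_vec 2) \<otimes>\<^bsub>E\<^esub> p \<oplus>\<^bsub>E\<^esub> q \<otimes>\<^bsub>E\<^esub> emb \<one>\<^bsub>A\<^esub> (unit_vec 2)) 3 = \<ominus>\<^bsub>A\<^esub> (p 1 \<ominus>\<^bsub>A\<^esub> q 1)"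
    using c by (simp add: emb_unit_vec E_ops A.l_null A.r_null a_minus_def M.minus_add)
  ultimately have "p 1 \<ominus>\<^bsub>A\<^esub> q 1 \<in> K"
    using c by (simp add: emb_def a_minus_def)
  then show ?thesis using that[OF pq s] ct c by (auto simp: algebra_center_def)
qed

lemma twist_nearly_standard:
  assumes "nearly_standard_map (tensor_algebra F A C) B twist"
  shows "carrier A = K <+>\<^bsub>A\<^esub> algebra_center A"
proof
  obtain f g where fg: "f \<in> carrier (tensor_algebra F A C) \<rightarrow> carrier B" "g \<in> carrier (tensor_algebra F A C) \<rightarrow> carrier B"
    "\<forall>x\<in>carrier (tensor_algebra F A C). twist x = f x \<oplus>\<^bsub>B\<^esub> g x"
    "\<forall>x\<in>carrier (tensor_algebra F A C). \<forall>y\<in>carrier (tensor_algebra F A C).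
      twist (x \<otimes>\<^bsub>tensor_algebra F A C\<^esub> y) = twist x \<otimes>\<^bsub>B\<^esub> f y \<oplus>\<^bsub>B\<^esub> g y \<otimes>\<^bsub>B\<^esub> twist x"
    using assms unfolding nearly_standard_map_def by blast
  show "carrier A \<subseteq> K <+>\<^bsub>A\<^esub> algebra_center A"
  proof
    fix b assume b: "b \<in> carrier A"
    obtain p q where pq: "p \<in> carrier E" "q \<in> carrier E" "p 1 \<oplus>\<^bsub>A\<^esub> q 1 = b"
      "q 1 \<in> algebra_center A" "p 1 \<ominus>\<^bsub>A\<^esub> q 1 \<in> K"
      using twist_decomposition[OF fg(1,2) bspec[OF fg(3)] bspec[OF bspec[OF fg(4)]] b] by blast
    have c: "p 1 \<in> carrier A" "q 1 \<in> carrier A" using pq by (simp_all add: mem_E)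
    have "q 1 \<oplus>\<^bsub>A\<^esub> q 1 \<in> algebra_center A"
      using pq(4) by (auto simp: algebra_center_def A.l_distr A.r_distr)
    \<comment> \<open>Doubling the central summand makes the remainder the difference that lies in
      \<open>K\<close>.\<close>
    moreover have "b = (p 1 \<ominus>\<^bsub>A\<^esub> q 1) \<oplus>\<^bsub>A\<^esub> (q 1 \<oplus>\<^bsub>A\<^esub> q 1)"
      using c by (simp add: a_minus_def M.a_assoc M.r_neg1 flip: pq(3))
    ultimately show "b \<in> K <+>\<^bsub>A\<^esub> algebra_center A"
      using pq(5) unfolding set_add_def' by blast
  qed
  show "K <+>\<^bsub>A\<^esub> algebra_center A \<subseteq> carrier A"
    using K.a_subset by (auto simp: set_add_def' algebra_center_def)
qed

lemma twist_standard:
  assumes "standard_map F (tensor_algebra F A C) B twist"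
  shows "carrier A = K"
proof -
  interpret E: assoc_algebra F E by (rule assoc_algebra_E)
  obtain f g where fg: "algebra_hom F (tensor_algebra F A C) B f" "algebra_antihom F (tensor_algebra F A C) B g"
    and sum: "\<And>x. x \<in> carrier (tensor_algebra F A C) \<Longrightarrow> twist x = f x \<oplus>\<^bsub>B\<^esub> g x"
    and orth: "\<And>x y. x \<in> carrier (tensor_algebra F A C) \<Longrightarrow> y \<in> carrier (tensor_algebra F A C) \<Longrightarrow>
      f x \<otimes>\<^bsub>B\<^esub> g y = \<zero>\<^bsub>B\<^esub> \<and> g y \<otimes>\<^bsub>B\<^esub> f x = \<zero>\<^bsub>B\<^esub>"
    using assms unfolding standard_map_def by blast
  have f: "f \<in> carrier (tensor_algebra F A C) \<rightarrow> carrier B" "g \<in> carrier (tensor_algebra F A C) \<rightarrow> carrier B"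
    using fg by (auto simp: algebra_hom_def algebra_antihom_def linear_map_def)
  note mult = standard_mult[OF assoc_algebra_B T.mult_T_closed fg sum orth]
  obtain p q where pq: "p \<in> carrier E" "q \<in> carrier E" "f (gen \<one>\<^bsub>A\<^esub> 1) = enc p" "g (gen \<one>\<^bsub>A\<^esub> 1) = enc q"
    "p 0 \<oplus>\<^bsub>A\<^esub> q 0 = \<zero>\<^bsub>A\<^esub>" "p 1 \<oplus>\<^bsub>A\<^esub> q 1 = \<one>\<^bsub>A\<^esub>" "p 1 \<ominus>\<^bsub>A\<^esub> q 1 \<in> K"
    using twist_decomposition[OF f sum mult one_closed] by blast
  note x = gen_closed[OF one_closed, of 0] and y = gen_closed[OF one_closed, of 1]
  obtain r s where rs: "r \<in> carrier E" "s \<in> carrier E" "f (gen \<one>\<^bsub>A\<^esub> 0) = enc r" "g (gen \<one>\<^bsub>A\<^esub> 0) = enc s"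
    using funcset_mem[OF f(1) x] funcset_mem[OF f(2) x] by (auto simp: carrier_B)
  have c: "p i \<in> carrier A" "q i \<in> carrier A" "r i \<in> carrier A" "s i \<in> carrier A" for i
    using pq rs by (simp_all add: mem_E)
  have emb: "emb \<one>\<^bsub>A\<^esub> (unit_vec 0) \<in> carrier E" by (intro emb_closed unit_vec one_closed)
  have "enc (emb \<one>\<^bsub>A\<^esub> (unit_vec 0)) = enc (r \<oplus>\<^bsub>E\<^esub> s)"
    using sum[OF x] rs by (simp add: twist_gen B_ops)
  then have "\<forall>i. i \<noteq> 3 \<longrightarrow> emb \<one>\<^bsub>A\<^esub> (unit_vec 0) i = (r \<oplus>\<^bsub>E\<^esub> s) i"
    using enc_eq_iff[OF emb E.M.a_closed[OF rs(1,2)]] by simp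
  then have "emb \<one>\<^bsub>A\<^esub> (unit_vec 0) 0 = (r \<oplus>\<^bsub>E\<^esub> s) 0" by simp
  then have rs1: "r 0 \<oplus>\<^bsub>A\<^esub> s 0 = \<one>\<^bsub>A\<^esub>" by (simp add: emb_unit_vec E_ops)
  have prod0: "u 0 \<otimes>\<^bsub>A\<^esub> v 0 = \<zero>\<^bsub>A\<^esub>" "u 0 \<otimes>\<^bsub>A\<^esub> v 1 \<oplus>\<^bsub>A\<^esub> u 1 \<otimes>\<^bsub>A\<^esub> v 0 = \<zero>\<^bsub>A\<^esub>"
    if uv: "u \<in> carrier E" "v \<in> carrier E" "enc u \<otimes>\<^bsub>B\<^esub> enc v = \<zero>\<^bsub>B\<^esub>" for u v
  proof -
    have "enc (u \<otimes>\<^bsub>E\<^esub> v) = enc \<zero>\<^bsub>E\<^esub>" using uv by (simp add: B_ops carrier_B)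
    then have "\<forall>i. i \<noteq> 3 \<longrightarrow> (u \<otimes>\<^bsub>E\<^esub> v) i = \<zero>\<^bsub>E\<^esub> i"
      using enc_eq_iff[OF mult_closed_E[OF uv(1,2)] E.M.zero_closed] by simp
    then have "(u \<otimes>\<^bsub>E\<^esub> v) 0 = \<zero>\<^bsub>E\<^esub> 0" "(u \<otimes>\<^bsub>E\<^esub> v) 1 = \<zero>\<^bsub>E\<^esub> 1" by auto
    then show "u 0 \<otimes>\<^bsub>A\<^esub> v 0 = \<zero>\<^bsub>A\<^esub>" "u 0 \<otimes>\<^bsub>A\<^esub> v 1 \<oplus>\<^bsub>A\<^esub> u 1 \<otimes>\<^bsub>A\<^esub> v 0 = \<zero>\<^bsub>A\<^esub>"
      by (simp_all add: E_ops)
  qed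
  have ps: "p 0 \<otimes>\<^bsub>A\<^esub> s 0 = \<zero>\<^bsub>A\<^esub>" "p 0 \<otimes>\<^bsub>A\<^esub> s 1 \<oplus>\<^bsub>A\<^esub> p 1 \<otimes>\<^bsub>A\<^esub> s 0 = \<zero>\<^bsub>A\<^esub>"
    using prod0[OF pq(1) rs(2)] orth[OF y x] pq rs by simp_all
  have qr: "q 0 \<otimes>\<^bsub>A\<^esub> r 0 = \<zero>\<^bsub>A\<^esub>" "q 0 \<otimes>\<^bsub>A\<^esub> r 1 \<oplus>\<^bsub>A\<^esub> q 1 \<otimes>\<^bsub>A\<^esub> r 0 = \<zero>\<^bsub>A\<^esub>"
    using prod0[OF pq(2) rs(1)] orth[OF x y] pq rs by simp_all
  have rs0: "r 0 \<otimes>\<^bsub>A\<^esub> s 0 = \<zero>\<^bsub>A\<^esub>" "s 0 \<otimes>\<^bsub>A\<^esub> r 0 = \<zero>\<^bsub>A\<^esub>"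
    using prod0(1)[OF rs(1,2)] prod0(1)[OF rs(2,1)] orth[OF x x] rs by simp_all
  have q0: "q 0 = \<ominus>\<^bsub>A\<^esub> p 0" using pq(5) c by (metis M.minus_equality M.a_comm)
  \<comment> \<open>\<open>p 0\<close> is annihilated by both \<open>r 0\<close> and
    \<open>s 0\<close>, hence by their sum, the unit. With the constant terms of \<open>p\<close>
    and \<open>q\<close> gone, orthogonality at coordinate 1 identifies \<open>p 1\<close> with
    \<open>r 0\<close> and \<open>q 1\<close> with \<open>s 0\<close>.\<close>
  have "p 0 \<otimes>\<^bsub>A\<^esub> r 0 = \<zero>\<^bsub>A\<^esub>" using qr(1) c by (simp add: q0 A.l_minus)
  then have "p 0 \<otimes>\<^bsub>A\<^esub> (r 0 \<oplus>\<^bsub>A\<^esub> s 0) = \<zero>\<^bsub>A\<^esub>" using ps(1) c by (simp add: A.r_distr)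
  then have p0: "p 0 = \<zero>\<^bsub>A\<^esub>" using c by (simp add: rs1)
  have ps1: "p 1 \<otimes>\<^bsub>A\<^esub> s 0 = \<zero>\<^bsub>A\<^esub>" and qr1: "q 1 \<otimes>\<^bsub>A\<^esub> r 0 = \<zero>\<^bsub>A\<^esub>"
    using ps(2) qr(2) c by (simp_all add: q0 p0 A.l_null mult_closed)
  have "r 0 = (p 1 \<oplus>\<^bsub>A\<^esub> q 1) \<otimes>\<^bsub>A\<^esub> r 0" "s 0 = (p 1 \<oplus>\<^bsub>A\<^esub> q 1) \<otimes>\<^bsub>A\<^esub> s 0"
    unfolding pq(6) using c by simp_all
  then have rp: "r 0 = p 1 \<otimes>\<^bsub>A\<^esub> r 0" and sq: "s 0 = q 1 \<otimes>\<^bsub>A\<^esub> s 0"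
    using c ps1 qr1 by (simp_all add: A.l_distr mult_closed)
  have "p 1 = p 1 \<otimes>\<^bsub>A\<^esub> (r 0 \<oplus>\<^bsub>A\<^esub> s 0)" "q 1 = q 1 \<otimes>\<^bsub>A\<^esub> (r 0 \<oplus>\<^bsub>A\<^esub> s 0)"
    unfolding rs1 using c by simp_all
  then have "p 1 = r 0" "q 1 = s 0"
    using c ps1 qr1 rp sq by (simp_all add: A.r_distr mult_closed)
  then have k: "r 0 \<ominus>\<^bsub>A\<^esub> s 0 \<in> K" using pq(7) by simp
  have "(r 0 \<ominus>\<^bsub>A\<^esub> s 0) \<otimes>\<^bsub>A\<^esub> (r 0 \<ominus>\<^bsub>A\<^esub> s 0) = (r 0 \<oplus>\<^bsub>A\<^esub> s 0) \<otimes>\<^bsub>A\<^esub> (r 0 \<oplus>\<^bsub>A\<^esub> s 0)"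
    using c rs0 by (simp add: a_minus_def A.l_distr A.r_distr A.l_minus A.r_minus mult_closed)
  then have "\<one>\<^bsub>A\<^esub> \<in> K" using K.I_l_closed[OF k, of "r 0 \<ominus>\<^bsub>A\<^esub> s 0"] c by (simp add: rs1)
  then show ?thesis using K.one_imp_carrier by simp
qed

end

lemma (in field) ring_char_eq_2:
  assumes "\<one> \<oplus> \<one> = \<zero>"
  shows "ring_char R = 2"
proof -
  have two: "[(2::nat)] \<cdot>\<^bsub>R\<^esub> \<one> = \<zero>"
    using assms by (simp add: numeral_2_eq_2)
  have "(LEAST n::nat. n > 0 \<and> [n] \<cdot>\<^bsub>R\<^esub> \<one> = \<zero>) = 2"
  proof (rule Least_equality)
    show "2 \<le> n" if "0 < n \<and> [n] \<cdot>\<^bsub>R\<^esub> \<one> = \<zero>" for n :: nat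
    proof (rule ccontr)
      assume "\<not> 2 \<le> n"
      with that have "n = 1" by simp
      with that show False by simp
    qed
  qed (use two in simp)
  then show ?thesis
    unfolding ring_char_def using two by (auto intro: exI[of _ 2])
qed

theorem corollary2p14:
  fixes F :: "'f ring" and A :: "('f, 'a) module"
  assumes "field F" and "ring_char F \<noteq> 2" and "unital_assoc_algebra F A"
  shows
    "(carrier A = commutator_ideal A \<longrightarrow>
       (\<forall>(C :: ('f, 'c) module) (B :: ('f, 'b) module) \<phi>.
          algebra F C \<and> assoc_algebra F B \<and> jordan_hom F (tensor_algebra F A C) B \<phi> \<and>
          \<phi> ` carrier (tensor_algebra F A C) = carrier B \<longrightarrow>
          standard_map F (tensor_algebra F A C) B \<phi>))
   \<and> (carrier A = commutator_ideal A \<longrightarrow>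
       (\<forall>(C :: ('f, 'c) module) (B :: ('f, 'b) module) \<phi>.
          algebra F C \<and> assoc_algebra F B \<and> jordan_hom F (tensor_algebra F A C) B \<phi> \<longrightarrow>
          nearly_standard_map (tensor_algebra F A C) B \<phi>))
   \<and> (carrier A \<noteq> commutator_ideal A \<longrightarrow>
       (\<exists>(C :: ('f, 'f scalar_seq) module) (B :: ('f, 'a coset_seq) module) \<phi>.
          algebra F C \<and> assoc_algebra F B \<and> jordan_hom F (tensor_algebra F A C) B \<phi> \<and>
          \<not> standard_map F (tensor_algebra F A C) B \<phi>))
   \<and> (carrier A \<noteq> commutator_ideal A <+>\<^bsub>A\<^esub> algebra_center A \<longrightarrow>
       (\<exists>(C :: ('f, 'f scalar_seq) module) (B :: ('f, 'a coset_seq) module) \<phi>.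
          algebra F C \<and> assoc_algebra F B \<and> jordan_hom F (tensor_algebra F A C) B \<phi> \<and>
          \<not> nearly_standard_map (tensor_algebra F A C) B \<phi>))"
proof -
  interpret F: field F by (rule assms(1))
  interpret unital_assoc_algebra F A by (rule assms(3))
  have two: "\<one>\<^bsub>F\<^esub> \<oplus>\<^bsub>F\<^esub> \<one>\<^bsub>F\<^esub> \<noteq> \<zero>\<^bsub>F\<^esub>"
    using assms(2) F.ring_char_eq_2 by blast
  have standard: "standard_map F (tensor_algebra F A C) B \<phi>"
    and nearly_standard: "nearly_standard_map (tensor_algebra F A C) B \<phi>"
    if "carrier A = commutator_ideal A" "algebra F C" "assoc_algebra F B"
      "jordan_hom F (tensor_algebra F A C) B \<phi>"
    for C :: "('f, 'c) module" and B :: "('f, 'b) module" and \<phi>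
  proof -
    interpret T: tensor_setup F A C
      using assms(3) that(2) by (rule tensor_setup.intro)
    show *: "standard_map F (tensor_algebra F A C) B \<phi>"
      using T.jordan_hom_T_standard two that by blast
    show "nearly_standard_map (tensor_algebra F A C) B \<phi>"
      by (rule standard_imp_nearly_standard[OF that(3) T.mult_T_closed *])
  qed
  \<comment> \<open>The same \<open>C\<close>, \<open>B\<close> and \<open>twist\<close> witness
    both negative parts, so they are produced once.\<close>
  have "\<exists>(C :: ('f, 'f scalar_seq) module) (B :: ('f, 'a coset_seq) module) \<phi>.
      algebra F C \<and> assoc_algebra F B \<and> jordan_hom F (tensor_algebra F A C) B \<phi> \<and>
      (carrier A \<noteq> commutator_ideal A \<longrightarrow> \<not> standard_map F (tensor_algebra F A C) B \<phi>) \<and>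
      (carrier A \<noteq> commutator_ideal A <+>\<^bsub>A\<^esub> algebra_center A \<longrightarrow>
        \<not> nearly_standard_map (tensor_algebra F A C) B \<phi>)"
    using F.algebra_trivial_extension assoc_algebra_B jordan_hom_twist twist_standard twist_nearly_standard
    by blast
  with standard nearly_standard show ?thesis by blast
qed

end
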